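(* For every $u\in H^{1/2}_+$ and every positive integer $n$, set $J_n(u)=(H_u^n(1)|1)$. If $u\in C(\mathbb R,H^{1/2}_+)$ solves $i\partial_tu=\Pi(|u|^2u)$, then, for every positive integer $k$, $$\frac{d}{dt}J_{2k}(u)=0,\qquad i\frac{d}{dt}J_{2k-1}(u)=J_{2k+1}(u).$$
   Context: $\mathbb S^1$ is the unit circle in $\mathbb C$, $(u|v)=\int_{\mathbb S^1}u\overline v\,\frac{d\theta}{2\pi}$. $E_+$ denotes the subspace of elements $u$ of a space $E$ of distributions on $\mathbb S^1$ with $\hat u(k)=0$ for all $k<0$; $L^2_+$ is the Hardy space, $H^{1/2}_+=(H^{1/2}(\mathbb S^1))_+$; $\Pi:L^2(\mathbb S^1)\to L^2_+$ is the orthogonal projector. For $u\in H^{1/2}_+$, the Hankel operator $H_u$ is the $\mathbb C$-antilinear operator on $L^2_+$ given by $H_u(h)=\Pi(u\overline h)$; $1$ is the constant function. *)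

theory Defs
  imports "HOL-Analysis.Analysis"
begin

text \<open>
  Functions on the unit circle are represented by functions on \<^typ>\<open>complex\<close>; only the values
  there matter, and elements of the function spaces below are representatives of
  classes modulo equality almost everywhere.
\<close>

definition circle :: "complex measure" where
  "circle = distr (uniform_measure lborel {0..2 * pi}) (restrict_space borel (sphere 0 1)) cis"

definition ip :: "(complex \<Rightarrow> complex) \<Rightarrow> (complex \<Rightarrow> complex) \<Rightarrow> complex" where
  "ip u v = (LINT z|circle. u z * cnj (v z))"

definition fhat :: "(complex \<Rightarrow> complex) \<Rightarrow> int \<Rightarrow> complex" where
  "fhat u k = ip u (\<lambda>z. z powi k)"

definition L2 :: "(complex \<Rightarrow> complex) set" where
  "L2 = {u \<in> borel_measurable circle. integrable circle (\<lambda>z. (cmod (u z))\<^sup>2)}"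

definition plus_part :: "(complex \<Rightarrow> complex) set \<Rightarrow> (complex \<Rightarrow> complex) set" where
  "plus_part E = {u \<in> E. \<forall>k<0. fhat u k = 0}"

text \<open>
  A distribution whose Fourier coefficients satisfy the condition below is an \<open>L\<^sup>2\<close> function,
  so nothing is lost by taking \<open>H\<^sup>1\<^sup>/\<^sup>2\<close> inside \<^term>\<open>L2\<close>.
\<close>

definition H_half :: "(complex \<Rightarrow> complex) set" where
  "H_half = {u \<in> L2. (\<lambda>k. sqrt (1 + (real_of_int k)\<^sup>2) * (cmod (fhat u k))\<^sup>2) summable_on UNIV}"

definition H_half_norm :: "(complex \<Rightarrow> complex) \<Rightarrow> real" where
  "H_half_norm u = sqrt (\<Sum>\<^sub>\<infinity>k. sqrt (1 + (real_of_int k)\<^sup>2) * (cmod (fhat u k))\<^sup>2)"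

text \<open>
  The projector is orthogonal projection on \<^term>\<open>L2\<close>. For \<open>u\<close> in \<open>H\<^sup>1\<^sup>/\<^sup>2\<close> and \<open>h\<close> in \<open>L\<^sup>2\<close> the
  product of \<open>u\<close> with the conjugate of \<open>h\<close> is in general only integrable; there the projector is
  extended, as usual, by discarding the Fourier coefficients of negative index. In both cases the
  conditions determine \<open>g\<close> up to equality almost everywhere.
\<close>

definition is_szego_proj :: "(complex \<Rightarrow> complex) \<Rightarrow> (complex \<Rightarrow> complex) \<Rightarrow> bool" where
  "is_szego_proj f g \<longleftrightarrow> g \<in> plus_part L2 \<and>
     (if f \<in> L2 then \<forall>h \<in> plus_part L2. ip (\<lambda>z. f z - g z) h = 0
      else \<forall>k\<ge>0. fhat g k = fhat f k)"

definition szego_proj :: "(complex \<Rightarrow> complex) \<Rightarrow> complex \<Rightarrow> complex" where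
  "szego_proj f = (SOME g. is_szego_proj f g)"

definition hankel :: "(complex \<Rightarrow> complex) \<Rightarrow> (complex \<Rightarrow> complex) \<Rightarrow> complex \<Rightarrow> complex" where
  "hankel u h = szego_proj (\<lambda>z. u z * cnj (h z))"

definition J :: "nat \<Rightarrow> (complex \<Rightarrow> complex) \<Rightarrow> complex" where
  "J n u = ip ((hankel u ^^ n) (\<lambda>_. 1)) (\<lambda>_. 1)"

definition continuous_into_H_half_plus :: "(real \<Rightarrow> complex \<Rightarrow> complex) \<Rightarrow> bool" where
  "continuous_into_H_half_plus u \<longleftrightarrow> (\<forall>t. u t \<in> plus_part H_half) \<and>
     (\<forall>t. ((\<lambda>s. H_half_norm (\<lambda>z. u s z - u t z)) \<longlongrightarrow> 0) (at t))"

text \<open>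
  The time derivative is taken in the sense of distributions on the circle, tested on the
  exponentials. This is implied by differentiability in time with respect to the \<open>L\<^sup>2\<close> norm.
\<close>

definition solves_szego :: "(real \<Rightarrow> complex \<Rightarrow> complex) \<Rightarrow> bool" where
  "solves_szego u \<longleftrightarrow> (\<forall>t k. (\<lambda>s. fhat (u s) k) differentiable (at t) \<and>
     \<i> * vector_derivative (\<lambda>s. fhat (u s) k) (at t) =
       fhat (szego_proj (\<lambda>z. complex_of_real ((cmod (u t z))\<^sup>2) * u t z)) k)"

end

theory Submission
  imports Defs
begin

text \<open>
  Write \<open>a\<close> for the sequence of Fourier coefficients of \<open>u\<close> and \<open>H\<close> for the antilinear Hankel operator
  \<open>(H p) n = (\<Sum>l. a (n + l) * cnj (p l))\<close>, so that \<open>J\<^sub>n\<close> is the zeroth entry of \<open>H\<^sup>n e\<^sub>0\<close>. The symmetry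
  \<open>(H p | q) = (H q | p) = (a | p * q)\<close>, with \<open>p * q\<close> the convolution, turns a difference quotient of
  \<open>J\<^sub>n\<close> into a finite sum of terms \<open>((a s - a t) / (s - t) | p * q)\<close> with \<open>p\<close> and \<open>q\<close> of the form \<open>H\<^sup>j e\<^sub>0\<close>.
  For \<open>u\<close> merely in \<open>H\<^sup>1\<^sup>/\<^sup>2\<close> the Hankel operator whose symbol is the cubic nonlinearity need not be
  bounded on \<open>L\<^sup>2\<close>, so the Lax pair is not directly available; but \<open>H\<close> is bounded on \<open>H\<^sup>1\<^sup>/\<^sup>4\<close>, the convolution of two
  elements of \<open>H\<^sup>1\<^sup>/\<^sup>4\<close> is square summable, and the nonlinearity is square summable. So the difference quotients
  of \<open>a\<close> converge weakly, the convolutions strongly, and only terms \<open>(G | p * q)\<close> remain, \<open>G\<close> being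
  the nonlinearity. Inclusion-exclusion on the indices of the five-fold sum gives
  \<open>(G | p * q) = (a * H p | a * q) + (a * H q | a * p) - (H q | H (H p))\<close>, which replaces the Lax pair, and the sum
  telescopes.
\<close>

section \<open>Weighted sequence spaces\<close>

text \<open>The exponent 1/4 comes from a Hilbert-Schmidt bound: with weights sqrt(n + 1) on both
  sides, the squared Hilbert-Schmidt norm of a Hankel matrix is at most a constant times the sum of
  (m + 1) |a m|^2, exactly what a symbol in H^(1/2) offers. The telescoping comes from
  antilinearity: each transfer of \<open>H\<close> across the pairing conjugates, and conjugation
  turns the factor \<open>- \<i>\<close> of the equation into \<open>\<i>\<close>. So the summands
  alternate in sign, and the first two terms of the identity cancel between neighbours. The two ends
  are \<open>J (n + 2)\<close> up to conjugation. On the function side, u^2 is a priori only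
  integrable. Its coefficients are square summable, so it agrees almost everywhere with an L^2
  function, provided that integrable functions are determined by their Fourier coefficients; this
  replaces the embedding of H^(1/2) into L^4. The equation is given one coefficient at a time. That
  the difference quotients stay bounded in l^2 has to be extracted from a local bound on the
  nonlinearity by a mean value inequality.\<close>

definition wsummable :: "(nat \<Rightarrow> real) \<Rightarrow> (nat \<Rightarrow> complex) \<Rightarrow> bool" where
  "wsummable W c \<longleftrightarrow> summable (\<lambda>n. W n * (cmod (c n))\<^sup>2)"

text \<open>A \<open>suminf\<close> carries information only for summable terms; hence bounds on
  \<open>wsq\<close> come together with \<open>wsummable\<close>.\<close>

definition wsq :: "(nat \<Rightarrow> real) \<Rightarrow> (nat \<Rightarrow> complex) \<Rightarrow> real" where
  "wsq W c = (\<Sum>n. W n * (cmod (c n))\<^sup>2)"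

text \<open>
  The weights of \<open>L\<^sup>2\<close>, \<open>H\<^sup>1\<^sup>/\<^sup>4\<close> and \<open>H\<^sup>1\<^sup>/\<^sup>2\<close>.
\<close>

definition W0 :: "nat \<Rightarrow> real" where "W0 n = 1"
definition Wh :: "nat \<Rightarrow> real" where "Wh n = sqrt (real n + 1)"
definition W1 :: "nat \<Rightarrow> real" where "W1 n = real n + 1"

definition sdot :: "(nat \<Rightarrow> complex) \<Rightarrow> (nat \<Rightarrow> complex) \<Rightarrow> complex" where
  "sdot f g = (\<Sum>n. f n * cnj (g n))"

definition sconv :: "(nat \<Rightarrow> complex) \<Rightarrow> (nat \<Rightarrow> complex) \<Rightarrow> nat \<Rightarrow> complex" where
  "sconv p q n = (\<Sum>i\<le>n. p i * q (n - i))"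

definition shankel :: "(nat \<Rightarrow> complex) \<Rightarrow> (nat \<Rightarrow> complex) \<Rightarrow> nat \<Rightarrow> complex" where
  "shankel a p n = (\<Sum>l. a (n + l) * cnj (p l))"

lemma W_pos [simp]: "W0 n > 0" "Wh n > 0" "W1 n > 0"
  by (auto simp: W0_def Wh_def W1_def intro: add_nonneg_pos)

lemma W_nonneg [simp]: "W0 n \<ge> 0" "Wh n \<ge> 0" "W1 n \<ge> 0"
  by (auto simp: W0_def Wh_def W1_def)

lemma W_neq_0 [simp]: "W0 n \<noteq> 0" "Wh n \<noteq> 0" "W1 n \<noteq> 0"
  by (metis W_pos less_irrefl)+

lemma W_le: "W0 n \<le> Wh n" "Wh n \<le> W1 n"
proof -
  show "W0 n \<le> Wh n" by (simp add: W0_def Wh_def)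
  have "sqrt (real n + 1) \<le> sqrt ((real n + 1)^2)"
    by (rule real_sqrt_le_mono) (simp add: power2_eq_square)
  then show "Wh n \<le> W1 n" by (simp add: Wh_def W1_def)
qed

lemma Wh_sq: "Wh n * Wh n = W1 n"
  by (simp add: Wh_def W1_def)

lemma wsummable_boundI:
  assumes "\<And>n. W n \<ge> 0" "\<And>N. (\<Sum>n<N. W n * (cmod (c n))\<^sup>2) \<le> B"
  shows "wsummable W c" "wsq W c \<le> B"
proof -
  have "summable (\<lambda>n. W n * (cmod (c n))\<^sup>2)"
    by (rule summableI_nonneg_bounded[where x = B]) (use assms in auto)
  then show "wsummable W c" "wsq W c \<le> B"
    unfolding wsummable_def wsq_def using assms by (auto intro: suminf_le_const)
qed

lemma wsq_nonneg: "(\<And>n. W n \<ge> 0) \<Longrightarrow> wsummable W c \<Longrightarrow> wsq W c \<ge> 0"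
  unfolding wsq_def wsummable_def by (auto intro!: suminf_nonneg)

lemma wsq_partial:
  assumes "\<And>n. W n \<ge> 0" "wsummable W c"
  shows "finite A \<Longrightarrow> (\<Sum>n\<in>A. W n * (cmod (c n))\<^sup>2) \<le> wsq W c"
  unfolding wsq_def
  by (rule sum_le_suminf) (use assms in \<open>auto simp: wsummable_def\<close>)

lemma wsq_mono_weight:
  assumes "\<And>n. 0 \<le> W n" "\<And>n. W n \<le> W' n" "wsummable W' c"
  shows "wsummable W c" "wsq W c \<le> wsq W' c"
proof -
  have "(\<Sum>n<N. W n * (cmod (c n))\<^sup>2) \<le> wsq W' c" for N
  proof -
    have "(\<Sum>n<N. W n * (cmod (c n))\<^sup>2) \<le> (\<Sum>n<N. W' n * (cmod (c n))\<^sup>2)"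
      by (intro sum_mono mult_right_mono assms) auto
    also have "\<dots> \<le> wsq W' c"
      by (rule wsq_partial) (use assms order_trans in blast)+
    finally show ?thesis .
  qed
  from wsummable_boundI[OF assms(1) this] show "wsummable W c" "wsq W c \<le> wsq W' c" by auto
qed

lemma cmod_add_sq_le: "(cmod (x + y))\<^sup>2 \<le> 2 * (cmod x)\<^sup>2 + 2 * (cmod y)\<^sup>2"
proof -
  have "(cmod (x + y))\<^sup>2 \<le> (cmod x + cmod y)\<^sup>2"
    by (rule power_mono) (auto intro: norm_triangle_ineq)
  also have "\<dots> \<le> 2 * (cmod x)\<^sup>2 + 2 * (cmod y)\<^sup>2"
    using sum_squares_bound[of "cmod x" "cmod y"] by (simp add: power2_sum)
  finally show ?thesis .
qed

lemma wsq_add: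
  assumes "\<And>n. W n \<ge> 0" "wsummable W f" "wsummable W g"
  shows "wsummable W (\<lambda>n. f n + g n)" "wsq W (\<lambda>n. f n + g n) \<le> 2 * wsq W f + 2 * wsq W g"
proof -
  have "(\<Sum>n<N. W n * (cmod (f n + g n))\<^sup>2) \<le> 2 * wsq W f + 2 * wsq W g" for N
  proof -
    have "(\<Sum>n<N. W n * (cmod (f n + g n))\<^sup>2) \<le>
        (\<Sum>n<N. W n * (2 * (cmod (f n))\<^sup>2 + 2 * (cmod (g n))\<^sup>2))"
      by (intro sum_mono mult_left_mono cmod_add_sq_le assms)
    also have "\<dots> = 2 * (\<Sum>n<N. W n * (cmod (f n))\<^sup>2) + 2 * (\<Sum>n<N. W n * (cmod (g n))\<^sup>2)"
      by (simp add: sum_distrib_left sum.distrib algebra_simps)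
    also have "\<dots> \<le> 2 * wsq W f + 2 * wsq W g"
      by (intro add_mono mult_left_mono wsq_partial assms) auto
    finally show ?thesis .
  qed
  from wsummable_boundI[OF assms(1) this]
  show "wsummable W (\<lambda>n. f n + g n)" "wsq W (\<lambda>n. f n + g n) \<le> 2 * wsq W f + 2 * wsq W g" by auto
qed

lemma wsq_cmult:
  assumes "wsummable W f"
  shows "wsummable W (\<lambda>n. c * f n)" "wsq W (\<lambda>n. c * f n) = (cmod c)\<^sup>2 * wsq W f"
proof -
  have eq: "(\<lambda>n. W n * (cmod (c * f n))\<^sup>2) = (\<lambda>n. (cmod c)\<^sup>2 * (W n * (cmod (f n))\<^sup>2))"
    by (auto simp: norm_mult power_mult_distrib)
  show "wsummable W (\<lambda>n. c * f n)"
    using assms unfolding wsummable_def eq by (rule summable_mult)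
  show "wsq W (\<lambda>n. c * f n) = (cmod c)\<^sup>2 * wsq W f"
    using assms unfolding wsummable_def wsq_def eq by (rule suminf_mult)
qed

lemma wsummable_uminus: "wsummable W (\<lambda>n. - f n) = wsummable W f"
  and wsq_uminus: "wsq W (\<lambda>n. - f n) = wsq W f"
  by (simp_all add: wsummable_def wsq_def)

lemma wsq_diff:
  assumes "\<And>n. W n \<ge> 0" "wsummable W f" "wsummable W g"
  shows "wsummable W (\<lambda>n. f n - g n)" "wsq W (\<lambda>n. f n - g n) \<le> 2 * wsq W f + 2 * wsq W g"
  using wsq_add[OF assms(1,2), of "\<lambda>n. - g n"] assms(3) by (simp_all add: wsummable_uminus wsq_uminus)

section \<open>Weighted Cauchy-Schwarz inequalities and boundedness of Hankel operators and
  convolutions\<close>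

lemma weighted_Cauchy_sum:
  fixes x y \<beta> :: "nat \<Rightarrow> real"
  assumes "\<And>i. \<beta> i > 0"
  shows "(\<Sum>i\<in>A. x i * y i)\<^sup>2 \<le> (\<Sum>i\<in>A. (x i)\<^sup>2 / \<beta> i) * (\<Sum>i\<in>A. \<beta> i * (y i)\<^sup>2)"
proof -
  have "(\<Sum>i\<in>A. (x i / sqrt (\<beta> i)) * (sqrt (\<beta> i) * y i))\<^sup>2 \<le>
      (\<Sum>i\<in>A. (x i / sqrt (\<beta> i))\<^sup>2) * (\<Sum>i\<in>A. (sqrt (\<beta> i) * y i)\<^sup>2)"
    by (rule Cauchy_Schwarz_ineq_sum)
  moreover have "sqrt (\<beta> i) \<noteq> 0" "(sqrt (\<beta> i))\<^sup>2 = \<beta> i" for i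
    using assms[of i] by auto
  ultimately show ?thesis
    by (simp add: power_divide power_mult_distrib)
qed

lemma weighted_Cauchy_suminf:
  fixes x y :: "nat \<Rightarrow> complex" and \<beta> :: "nat \<Rightarrow> real"
  assumes \<beta>: "\<And>i. \<beta> i > 0"
    and x: "summable (\<lambda>i. (cmod (x i))\<^sup>2 / \<beta> i)" and y: "wsummable \<beta> y"
  shows "summable (\<lambda>i. cmod (x i * y i))" "summable (\<lambda>i. x i * y i)"
    "(cmod (\<Sum>i. x i * y i))\<^sup>2 \<le> (\<Sum>i. (cmod (x i))\<^sup>2 / \<beta> i) * wsq \<beta> y"
proof -
  let ?B = "(\<Sum>i. (cmod (x i))\<^sup>2 / \<beta> i) * wsq \<beta> y"
  have nn: "\<beta> i \<ge> 0" for i using \<beta>[of i] by simp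
  have p1: "(\<Sum>i<N. (cmod (x i))\<^sup>2 / \<beta> i) \<le> (\<Sum>i. (cmod (x i))\<^sup>2 / \<beta> i)" for N
    by (rule sum_le_suminf[OF x]) (use nn in auto)
  have p0: "0 \<le> (\<Sum>i. (cmod (x i))\<^sup>2 / \<beta> i)"
    by (rule suminf_nonneg[OF x]) (use nn in auto)
  have bd: "(\<Sum>i<N. cmod (x i * y i)) \<le> sqrt ?B" for N
  proof (rule real_le_rsqrt)
    have "(\<Sum>i<N. cmod (x i * y i))\<^sup>2 \<le>
        (\<Sum>i<N. (cmod (x i))\<^sup>2 / \<beta> i) * (\<Sum>i<N. \<beta> i * (cmod (y i))\<^sup>2)"
      using weighted_Cauchy_sum[OF \<beta>, of "\<lambda>i. cmod (x i)" "\<lambda>i. cmod (y i)" "{..<N}"]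
      by (simp add: norm_mult)
    also have "\<dots> \<le> ?B"
      by (intro mult_mono p1 p0 wsq_partial nn y sum_nonneg) (use nn in auto)
    finally show "(\<Sum>i<N. cmod (x i * y i))\<^sup>2 \<le> ?B" .
  qed
  show s: "summable (\<lambda>i. cmod (x i * y i))"
    by (rule summableI_nonneg_bounded[OF _ bd]) auto
  then show "summable (\<lambda>i. x i * y i)"
    by (rule summable_norm_cancel)
  have "cmod (\<Sum>i. x i * y i) \<le> (\<Sum>i. cmod (x i * y i))"
    by (rule summable_norm[OF s])
  also have "\<dots> \<le> sqrt ?B"
    by (rule suminf_le_const[OF s bd])
  finally have "(cmod (\<Sum>i. x i * y i))\<^sup>2 \<le> (sqrt ?B)\<^sup>2"
    by (rule power_mono) auto
  also have "\<dots> = ?B"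
    using p0 wsq_nonneg[OF nn y] by simp
  finally show "(cmod (\<Sum>i. x i * y i))\<^sup>2 \<le> ?B" .
qed

lemma wsummable_cnj [simp]: "wsummable W (\<lambda>n. cnj (f n)) = wsummable W f"
  and wsq_cnj [simp]: "wsq W (\<lambda>n. cnj (f n)) = wsq W f"
  by (simp_all add: wsummable_def wsq_def)

lemma sdot_Cauchy:
  assumes "wsummable W0 f" "wsummable W0 g"
  shows "summable (\<lambda>n. f n * cnj (g n))" "(cmod (sdot f g))\<^sup>2 \<le> wsq W0 f * wsq W0 g"
  using weighted_Cauchy_suminf[of W0 f "\<lambda>n. cnj (g n)"] assms
  by (auto simp: sdot_def wsq_def wsummable_def W0_def)

text \<open>A box lies in a triangle and a triangle in a box. For nonnegative terms this passes
  between row sums and diagonal sums without any infinite double series.\<close>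

lemma sum_antidiagonal_le:
  fixes g :: "nat \<Rightarrow> nat \<Rightarrow> real"
  assumes "\<And>i j. g i j \<ge> 0"
  shows "(\<Sum>i<M. \<Sum>j<L. g i j) \<le> (\<Sum>k<M + L. \<Sum>i\<le>k. g i (k - i))"
    and "(\<Sum>k<N. \<Sum>i\<le>k. g i (k - i)) \<le> (\<Sum>i<N. \<Sum>j<N. g i j)"
proof -
  have fin: "finite {(i, j). i + j < (N::nat)}" for N
    by (rule finite_subset[of _ "{..<N} \<times> {..<N}"]) auto
  have "(\<Sum>i<M. \<Sum>j<L. g i j) = sum (\<lambda>(i, j). g i j) ({..<M} \<times> {..<L})"
    by (simp add: sum.cartesian_product)
  also have "\<dots> \<le> sum (\<lambda>(i, j). g i j) {(i, j). i + j < M + L}"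
    by (rule sum_mono2) (use fin assms in auto)
  finally show "(\<Sum>i<M. \<Sum>j<L. g i j) \<le> (\<Sum>k<M + L. \<Sum>i\<le>k. g i (k - i))"
    by (simp add: sum.triangle_reindex)
  have "sum (\<lambda>(i, j). g i j) {(i, j). i + j < N} \<le> sum (\<lambda>(i, j). g i j) ({..<N} \<times> {..<N})"
    by (rule sum_mono2) (use assms in auto)
  then show "(\<Sum>k<N. \<Sum>i\<le>k. g i (k - i)) \<le> (\<Sum>i<N. \<Sum>j<N. g i j)"
    by (simp add: sum.cartesian_product sum.triangle_reindex)
qed

text \<open>Hilbert-Schmidt bound for the matrix with entries \<open>a (n + l)\<close>, weighted by
  \<open>\<gamma> n / \<beta> l\<close>. Collecting the entries with \<open>n + l = m\<close> gives
  |a m|^2 the total weight on the left of the hypothesis on \<open>C\<close>.\<close>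

lemma shankel_estimate:
  fixes \<alpha> \<beta> \<gamma> :: "nat \<Rightarrow> real"
  assumes pos: "\<And>n. \<alpha> n > 0" "\<And>n. \<beta> n > 0" "\<And>n. \<gamma> n > 0"
    and C: "\<And>m. (\<Sum>l\<le>m. \<gamma> (m - l) / \<beta> l) \<le> C * \<alpha> m"
    and a: "wsummable \<alpha> a" and p: "wsummable \<beta> p"
  shows "summable (\<lambda>l. a (n + l) * cnj (p l))"
    "wsummable \<gamma> (shankel a p)" "wsq \<gamma> (shankel a p) \<le> C * wsq \<alpha> a * wsq \<beta> p"
proof -
  have nn: "\<alpha> n \<ge> 0" "\<beta> n \<ge> 0" "\<gamma> n \<ge> 0" for n
    using pos less_imp_le by blast+
  have C0: "C \<ge> 0"
  proof -
    have "0 \<le> \<gamma> 0 / \<beta> 0" using nn by auto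
    also have "\<dots> \<le> C * \<alpha> 0" using C[of 0] by simp
    finally show ?thesis using pos(1)[of 0] by (simp add: zero_le_mult_iff)
  qed
  \<comment> \<open>\<open>K n\<close> is the squared norm of row \<open>n\<close>, weighted by
    \<open>1 / \<beta> l\<close>.\<close>
  define K where "K n = (\<Sum>l. (cmod (a (n + l)))\<^sup>2 / \<beta> l)" for n
  have sm: "summable (\<lambda>l. (cmod (a (n + l)))\<^sup>2 / \<beta> l)" for n
  proof (rule summable_comparison_test'[where N = 0])
    have "summable (\<lambda>l. \<alpha> (n + l) * (cmod (a (n + l)))\<^sup>2)"
      using a summable_ignore_initial_segment[of "\<lambda>l. \<alpha> l * (cmod (a l))\<^sup>2" n]
      by (simp add: wsummable_def add.commute)
    then show "summable (\<lambda>l. C / \<gamma> n * (\<alpha> (n + l) * (cmod (a (n + l)))\<^sup>2))"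
      by (rule summable_mult)
    fix l :: nat
    \<comment> \<open>A single term of the hypothesis on \<open>C\<close> bounds
      \<open>1 / \<beta> l\<close> by a multiple of \<open>\<alpha> (n + l)\<close>, so each row
      inherits summability from \<open>a\<close>.\<close>
    have "\<gamma> n / \<beta> l \<le> (\<Sum>l'\<le>n + l. \<gamma> (n + l - l') / \<beta> l')"
      using member_le_sum[of l "{..n + l}" "\<lambda>l'. \<gamma> (n + l - l') / \<beta> l'"] nn by auto
    also have "\<dots> \<le> C * \<alpha> (n + l)" by (rule C)
    finally have "1 / \<beta> l \<le> C / \<gamma> n * \<alpha> (n + l)"
      using pos(3)[of n] by (simp add: field_simps)
    from mult_right_mono[OF this, of "(cmod (a (n + l)))\<^sup>2"]
    show "norm ((cmod (a (n + l)))\<^sup>2 / \<beta> l) \<le> C / \<gamma> n * (\<alpha> (n + l) * (cmod (a (n + l)))\<^sup>2)"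
      using nn by (simp add: mult.assoc)
  qed
  have p': "wsummable \<beta> (\<lambda>n. cnj (p n))" using p by simp
  note cs = weighted_Cauchy_suminf[OF pos(2) sm p']
  show "summable (\<lambda>l. a (n + l) * cnj (p l))" by (rule cs)
  have pt: "(cmod (shankel a p n))\<^sup>2 \<le> K n * wsq \<beta> p" for n
    using cs(3)[of n] by (simp add: shankel_def K_def)
  have K: "(\<Sum>n<M. \<gamma> n * K n) \<le> C * wsq \<alpha> a" for M
  proof -
    have "(\<Sum>n<M. \<gamma> n * K n) = (\<Sum>n<M. \<Sum>l. \<gamma> n * ((cmod (a (n + l)))\<^sup>2 / \<beta> l))"
      unfolding K_def by (intro sum.cong refl suminf_mult[symmetric] sm)
    also have "\<dots> = (\<Sum>l. \<Sum>n<M. \<gamma> n * ((cmod (a (n + l)))\<^sup>2 / \<beta> l))"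
      by (intro suminf_sum[symmetric] summable_mult sm)
    also have "\<dots> \<le> C * wsq \<alpha> a"
    proof (rule suminf_le_const)
      show "summable (\<lambda>l. \<Sum>n<M. \<gamma> n * ((cmod (a (n + l)))\<^sup>2 / \<beta> l))"
        by (intro summable_sum summable_mult sm)
      fix L
      \<comment> \<open>Regrouping a finite box along \<open>k = n + l\<close> produces the sum that
        the hypothesis on \<open>C\<close> controls.\<close>
      have "(\<Sum>l<L. \<Sum>n<M. \<gamma> n * ((cmod (a (n + l)))\<^sup>2 / \<beta> l)) \<le>
          (\<Sum>k<L + M. \<Sum>l\<le>k. \<gamma> (k - l) * ((cmod (a (k - l + l)))\<^sup>2 / \<beta> l))"
        by (rule sum_antidiagonal_le) (use nn in auto)
      also have "\<dots> = (\<Sum>k<L + M. (\<Sum>l\<le>k. \<gamma> (k - l) / \<beta> l) * (cmod (a k))\<^sup>2)"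
        by (auto intro!: sum.cong simp: sum_distrib_right)
      also have "\<dots> \<le> (\<Sum>k<L + M. C * \<alpha> k * (cmod (a k))\<^sup>2)"
        by (intro sum_mono mult_right_mono C) auto
      also have "\<dots> = C * (\<Sum>k<L + M. \<alpha> k * (cmod (a k))\<^sup>2)"
        by (simp add: sum_distrib_left mult.assoc)
      also have "\<dots> \<le> C * wsq \<alpha> a"
        by (intro mult_left_mono wsq_partial a nn C0) auto
      finally show "(\<Sum>l<L. \<Sum>n<M. \<gamma> n * ((cmod (a (n + l)))\<^sup>2 / \<beta> l)) \<le> C * wsq \<alpha> a" .
    qed
    finally show ?thesis .
  qed
  have "(\<Sum>n<M. \<gamma> n * (cmod (shankel a p n))\<^sup>2) \<le> C * wsq \<alpha> a * wsq \<beta> p" for M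
  proof -
    have "(\<Sum>n<M. \<gamma> n * (cmod (shankel a p n))\<^sup>2) \<le> (\<Sum>n<M. \<gamma> n * (K n * wsq \<beta> p))"
      by (intro sum_mono mult_left_mono pt nn)
    also have "\<dots> = (\<Sum>n<M. \<gamma> n * K n) * wsq \<beta> p"
      by (simp add: sum_distrib_right mult.assoc)
    also have "\<dots> \<le> C * wsq \<alpha> a * wsq \<beta> p"
      by (intro mult_right_mono K wsq_nonneg nn p)
    finally show ?thesis .
  qed
  from wsummable_boundI[OF nn(3) this]
  show "wsummable \<gamma> (shankel a p)" "wsq \<gamma> (shankel a p) \<le> C * wsq \<alpha> a * wsq \<beta> p"
    by auto
qed

text \<open>Cauchy-Schwarz on each diagonal: the hypothesis on \<open>C\<close> bounds the factor
  with the inverse weights uniformly in \<open>n\<close>, and the other factors, summed over all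
  diagonals, are dominated by a product of two norms.\<close>

lemma sconv_estimate:
  fixes \<alpha> \<beta> \<gamma> :: "nat \<Rightarrow> real"
  assumes pos: "\<And>n. \<alpha> n > 0" "\<And>n. \<beta> n > 0" "\<And>n. \<gamma> n > 0"
    and C: "\<And>n. \<gamma> n * (\<Sum>i\<le>n. 1 / (\<alpha> i * \<beta> (n - i))) \<le> C"
    and p: "wsummable \<alpha> p" and q: "wsummable \<beta> q"
  shows "wsummable \<gamma> (sconv p q)" "wsq \<gamma> (sconv p q) \<le> C * wsq \<alpha> p * wsq \<beta> q"
proof -
  have nn: "\<alpha> n \<ge> 0" "\<beta> n \<ge> 0" "\<gamma> n \<ge> 0" for n
    using pos less_imp_le by blast+
  have C0: "C \<ge> 0"
  proof -
    have "0 \<le> \<gamma> 0 * (1 / (\<alpha> 0 * \<beta> 0))" using nn by auto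
    also have "\<dots> \<le> C" using C[of 0] by simp
    finally show ?thesis .
  qed
  define g where "g i j = (\<alpha> i * (cmod (p i))\<^sup>2) * (\<beta> j * (cmod (q j))\<^sup>2)" for i j
  have g0: "g i j \<ge> 0" for i j using nn by (simp add: g_def)
  have pt: "\<gamma> n * (cmod (sconv p q n))\<^sup>2 \<le> C * (\<Sum>i\<le>n. g i (n - i))" for n
  proof -
    have "cmod (sconv p q n) \<le> (\<Sum>i\<le>n. 1 * (cmod (p i) * cmod (q (n - i))))"
      unfolding sconv_def by (rule order_trans[OF norm_sum]) (simp add: norm_mult)
    then have "(cmod (sconv p q n))\<^sup>2 \<le> (\<Sum>i\<le>n. 1 * (cmod (p i) * cmod (q (n - i))))\<^sup>2"
      by (rule power_mono) auto
    also have "\<dots> \<le> (\<Sum>i\<le>n. 1\<^sup>2 / (\<alpha> i * \<beta> (n - i))) *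
        (\<Sum>i\<le>n. (\<alpha> i * \<beta> (n - i)) * (cmod (p i) * cmod (q (n - i)))\<^sup>2)"
      by (rule weighted_Cauchy_sum) (use pos in auto)
    also have "\<dots> = (\<Sum>i\<le>n. 1 / (\<alpha> i * \<beta> (n - i))) * (\<Sum>i\<le>n. g i (n - i))"
      by (simp add: g_def power_mult_distrib mult_ac)
    finally have "\<gamma> n * (cmod (sconv p q n))\<^sup>2 \<le>
        \<gamma> n * ((\<Sum>i\<le>n. 1 / (\<alpha> i * \<beta> (n - i))) * (\<Sum>i\<le>n. g i (n - i)))"
      by (rule mult_left_mono[OF _ nn(3)])
    also have "\<dots> = (\<gamma> n * (\<Sum>i\<le>n. 1 / (\<alpha> i * \<beta> (n - i)))) * (\<Sum>i\<le>n. g i (n - i))"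
      by (simp only: mult.assoc)
    also have "\<dots> \<le> C * (\<Sum>i\<le>n. g i (n - i))"
      by (intro mult_right_mono C sum_nonneg g0)
    finally show ?thesis .
  qed
  have "(\<Sum>n<N. \<gamma> n * (cmod (sconv p q n))\<^sup>2) \<le> C * wsq \<alpha> p * wsq \<beta> q" for N
  proof -
    have "(\<Sum>n<N. \<gamma> n * (cmod (sconv p q n))\<^sup>2) \<le> C * (\<Sum>n<N. \<Sum>i\<le>n. g i (n - i))"
      unfolding sum_distrib_left[of C] by (intro sum_mono) (use pt in \<open>simp add: sum_distrib_left\<close>)
    also have "\<dots> \<le> C * (\<Sum>i<N. \<Sum>j<N. g i j)"
      by (intro mult_left_mono sum_antidiagonal_le g0 C0)
    also have "(\<Sum>i<N. \<Sum>j<N. g i j) =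
        (\<Sum>i<N. \<alpha> i * (cmod (p i))\<^sup>2) * (\<Sum>j<N. \<beta> j * (cmod (q j))\<^sup>2)"
      by (simp add: g_def sum_product)
    also have "C * \<dots> \<le> C * (wsq \<alpha> p * wsq \<beta> q)"
      by (intro mult_left_mono mult_mono wsq_partial nn p q C0 wsq_nonneg sum_nonneg) (use nn in auto)
    finally show ?thesis by (simp add: mult.assoc)
  qed
  from wsummable_boundI[OF nn(3) this]
  show "wsummable \<gamma> (sconv p q)" "wsq \<gamma> (sconv p q) \<le> C * wsq \<alpha> p * wsq \<beta> q"
    by auto
qed

text \<open>Discrete comparison with the integral of an inverse square root: each increment of
  \<open>2 * Wh\<close> exceeds the next summand, because consecutive squares \<open>x * x\<close>
  and \<open>y * y\<close> differ by 1.\<close>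

lemma sum_inverse_sqrt_le: "(\<Sum>l\<le>m. 1 / Wh l) \<le> 2 * Wh m"
proof (induction m)
  case 0
  then show ?case by (simp add: Wh_def)
next
  case (Suc m)
  define x y where "x = Wh m" and "y = Wh (Suc m)"
  have xy: "x > 0" "y > 0" "x \<le> y" "y * y = x * x + 1"
    by (auto simp: x_def y_def Wh_sq W1_def) (simp add: Wh_def)
  have "1 = (y - x) * (y + x)" using xy by (simp add: algebra_simps)
  also have "\<dots> \<le> (y - x) * (2 * y)" using xy by (intro mult_left_mono) auto
  finally have "1 / y \<le> 2 * (y - x)"
    using xy by (simp add: divide_le_eq mult_ac)
  then show ?case using Suc by (simp add: x_def y_def)
qed

text \<open>The first three sums feed \<open>shankel_estimate\<close>, the last two
  \<open>sconv_estimate\<close>. The last two use 1/(AB) = (1/A + 1/B)/(A + B) and the fact that A +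
  B dominates the weight at \<open>m\<close>.\<close>

lemma weight_sums:
  shows "(\<Sum>l\<le>m. Wh (m - l) / Wh l) \<le> 2 * W1 m"
    and "(\<Sum>l\<le>m. W0 (m - l) / W1 l) \<le> 2 * Wh m"
    and "(\<Sum>l\<le>m. W0 (m - l) / W0 l) \<le> 1 * W1 m"
    and "W0 m * (\<Sum>i\<le>m. 1 / (Wh i * Wh (m - i))) \<le> 4"
    and "Wh m * (\<Sum>i\<le>m. 1 / (W1 i * W1 (m - i))) \<le> 4"
proof -
  have "(\<Sum>l\<le>m. Wh (m - l) / Wh l) \<le> (\<Sum>l\<le>m. Wh m / Wh l)"
    by (intro sum_mono divide_right_mono) (auto simp: Wh_def)
  also have "\<dots> = Wh m * (\<Sum>l\<le>m. 1 / Wh l)"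
    by (simp add: sum_distrib_left)
  also have "\<dots> \<le> Wh m * (2 * Wh m)"
    by (intro mult_left_mono sum_inverse_sqrt_le) auto
  finally show "(\<Sum>l\<le>m. Wh (m - l) / Wh l) \<le> 2 * W1 m"
    by (simp add: Wh_sq[symmetric] mult_ac)
  \<comment> \<open>The sum is of logarithmic size; comparison with inverse square roots is crude
    but fits the available weight \<open>Wh m\<close>.\<close>
  have le: "(\<Sum>l\<le>m. 1 / W1 l) \<le> 2 * Wh m"
  proof -
    have "(\<Sum>l\<le>m. 1 / W1 l) \<le> (\<Sum>l\<le>m. 1 / Wh l)"
      by (intro sum_mono divide_left_mono W_le mult_pos_pos) auto
    also note sum_inverse_sqrt_le
    finally show ?thesis .
  qed
  then show "(\<Sum>l\<le>m. W0 (m - l) / W1 l) \<le> 2 * Wh m"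
    by (simp add: W0_def)
  show "(\<Sum>l\<le>m. W0 (m - l) / W0 l) \<le> 1 * W1 m"
    by (simp add: W0_def W1_def)
  have refl: "(\<Sum>i\<le>m. F (m - i)) = (\<Sum>i\<le>m. F i)" for F :: "nat \<Rightarrow> real"
    by (rule sum.reindex_bij_witness[of _ "\<lambda>i. m - i" "\<lambda>i. m - i"]) auto
  have "(\<Sum>i\<le>m. 1 / (Wh i * Wh (m - i))) \<le> (\<Sum>i\<le>m. (1 / Wh i + 1 / Wh (m - i)) / Wh m)"
  proof (rule sum_mono)
    fix i assume "i \<in> {..m}"
    then have "Wh m \<le> Wh i + Wh (m - i)"
      unfolding Wh_def
      by (intro order_trans[OF _ sqrt_add_le_add_sqrt]) (auto intro!: real_sqrt_le_mono)
    then have "Wh m / (Wh i * Wh (m - i) * Wh m) \<le> (Wh i + Wh (m - i)) / (Wh i * Wh (m - i) * Wh m)"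
      by (intro divide_right_mono) auto
    then show "1 / (Wh i * Wh (m - i)) \<le> (1 / Wh i + 1 / Wh (m - i)) / Wh m"
      by (simp add: field_simps)
  qed
  also have "\<dots> = ((\<Sum>i\<le>m. 1 / Wh i) + (\<Sum>i\<le>m. 1 / Wh (m - i))) / Wh m"
    by (simp only: sum_divide_distrib[symmetric] sum.distrib)
  also have "\<dots> = 2 * (\<Sum>i\<le>m. 1 / Wh i) / Wh m"
    using refl[of "\<lambda>i. 1 / Wh i"] by simp
  also have "\<dots> \<le> 2 * (2 * Wh m) / Wh m"
    by (intro divide_right_mono mult_left_mono sum_inverse_sqrt_le) auto
  also have "\<dots> = 4" by simp
  finally show "W0 m * (\<Sum>i\<le>m. 1 / (Wh i * Wh (m - i))) \<le> 4"
    by (simp add: W0_def)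
  have "(\<Sum>i\<le>m. 1 / (W1 i * W1 (m - i))) \<le> (\<Sum>i\<le>m. (1 / W1 i + 1 / W1 (m - i)) / W1 m)"
  proof (rule sum_mono)
    fix i assume "i \<in> {..m}"
    then have "W1 m \<le> W1 i + W1 (m - i)"
      unfolding W1_def by auto
    then have "W1 m / (W1 i * W1 (m - i) * W1 m) \<le> (W1 i + W1 (m - i)) / (W1 i * W1 (m - i) * W1 m)"
      by (intro divide_right_mono) auto
    then show "1 / (W1 i * W1 (m - i)) \<le> (1 / W1 i + 1 / W1 (m - i)) / W1 m"
      by (simp add: field_simps)
  qed
  also have "\<dots> = ((\<Sum>i\<le>m. 1 / W1 i) + (\<Sum>i\<le>m. 1 / W1 (m - i))) / W1 m"
    by (simp only: sum_divide_distrib[symmetric] sum.distrib)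
  also have "\<dots> = 2 * (\<Sum>i\<le>m. 1 / W1 i) / W1 m"
    using refl[of "\<lambda>i. 1 / W1 i"] by simp
  also have "\<dots> \<le> 2 * (2 * Wh m) / W1 m"
    by (intro divide_right_mono mult_left_mono le) auto
  finally have "Wh m * (\<Sum>i\<le>m. 1 / (W1 i * W1 (m - i))) \<le> Wh m * (2 * (2 * Wh m) / W1 m)"
    by (rule mult_left_mono) auto
  also have "\<dots> = 4" by (simp add: Wh_sq[symmetric])
  finally show "Wh m * (\<Sum>i\<le>m. 1 / (W1 i * W1 (m - i))) \<le> 4" .
qed

text \<open>Suffixes name the spaces of the two arguments: \<open>0\<close>, \<open>h\<close>,
  \<open>1\<close> for \<open>W0\<close>, \<open>Wh\<close>, \<open>W1\<close>. The results lie in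
  \<open>Wh\<close>, \<open>W0\<close>, \<open>W0\<close> for \<open>shankel\<close> and in
  \<open>W0\<close>, \<open>Wh\<close> for \<open>sconv\<close>. Thus \<open>shankel_1h\<close>
  keeps iterates in \<open>Wh\<close>, and \<open>sconv_11\<close> followed by
  \<open>shankel_h1\<close> puts the cubic term in \<open>W0\<close>.\<close>

lemmas shankel_1h = shankel_estimate[OF W_pos(3) W_pos(2) W_pos(2) weight_sums(1)]
lemmas shankel_h1 = shankel_estimate[OF W_pos(2) W_pos(3) W_pos(1) weight_sums(2)]
lemmas shankel_10 = shankel_estimate[OF W_pos(3) W_pos(1) W_pos(1) weight_sums(3)]
lemmas sconv_hh = sconv_estimate[OF W_pos(2) W_pos(2) W_pos(1) weight_sums(4)]
lemmas sconv_11 = sconv_estimate[OF W_pos(3) W_pos(3) W_pos(2) weight_sums(5)]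

section \<open>Convergence in weighted sequence spaces\<close>

lemma wsummable_weaken:
  "wsummable W1 c \<Longrightarrow> wsummable Wh c" "wsummable Wh c \<Longrightarrow> wsummable W0 c" "wsummable W1 c \<Longrightarrow> wsummable W0 c"
  using wsq_mono_weight(1) W_le W_nonneg by metis+

definition seq_trunc :: "nat \<Rightarrow> (nat \<Rightarrow> complex) \<Rightarrow> nat \<Rightarrow> complex" where
  "seq_trunc N c n = (if n < N then c n else 0)"

text \<open>Membership is demanded for every \<open>x\<close>, so that the \<open>wsq\<close> in the
  limit is always a genuine norm.\<close>

definition wtendsto :: "(nat \<Rightarrow> real) \<Rightarrow> ('a \<Rightarrow> nat \<Rightarrow> complex) \<Rightarrow> (nat \<Rightarrow> complex) \<Rightarrow> 'a filter \<Rightarrow> bool" where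
  "wtendsto W f g F \<longleftrightarrow> (\<forall>x. wsummable W (f x)) \<and> wsummable W g \<and>
     ((\<lambda>x. wsq W (\<lambda>n. f x n - g n)) \<longlongrightarrow> 0) F"

lemma wtendsto_const: "wsummable W c \<Longrightarrow> wtendsto W (\<lambda>x. c) c F"
  by (auto simp: wtendsto_def wsq_def)

lemma wtendsto_weaken:
  assumes "\<And>n. 0 \<le> W n" "\<And>n. W n \<le> W' n" "wtendsto W' f g F"
  shows "wtendsto W f g F"
proof -
  have W'0: "0 \<le> W' n" for n using assms(1,2) order_trans by blast
  have s: "wsummable W' (f x)" "wsummable W' g" "wsummable W' (\<lambda>n. f x n - g n)" for x
    using assms wsq_diff(1)[OF W'0] by (auto simp: wtendsto_def)
  have "((\<lambda>x. wsq W (\<lambda>n. f x n - g n)) \<longlongrightarrow> 0) F"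
  proof (rule tendsto_sandwich[OF _ _ tendsto_const])
    show "\<forall>\<^sub>F x in F. 0 \<le> wsq W (\<lambda>n. f x n - g n)"
      by (intro always_eventually allI wsq_nonneg assms wsq_mono_weight(1)[OF assms(1,2)] s)
    show "\<forall>\<^sub>F x in F. wsq W (\<lambda>n. f x n - g n) \<le> wsq W' (\<lambda>n. f x n - g n)"
      by (intro always_eventually allI wsq_mono_weight(2)[OF assms(1,2)] s)
    show "((\<lambda>x. wsq W' (\<lambda>n. f x n - g n)) \<longlongrightarrow> 0) F"
      using assms(3) by (simp add: wtendsto_def)
  qed
  then show ?thesis
    using wsq_mono_weight(1)[OF assms(1,2)] s by (auto simp: wtendsto_def)
qed

text \<open>Splits the difference as \<open>\<B> (a - a') p + \<B> a' (p - p')\<close>. Only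
  compatibility with subtraction is required, so the antilinear second slot of
  \<open>shankel\<close> is covered as well.\<close>

lemma wtendsto_bilinear:
  fixes \<B> :: "(nat \<Rightarrow> complex) \<Rightarrow> (nat \<Rightarrow> complex) \<Rightarrow> nat \<Rightarrow> complex"
  assumes nn: "\<And>n. \<alpha> n \<ge> 0" "\<And>n. \<beta> n \<ge> 0" "\<And>n. \<gamma> n \<ge> 0"
    and sm: "\<And>a p. wsummable \<alpha> a \<Longrightarrow> wsummable \<beta> p \<Longrightarrow> wsummable \<gamma> (\<B> a p)"
    and bd: "\<And>a p. wsummable \<alpha> a \<Longrightarrow> wsummable \<beta> p \<Longrightarrow> wsq \<gamma> (\<B> a p) \<le> C * wsq \<alpha> a * wsq \<beta> p"
    and dl: "\<And>a a' p n. wsummable \<alpha> a \<Longrightarrow> wsummable \<alpha> a' \<Longrightarrow> wsummable \<beta> p \<Longrightarrow>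
      \<B> (\<lambda>n. a n - a' n) p n = \<B> a p n - \<B> a' p n"
    and dr: "\<And>a p p' n. wsummable \<alpha> a \<Longrightarrow> wsummable \<beta> p \<Longrightarrow> wsummable \<beta> p' \<Longrightarrow>
      \<B> a (\<lambda>n. p n - p' n) n = \<B> a p n - \<B> a p' n"
    and C0: "C \<ge> 0"
    and a: "wtendsto \<alpha> a a' F" and p: "wtendsto \<beta> p p' F"
  shows "wtendsto \<gamma> (\<lambda>x. \<B> (a x) (p x)) (\<B> a' p') F"
proof -
  have s: "wsummable \<alpha> (a x)" "wsummable \<alpha> a'" "wsummable \<beta> (p x)" "wsummable \<beta> p'"
    "wsummable \<alpha> (\<lambda>n. a x n - a' n)" "wsummable \<beta> (\<lambda>n. p x n - p' n)" for x
    using a p wsq_diff(1)[OF nn(1)] wsq_diff(1)[OF nn(2)] by (auto simp: wtendsto_def)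
  define A where "A x = wsq \<alpha> (\<lambda>n. a x n - a' n)" for x
  define P where "P x = wsq \<beta> (\<lambda>n. p x n - p' n)" for x
  have A: "(A \<longlongrightarrow> 0) F" and P: "(P \<longlongrightarrow> 0) F"
    using a p by (simp_all add: wtendsto_def A_def[abs_def] P_def[abs_def])
  have A0: "A x \<ge> 0" and P0: "P x \<ge> 0" for x
    unfolding A_def P_def by (intro wsq_nonneg nn s)+
  have le: "wsq \<gamma> (\<lambda>n. \<B> (a x) (p x) n - \<B> a' p' n) \<le>
      2 * (C * A x * (2 * P x + 2 * wsq \<beta> p')) + 2 * (C * wsq \<alpha> a' * P x)" for x
  proof -
    have eq: "(\<lambda>n. \<B> (a x) (p x) n - \<B> a' p' n) =
        (\<lambda>n. \<B> (\<lambda>n. a x n - a' n) (p x) n + \<B> a' (\<lambda>n. p x n - p' n) n)"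
      by (simp add: dl dr s)
    have px: "wsq \<beta> (p x) \<le> 2 * P x + 2 * wsq \<beta> p'"
      using wsq_add(2)[OF nn(2) s(6) s(4), of x] by (simp add: P_def)
    have "wsq \<gamma> (\<lambda>n. \<B> (a x) (p x) n - \<B> a' p' n) \<le>
      2 * wsq \<gamma> (\<B> (\<lambda>n. a x n - a' n) (p x)) + 2 * wsq \<gamma> (\<B> a' (\<lambda>n. p x n - p' n))"
      unfolding eq by (rule wsq_add(2)[OF nn(3)]) (intro sm s)+
    also have "\<dots> \<le> 2 * (C * A x * wsq \<beta> (p x)) + 2 * (C * wsq \<alpha> a' * P x)"
      unfolding A_def P_def by (intro add_mono mult_left_mono bd s) auto
    also have "\<dots> \<le> 2 * (C * A x * (2 * P x + 2 * wsq \<beta> p')) + 2 * (C * wsq \<alpha> a' * P x)"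
      by (intro add_mono mult_left_mono px mult_nonneg_nonneg C0 A0 order_refl) auto
    finally show ?thesis .
  qed
  have sd: "wsummable \<gamma> (\<lambda>n. \<B> (a x) (p x) n - \<B> a' p' n)" for x
    by (rule wsq_diff(1)[OF nn(3)]) (intro sm s)+
  have "((\<lambda>x. wsq \<gamma> (\<lambda>n. \<B> (a x) (p x) n - \<B> a' p' n)) \<longlongrightarrow> 0) F"
  proof (rule tendsto_sandwich[OF _ _ tendsto_const])
    show "\<forall>\<^sub>F x in F. 0 \<le> wsq \<gamma> (\<lambda>n. \<B> (a x) (p x) n - \<B> a' p' n)"
      by (intro always_eventually allI wsq_nonneg nn sd)
    show "\<forall>\<^sub>F x in F. wsq \<gamma> (\<lambda>n. \<B> (a x) (p x) n - \<B> a' p' n) \<le>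
        2 * (C * A x * (2 * P x + 2 * wsq \<beta> p')) + 2 * (C * wsq \<alpha> a' * P x)"
      by (intro always_eventually allI le)
    have "((\<lambda>x. 2 * (C * A x * (2 * P x + 2 * wsq \<beta> p')) + 2 * (C * wsq \<alpha> a' * P x)) \<longlongrightarrow>
        2 * (C * 0 * (2 * 0 + 2 * wsq \<beta> p')) + 2 * (C * wsq \<alpha> a' * 0)) F"
      by (intro tendsto_intros A P)
    then show "((\<lambda>x. 2 * (C * A x * (2 * P x + 2 * wsq \<beta> p')) + 2 * (C * wsq \<alpha> a' * P x)) \<longlongrightarrow> 0) F"
      by simp
  qed
  then show ?thesis
    unfolding wtendsto_def using sm s by auto
qed

lemma sconv_diff_left: "sconv (\<lambda>n. a n - a' n) p n = sconv a p n - sconv a' p n"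
  and sconv_diff_right: "sconv a (\<lambda>n. p n - p' n) n = sconv a p n - sconv a p' n"
  by (simp_all add: sconv_def sum_subtractf algebra_simps)

lemma shankel_diff_left:
  assumes "summable (\<lambda>l. a (n + l) * cnj (p l))" "summable (\<lambda>l. a' (n + l) * cnj (p l))"
  shows "shankel (\<lambda>n. a n - a' n) p n = shankel a p n - shankel a' p n"
  using suminf_diff[OF assms] by (simp add: shankel_def algebra_simps)

lemma shankel_diff_right:
  assumes "summable (\<lambda>l. a (n + l) * cnj (p l))" "summable (\<lambda>l. a (n + l) * cnj (p' l))"
  shows "shankel a (\<lambda>n. p n - p' n) n = shankel a p n - shankel a p' n"
  using suminf_diff[OF assms] by (simp add: shankel_def algebra_simps)

lemma wtendsto_sconv_hh:
  "wtendsto Wh a a' F \<Longrightarrow> wtendsto Wh p p' F \<Longrightarrow> wtendsto W0 (\<lambda>x. sconv (a x) (p x)) (sconv a' p') F"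
  by (rule wtendsto_bilinear[where \<alpha> = Wh and \<beta> = Wh and C = 4])
     (auto intro: sconv_hh sconv_diff_left sconv_diff_right)

lemma wtendsto_sconv_11:
  "wtendsto W1 a a' F \<Longrightarrow> wtendsto W1 p p' F \<Longrightarrow> wtendsto Wh (\<lambda>x. sconv (a x) (p x)) (sconv a' p') F"
  by (rule wtendsto_bilinear[where \<alpha> = W1 and \<beta> = W1 and C = 4])
     (auto intro: sconv_11 sconv_diff_left sconv_diff_right)

lemma wtendsto_shankel_1h:
  "wtendsto W1 a a' F \<Longrightarrow> wtendsto Wh p p' F \<Longrightarrow> wtendsto Wh (\<lambda>x. shankel (a x) (p x)) (shankel a' p') F"
  by (rule wtendsto_bilinear[where \<alpha> = W1 and \<beta> = Wh and C = 2])
     (auto intro: shankel_1h shankel_diff_left shankel_diff_right)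

lemma wtendsto_shankel_h1:
  "wtendsto Wh a a' F \<Longrightarrow> wtendsto W1 p p' F \<Longrightarrow> wtendsto W0 (\<lambda>x. shankel (a x) (p x)) (shankel a' p') F"
  by (rule wtendsto_bilinear[where \<alpha> = Wh and \<beta> = W1 and C = 2])
     (auto intro: shankel_h1 shankel_diff_left shankel_diff_right)

lemma seq_trunc_summable:
  assumes "\<And>n. W n \<ge> 0" shows "wsummable W (seq_trunc N c)"
  unfolding wsummable_def
  by (rule summable_finite[of "{..<N}"]) (auto simp: seq_trunc_def)

text \<open>Density of finitely supported sequences: identities proved for them pass to the
  limit.\<close>

lemma wtendsto_seq_trunc:
  assumes nn: "\<And>n. W n \<ge> 0" and c: "wsummable W c"
  shows "wtendsto W (\<lambda>N. seq_trunc N c) c sequentially"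
proof -
  let ?f = "\<lambda>n. W n * (cmod (c n))\<^sup>2"
  have s: "summable ?f" using c by (simp add: wsummable_def)
  have "wsq W (\<lambda>n. seq_trunc N c n - c n) = suminf ?f - (\<Sum>n<N. ?f n)" for N
  proof -
    have "(\<lambda>n. W n * (cmod (seq_trunc N c n - c n))\<^sup>2) = (\<lambda>n. ?f n - (if n \<in> {..<N} then ?f n else 0))"
      by (auto simp: seq_trunc_def)
    moreover have "(\<lambda>n. ?f n - (if n \<in> {..<N} then ?f n else 0)) sums (suminf ?f - (\<Sum>n<N. ?f n))"
      by (intro sums_diff summable_sums s sums_If_finite_set) auto
    ultimately show ?thesis unfolding wsq_def by (simp add: sums_unique[symmetric])
  qed
  moreover have "(\<lambda>N. suminf ?f - (\<Sum>n<N. ?f n)) \<longlonglongrightarrow> suminf ?f - suminf ?f"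
    by (intro tendsto_intros summable_LIMSEQ s)
  ultimately show ?thesis
    unfolding wtendsto_def using seq_trunc_summable[OF nn] c by simp
qed

lemma wtendsto_pointwise:
  assumes "\<And>n. W n > 0" "wtendsto W f g F"
  shows "((\<lambda>x. f x n) \<longlongrightarrow> g n) F"
proof -
  have nn: "W n \<ge> 0" for n using assms(1)[of n] by simp
  have s: "wsummable W (\<lambda>n. f x n - g n)" for x
    using assms wsq_diff(1)[OF nn] by (auto simp: wtendsto_def)
  have le: "(cmod (f x n - g n))\<^sup>2 \<le> wsq W (\<lambda>n. f x n - g n) / W n" for x
    using wsq_partial[OF nn s, of "{n}" x] assms(1)[of n] by (simp add: field_simps)
  have "((\<lambda>x. (cmod (f x n - g n))\<^sup>2) \<longlongrightarrow> 0) F"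
  proof (rule tendsto_sandwich[OF _ _ tendsto_const])
    have "((\<lambda>x. wsq W (\<lambda>n. f x n - g n) / W n) \<longlongrightarrow> 0 / W n) F"
      by (intro tendsto_intros) (use assms(2) assms(1)[of n] in \<open>auto simp: wtendsto_def\<close>)
    then show "((\<lambda>x. wsq W (\<lambda>n. f x n - g n) / W n) \<longlongrightarrow> 0) F" by simp
    show "\<forall>\<^sub>F x in F. (cmod (f x n - g n))\<^sup>2 \<le> wsq W (\<lambda>n. f x n - g n) / W n"
      by (intro always_eventually allI le)
  qed simp
  then have "((\<lambda>x. f x n - g n) \<longlongrightarrow> 0) F"
    by (intro tendsto_norm_zero_cancel[of "\<lambda>x. f x n - g n"]) (simp add: power_tendsto_0_iff)
  then show ?thesis by (simp add: Lim_null[symmetric] LIM_zero_iff)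
qed

lemma sdot_diff_right:
  assumes "wsummable W0 f" "wsummable W0 g" "wsummable W0 g'"
  shows "sdot f (\<lambda>n. g n - g' n) = sdot f g - sdot f g'"
  using suminf_diff[OF sdot_Cauchy(1)[OF assms(1,2)] sdot_Cauchy(1)[OF assms(1,3)]]
  by (simp add: sdot_def algebra_simps)

lemma sdot_diff_left:
  assumes "wsummable W0 f" "wsummable W0 f'" "wsummable W0 g"
  shows "sdot (\<lambda>n. f n - f' n) g = sdot f g - sdot f' g"
  using suminf_diff[OF sdot_Cauchy(1)[OF assms(1,3)] sdot_Cauchy(1)[OF assms(2,3)]]
  by (simp add: sdot_def algebra_simps)

lemma sdot_cnj:
  assumes "wsummable W0 f" "wsummable W0 g"
  shows "cnj (sdot f g) = sdot g f"
  using bounded_linear.suminf[OF bounded_linear_cnj sdot_Cauchy(1)[OF assms]]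
  by (simp add: sdot_def mult.commute)

lemma sdot_finite:
  assumes "\<And>n. n \<ge> N \<Longrightarrow> f n = 0 \<or> g n = 0"
  shows "sdot f g = (\<Sum>n<N. f n * cnj (g n))"
  unfolding sdot_def by (rule suminf_finite) (use assms not_less in auto)

text \<open>Weak against strong convergence. Bounded norms and convergence of every coordinate
  amount to weak convergence; this is all that is known about the difference quotients of the
  solution.\<close>

lemma tendsto_sdot_weak:
  assumes f: "\<And>x. wsummable W0 (f x)" "wsummable W0 f'"
    and K: "\<forall>\<^sub>F x in F. wsq W0 (f x) \<le> K"
    and pt: "\<And>n. ((\<lambda>x. f x n) \<longlongrightarrow> f' n) F"
    and g: "wtendsto W0 g g' F"
  shows "((\<lambda>x. sdot (f x) (g x)) \<longlongrightarrow> sdot f' g') F"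
proof -
  have gs: "wsummable W0 (g x)" "wsummable W0 g'" "wsummable W0 (\<lambda>n. g x n - g' n)" for x
    using g wsq_diff(1)[OF W_nonneg(1)] by (auto simp: wtendsto_def)
  have fs: "wsummable W0 (\<lambda>n. f x n - f' n)" for x
    using f wsq_diff(1)[OF W_nonneg(1)] by auto
  \<comment> \<open>Bounds the squared norm of \<open>f x - f'\<close>; the absolute value and the
    added 1 make \<open>L\<close> positive without information on \<open>K\<close>.\<close>
  define L where "L = 2 * \<bar>K\<bar> + 2 * wsq W0 f' + 1"
  have L: "L > 0" using wsq_nonneg[OF W_nonneg(1) f(2)] by (simp add: L_def)
  have fb: "\<forall>\<^sub>F x in F. wsq W0 (\<lambda>n. f x n - f' n) \<le> L"
    using K
  proof (eventually_elim)
    case (elim x)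
    then show ?case using wsq_diff(2)[OF W_nonneg(1) f(1) f(2), of x] by (simp add: L_def)
  qed
  have 1: "((\<lambda>x. sdot (f x) (\<lambda>n. g x n - g' n)) \<longlongrightarrow> 0) F"
  proof (rule tendsto_norm_zero_cancel, rule tendsto_sandwich[OF _ _ tendsto_const])
    have "((\<lambda>x. sqrt (\<bar>K\<bar> * wsq W0 (\<lambda>n. g x n - g' n))) \<longlongrightarrow> sqrt (\<bar>K\<bar> * 0)) F"
      by (intro tendsto_intros) (use g in \<open>simp add: wtendsto_def\<close>)
    then show "((\<lambda>x. sqrt (\<bar>K\<bar> * wsq W0 (\<lambda>n. g x n - g' n))) \<longlongrightarrow> 0) F" by simp
    show "\<forall>\<^sub>F x in F. norm (sdot (f x) (\<lambda>n. g x n - g' n)) \<le> sqrt (\<bar>K\<bar> * wsq W0 (\<lambda>n. g x n - g' n))"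
      using K
    proof eventually_elim
      case (elim x)
      have "(cmod (sdot (f x) (\<lambda>n. g x n - g' n)))\<^sup>2 \<le> wsq W0 (f x) * wsq W0 (\<lambda>n. g x n - g' n)"
        by (rule sdot_Cauchy(2)[OF f(1) gs(3)])
      also have "\<dots> \<le> \<bar>K\<bar> * wsq W0 (\<lambda>n. g x n - g' n)"
        by (intro mult_right_mono wsq_nonneg gs) (use elim in auto)
      finally show ?case by (rule real_le_rsqrt)
    qed
  qed auto
  \<comment> \<open>Truncating \<open>g'\<close> leaves a finite sum, where coordinatewise
    convergence suffices; the tail is small uniformly in \<open>x\<close> thanks to
    \<open>L\<close>.\<close>
  have 2: "((\<lambda>x. sdot (\<lambda>n. f x n - f' n) g') \<longlongrightarrow> 0) F"
  proof (rule tendstoI)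
    fix e :: real assume e: "e > 0"
    have "((\<lambda>N. wsq W0 (\<lambda>n. seq_trunc N g' n - g' n)) \<longlongrightarrow> 0) sequentially"
      using wtendsto_seq_trunc[OF W_nonneg(1) gs(2)] by (simp add: wtendsto_def)
    moreover have "(e/2)\<^sup>2 / L > 0" using e L by simp
    ultimately obtain N where "wsq W0 (\<lambda>n. seq_trunc N g' n - g' n) < (e/2)\<^sup>2 / L"
      using order_tendstoD(2)[THEN eventually_happens'[OF sequentially_bot]] by blast
    then have N: "L * wsq W0 (\<lambda>n. g' n - seq_trunc N g' n) < (e/2)\<^sup>2"
      using L by (simp add: field_simps wsq_def norm_minus_commute)
    have ts: "wsummable W0 (seq_trunc N g')" by (rule seq_trunc_summable) simp
    have "((\<lambda>x. sdot (\<lambda>n. f x n - f' n) (seq_trunc N g')) \<longlongrightarrow> (\<Sum>n<N. (f' n - f' n) * cnj (seq_trunc N g' n))) F"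
      by (subst sdot_finite[where N = N]) (simp add: seq_trunc_def, intro tendsto_intros pt)
    then have "\<forall>\<^sub>F x in F. cmod (sdot (\<lambda>n. f x n - f' n) (seq_trunc N g')) < e / 2"
      using e tendstoD[of "\<lambda>x. sdot (\<lambda>n. f x n - f' n) (seq_trunc N g')" 0 F "e / 2"] by simp
    then show "\<forall>\<^sub>F x in F. dist (sdot (\<lambda>n. f x n - f' n) g') 0 < e"
      using fb
    proof eventually_elim
      case (elim x)
      have "(cmod (sdot (\<lambda>n. f x n - f' n) (\<lambda>n. g' n - seq_trunc N g' n)))\<^sup>2 \<le>
          wsq W0 (\<lambda>n. f x n - f' n) * wsq W0 (\<lambda>n. g' n - seq_trunc N g' n)"
        by (intro sdot_Cauchy(2) fs wsq_diff(1) gs ts) auto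
      also have "\<dots> \<le> L * wsq W0 (\<lambda>n. g' n - seq_trunc N g' n)"
        by (intro mult_right_mono elim wsq_nonneg wsq_diff(1) gs ts) auto
      also note N
      finally have "cmod (sdot (\<lambda>n. f x n - f' n) (\<lambda>n. g' n - seq_trunc N g' n)) < e / 2"
        by (rule power2_less_imp_less) (use e in auto)
      then have "cmod (sdot (\<lambda>n. f x n - f' n) g' - sdot (\<lambda>n. f x n - f' n) (seq_trunc N g')) < e / 2"
        using sdot_diff_right[OF fs gs(2) ts] by simp
      then show ?case using elim(1) norm_triangle_sub[of "sdot (\<lambda>n. f x n - f' n) g'" "sdot (\<lambda>n. f x n - f' n) (seq_trunc N g')"]
        by simp
    qed
  qed
  have "sdot (f x) (g x) = sdot (f x) (\<lambda>n. g x n - g' n) + sdot (\<lambda>n. f x n - f' n) g' + sdot f' g'" for x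
    using sdot_diff_right[OF f(1) gs(1) gs(2), of x x] sdot_diff_left[OF f(1) f(2) gs(2), of x] by simp
  then show ?thesis
    using tendsto_add[OF tendsto_add[OF 1 2] tendsto_const[of "sdot f' g'"]] by simp
qed

lemma wtendsto_eventually_bounded:
  assumes nn: "\<And>n. W n \<ge> 0" and f: "wtendsto W f f' F"
  shows "\<forall>\<^sub>F x in F. wsq W (f x) \<le> 2 * wsq W f' + 2"
proof -
  have s: "wsummable W f'" "wsummable W (\<lambda>n. f x n - f' n)" for x
    using f wsq_diff(1)[OF nn] by (auto simp: wtendsto_def)
  have "\<forall>\<^sub>F x in F. wsq W (\<lambda>n. f x n - f' n) < 1"
    using f by (auto simp: wtendsto_def intro: order_tendstoD)
  then show ?thesis
  proof eventually_elim
    case (elim x)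
    then show ?case using wsq_add(2)[OF nn s(2) s(1), of x] by simp
  qed
qed

lemma tendsto_sdot:
  assumes "wtendsto W0 f f' F" "wtendsto W0 g g' F"
  shows "((\<lambda>x. sdot (f x) (g x)) \<longlongrightarrow> sdot f' g') F"
  by (rule tendsto_sdot_weak[OF _ _ wtendsto_eventually_bounded[OF W_nonneg(1) assms(1)] wtendsto_pointwise[OF W_pos(1) assms(1)] assms(2)])
     (use assms in \<open>auto simp: wtendsto_def\<close>)

section \<open>Duality between Hankel operators and convolution\<close>

lemma sconv_commute: "sconv p q = sconv q p"
proof
  fix n
  show "sconv p q n = sconv q p n"
    unfolding sconv_def
    by (rule sum.reindex_bij_witness[of _ "\<lambda>i. n - i" "\<lambda>i. n - i"]) (auto simp: mult.commute)
qed

lemma shankel_finite: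
  assumes "\<And>n. n \<ge> N \<Longrightarrow> a n = 0"
  shows "shankel a p n = (\<Sum>l<N. a (n + l) * cnj (p l))"
  unfolding shankel_def by (rule suminf_finite) (use assms in auto)

lemma shankel_finite':
  assumes "\<And>n. n \<ge> N \<Longrightarrow> p n = 0"
  shows "shankel a p n = (\<Sum>l<N. a (n + l) * cnj (p l))"
  unfolding shankel_def by (rule suminf_finite) (use assms in auto)

lemma sum_sconv:
  fixes g :: "nat \<Rightarrow> complex"
  assumes "\<And>n. n \<ge> N \<Longrightarrow> g n = 0"
  shows "(\<Sum>n<N. g n * cnj (sconv p q n)) = (\<Sum>k<N. \<Sum>l<N. g (k + l) * cnj (p k) * cnj (q l))"
proof -
  have g: "n < N" if "g n \<noteq> 0" for n
    using that assms not_less by blast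
  have "(\<Sum>k<N. \<Sum>l<N. g (k + l) * cnj (p k) * cnj (q l)) =
      sum (\<lambda>(k, l). g (k + l) * cnj (p k) * cnj (q l)) ({..<N} \<times> {..<N})"
    by (simp add: sum.cartesian_product)
  also have "\<dots> = sum (\<lambda>(k, l). g (k + l) * cnj (p k) * cnj (q l)) {(k, l). k + l < N}"
    by (rule sum.mono_neutral_right) (auto intro: g)
  also have "\<dots> = (\<Sum>n<N. \<Sum>k\<le>n. g n * cnj (p k) * cnj (q (n - k)))"
    by (subst sum.triangle_reindex) simp
  also have "\<dots> = (\<Sum>n<N. g n * cnj (sconv p q n))"
    by (simp add: sconv_def sum_distrib_left mult.assoc)
  finally show ?thesis ..
qed

text \<open>Both sides are the sum of \<open>a (k + l) * cnj (p k) * cnj (q l)\<close> over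
  \<open>k\<close> and \<open>l\<close>, which is symmetric in \<open>p\<close> and
  \<open>q\<close>.\<close>

lemma sdot_shankel_finite:
  assumes a: "\<And>n. n \<ge> N \<Longrightarrow> a n = 0"
  shows "sdot (shankel a p) q = sdot a (sconv p q)"
proof -
  have "shankel a p n = 0" if "n \<ge> N" for n
    using that a by (simp add: shankel_def)
  then have "sdot (shankel a p) q = (\<Sum>n<N. shankel a p n * cnj (q n))"
    by (intro sdot_finite) auto
  also have "\<dots> = (\<Sum>n<N. \<Sum>l<N. a (n + l) * cnj (q n) * cnj (p l))"
    by (simp add: shankel_finite[OF a] sum_distrib_left sum_distrib_right mult_ac)
  also have "\<dots> = (\<Sum>n<N. a n * cnj (sconv q p n))"
    by (rule sum_sconv[OF a, symmetric])
  also have "\<dots> = sdot a (sconv p q)"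
    by (subst sdot_finite[where N = N]) (use a in \<open>auto simp: sconv_commute[of q p]\<close>)
  finally show ?thesis .
qed

text \<open>Extension by density in \<open>a\<close> alone: once \<open>a\<close> is truncated, both
  sides are finite sums for arbitrary \<open>p\<close> and \<open>q\<close>.\<close>

lemma sdot_shankel:
  assumes a: "wsummable W1 a" and p: "wsummable Wh p" and q: "wsummable Wh q"
  shows "sdot (shankel a p) q = sdot a (sconv p q)"
proof -
  have T: "wtendsto W1 (\<lambda>N. seq_trunc N a) a sequentially"
    by (rule wtendsto_seq_trunc[OF W_nonneg(3) a])
  have T0: "wtendsto W0 (\<lambda>N. seq_trunc N a) a sequentially"
    by (rule wtendsto_seq_trunc) (use a wsummable_weaken in auto)
  have "wtendsto W0 (\<lambda>N. shankel (seq_trunc N a) p) (shankel a p) sequentially"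
    by (rule wtendsto_weaken[OF W_nonneg(1) W_le(1) wtendsto_shankel_1h[OF T wtendsto_const[OF p]]])
  then have "(\<lambda>N. sdot (shankel (seq_trunc N a) p) q) \<longlonglongrightarrow> sdot (shankel a p) q"
    by (rule tendsto_sdot) (use q wsummable_weaken in \<open>auto intro: wtendsto_const\<close>)
  moreover have "(\<lambda>N. sdot (seq_trunc N a) (sconv p q)) \<longlonglongrightarrow> sdot a (sconv p q)"
    by (rule tendsto_sdot[OF T0]) (intro wtendsto_const sconv_hh p q)
  moreover have "sdot (shankel (seq_trunc N a) p) q = sdot (seq_trunc N a) (sconv p q)" for N
    by (rule sdot_shankel_finite[of N]) (simp add: seq_trunc_def)
  ultimately show ?thesis
    using LIMSEQ_unique by simp
qed

section \<open>The cubic identity for finitely supported sequences\<close>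

definition finite_upto :: "nat \<Rightarrow> (nat \<Rightarrow> complex) \<Rightarrow> bool" where
  "finite_upto N a \<longleftrightarrow> (\<forall>n\<ge>N. a n = 0)"

lemma finite_uptoD: "finite_upto N a \<Longrightarrow> n \<ge> N \<Longrightarrow> a n = 0"
  by (simp add: finite_upto_def)

lemma finite_upto_shankel: "finite_upto N a \<Longrightarrow> finite_upto N (shankel a p)"
  by (simp add: finite_upto_def shankel_def)

lemma finite_upto_sconv:
  assumes "finite_upto N a" "finite_upto N b" shows "finite_upto (2 * N) (sconv a b)"
  unfolding finite_upto_def sconv_def
proof (intro allI impI sum.neutral ballI)
  fix n i assume "n \<ge> 2 * N" "i \<in> {..n}"
  then have "i \<ge> N \<or> n - i \<ge> N" by auto
  then show "a i * b (n - i) = 0" using assms by (auto simp: finite_upto_def)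
qed

lemma finite_upto_wsummable: "finite_upto N a \<Longrightarrow> wsummable W a"
  unfolding wsummable_def by (rule summable_finite[of "{..<N}"]) (auto simp: finite_upto_def)

lemma sdot_sconv_finite:
  fixes g :: "nat \<Rightarrow> complex"
  assumes "finite_upto N p" "finite_upto N q"
  shows "sdot g (sconv p q) = (\<Sum>k<N. \<Sum>l<N. g (k + l) * cnj (p k) * cnj (q l))"
proof -
  \<comment> \<open>\<open>g\<close> need not have finite support, but the convolution vanishes from
    \<open>2 * N\<close> on, so \<open>g\<close> may be cut there to make \<open>sum_sconv\<close>
    applicable.\<close>
  let ?g = "seq_trunc (2 * N) g"
  have "sdot g (sconv p q) = (\<Sum>n<2 * N. g n * cnj (sconv p q n))"
    by (rule sdot_finite) (use finite_uptoD[OF finite_upto_sconv[OF assms]] in auto)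
  also have "\<dots> = (\<Sum>n<2 * N. ?g n * cnj (sconv p q n))"
    by (simp add: seq_trunc_def)
  also have "\<dots> = (\<Sum>k<2 * N. \<Sum>l<2 * N. ?g (k + l) * cnj (p k) * cnj (q l))"
    by (rule sum_sconv) (simp add: seq_trunc_def)
  also have "\<dots> = (\<Sum>k<N. \<Sum>l<2 * N. ?g (k + l) * cnj (p k) * cnj (q l))"
    by (rule sum.mono_neutral_right) (use finite_uptoD[OF assms(1)] in auto)
  also have "\<dots> = (\<Sum>k<N. \<Sum>l<N. ?g (k + l) * cnj (p k) * cnj (q l))"
    by (intro sum.cong refl sum.mono_neutral_right) (use finite_uptoD[OF assms(2)] in auto)
  also have "\<dots> = (\<Sum>k<N. \<Sum>l<N. g (k + l) * cnj (p k) * cnj (q l))"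
    by (simp add: seq_trunc_def)
  finally show ?thesis .
qed

text \<open>This and the next two lemmas let every index range over the same box and move the
  constraints into conditionals. The terms of the cubic identity then become sums over one common
  index set.\<close>

lemma sconv_box:
  assumes "finite_upto N f"
  shows "sconv f g m = (\<Sum>x<N. if x \<le> m then f x * g (m - x) else 0)"
proof -
  have "sconv f g m = (\<Sum>x\<le>m. if x < N then f x * g (m - x) else 0)"
    unfolding sconv_def by (intro sum.cong) (use assms finite_uptoD in auto)
  also have "\<dots> = (\<Sum>x<N. if x \<le> m then f x * g (m - x) else 0)"
    by (simp add: sum.If_cases Int_def conj_commute)
  finally show ?thesis .
qed

lemma shankel_box:
  assumes "finite_upto N a" "finite_upto N p"
  shows "shankel a p n = (\<Sum>k<N. \<Sum>y<N. if y = n + k then a y * cnj (p k) else 0)"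
proof -
  have "shankel a p n = (\<Sum>k<N. a (n + k) * cnj (p k))"
    by (rule shankel_finite) (use assms finite_uptoD in auto)
  also have "\<dots> = (\<Sum>k<N. \<Sum>y<N. if y = n + k then a y * cnj (p k) else 0)"
    by (intro sum.cong refl) (use assms(1) finite_uptoD in \<open>auto simp: not_less\<close>)
  finally show ?thesis .
qed

lemma sum_shankel_box:
  fixes g :: "nat \<Rightarrow> complex"
  assumes "finite_upto N a" "finite_upto N p"
  shows "(\<Sum>n<N. g n * shankel a p n) = (\<Sum>y<N. \<Sum>k<N. if k \<le> y then g (y - k) * a y * cnj (p k) else 0)"
proof -
  have "(\<Sum>n<N. g n * shankel a p n) =
      (\<Sum>n<N. \<Sum>k<N. \<Sum>y<N. if y = n + k then g n * a y * cnj (p k) else 0)"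
    by (simp add: shankel_box[OF assms] sum_distrib_left mult.assoc if_distrib cong: if_cong)
  also have "\<dots> = (\<Sum>k<N. \<Sum>n<N. \<Sum>y<N. if y = n + k then g n * a y * cnj (p k) else 0)"
    by (rule sum.swap)
  also have "\<dots> = (\<Sum>k<N. \<Sum>y<N. \<Sum>n<N. if y = n + k then g n * a y * cnj (p k) else 0)"
    by (intro sum.cong refl sum.swap)
  also have "\<dots> = (\<Sum>y<N. \<Sum>k<N. \<Sum>n<N. if y = n + k then g n * a y * cnj (p k) else 0)"
    by (rule sum.swap)
  also have "\<dots> = (\<Sum>y<N. \<Sum>k<N. if k \<le> y then g (y - k) * a y * cnj (p k) else 0)"
  proof (intro sum.cong refl)
    fix y k assume y: "y \<in> {..<N}"
    have "(\<Sum>n<N. if y = n + k then g n * a y * cnj (p k) else 0) =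
        (\<Sum>n<N. if n = y - k then if k \<le> y then g n * a y * cnj (p k) else 0 else 0)"
      by (intro sum.cong refl) auto
    also have "\<dots> = (if k \<le> y then g (y - k) * a y * cnj (p k) else 0)"
      using y by (subst sum.delta) auto
    finally show "(\<Sum>n<N. if y = n + k then g n * a y * cnj (p k) else 0) =
        (if k \<le> y then g (y - k) * a y * cnj (p k) else 0)" .
  qed
  finally show ?thesis .
qed

text \<open>As a single sum over a product set, a permutation of the five indices becomes one
  bijection.\<close>

lemma sum5_cartesian:
  fixes F :: "nat \<Rightarrow> nat \<Rightarrow> nat \<Rightarrow> nat \<Rightarrow> nat \<Rightarrow> 'c::comm_monoid_add"
  shows "(\<Sum>a\<in>A. \<Sum>b\<in>A. \<Sum>c\<in>A. \<Sum>d\<in>A. \<Sum>e\<in>A. F a b c d e) =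
    (\<Sum>(a, b, c, d, e)\<in>A \<times> A \<times> A \<times> A \<times> A. F a b c d e)"
  by (simp add: sum.cartesian_product)

text \<open>
  All four terms sum \<open>a x * a y * cnj (a b) * cnj (p k) * cnj (q l)\<close> over \<open>x + y = k + l + b\<close>: the left-hand
  side without further restriction, the others over \<open>k \<le> y\<close>, over \<open>l \<le> x\<close>, and over both. One of
  the two inequalities always holds.
\<close>

lemma shankel_sconv_identity_finite:
  assumes a: "finite_upto N a" and p: "finite_upto N p" and q: "finite_upto N q"
  shows "sdot (shankel (sconv a a) a) (sconv p q) =
    sdot (sconv a (shankel a p)) (sconv a q) + sdot (sconv a (shankel a q)) (sconv a p)
    - sdot (shankel a q) (shankel a (shankel a p))"
proof -
  define f where "f k l b x y = a x * a y * cnj (a b) * cnj (p k) * cnj (q l)" for k l b x y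
  define T where "T = (\<Sum>k<N. \<Sum>l<N. \<Sum>b<N. \<Sum>x<N. \<Sum>y<N. if x + y = k + l + b then f k l b x y else 0)"
  define T1 where "T1 = (\<Sum>k<N. \<Sum>l<N. \<Sum>b<N. \<Sum>x<N. \<Sum>y<N. if x + y = k + l + b \<and> k \<le> y then f k l b x y else 0)"
  define T2 where "T2 = (\<Sum>k<N. \<Sum>l<N. \<Sum>b<N. \<Sum>x<N. \<Sum>y<N. if x + y = k + l + b \<and> l \<le> x then f k l b x y else 0)"
  define T3 where "T3 = (\<Sum>k<N. \<Sum>l<N. \<Sum>b<N. \<Sum>x<N. \<Sum>y<N. if x + y = k + l + b \<and> k \<le> y \<and> l \<le> x then f k l b x y else 0)"
  have mult_if: "c * (if P then z else 0) = (if P then c * z else 0)"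
    "(if P then z else 0) * c = (if P then z * c else 0)" for c z :: complex and P
    by auto
  have aa: "sconv a a m = (\<Sum>x<N. \<Sum>y<N. if x + y = m then a x * a y else 0)" for m
  proof -
    have "(if x \<le> m then a x * a (m - x) else 0) = (\<Sum>y<N. if x + y = m then a x * a y else 0)" for x
    proof -
      have "(\<Sum>y<N. if x + y = m then a x * a y else 0) =
          (\<Sum>y<N. if y = m - x then if x \<le> m then a x * a y else 0 else 0)"
        by (intro sum.cong) auto
      also have "\<dots> = (if x \<le> m then a x * a (m - x) else 0)"
        using finite_uptoD[OF a, of "m - x"] by (auto simp: not_less)
      finally show ?thesis ..
    qed
    then show ?thesis by (simp add: sconv_box[OF a])
  qed
  have D: "sdot (shankel (sconv a a) a) (sconv p q) = T"
  proof -
    have "sdot (shankel (sconv a a) a) (sconv p q) =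
       (\<Sum>k<N. \<Sum>l<N. (\<Sum>b<N. sconv a a (k + l + b) * cnj (a b)) * cnj (p k) * cnj (q l))"
      by (simp add: sdot_sconv_finite[OF p q] shankel_finite'[OF finite_uptoD[OF a]])
    also have "\<dots> = T"
      unfolding T_def f_def aa
      by (simp add: sum_distrib_left sum_distrib_right mult_if cong: if_cong)
    finally show ?thesis .
  qed
  \<comment> \<open>Stated for any \<open>p\<close> and \<open>q\<close>, to be used in both orders.
    Given \<open>x \<le> b + l\<close>, the condition \<open>y = b + l - x + k\<close> says that
    \<open>x + y = k + l + b\<close> and \<open>k \<le> y\<close>.\<close>
  have A: "sdot (sconv a (shankel a p)) (sconv a q) =
      (\<Sum>b<N. \<Sum>l<N. \<Sum>x<N. \<Sum>k<N. \<Sum>y<N. if x \<le> b + l \<and> y = b + l - x + k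
        then a x * a y * cnj (p k) * cnj (a b) * cnj (q l) else 0)"
    if p: "finite_upto N p" and q: "finite_upto N q" for p q
  proof -
    have "sconv a (shankel a p) m = (\<Sum>x<N. \<Sum>k<N. \<Sum>y<N. if x \<le> m \<and> y = m - x + k then a x * a y * cnj (p k) else 0)" for m
      unfolding sconv_box[OF a] shankel_box[OF a p]
      by (intro sum.cong refl) (auto simp: sum_distrib_left mult_if mult.assoc cong: if_cong)
    then show ?thesis
      by (simp add: sdot_sconv_finite[OF a q] sum_distrib_right mult_if cong: if_cong)
  qed
  have A1: "sdot (sconv a (shankel a p)) (sconv a q) = T1"
    unfolding A[OF p q] T1_def sum5_cartesian
    by (rule sum.reindex_bij_witness[of _ "\<lambda>(k, l, b, x, y). (b, l, x, k, y)" "\<lambda>(b, l, x, k, y). (k, l, b, x, y)"])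
       (auto simp: f_def mult_ac split: if_splits)
  \<comment> \<open>Exchanging \<open>p\<close> and \<open>q\<close> exchanges \<open>k\<close> with
    \<open>l\<close>; renaming \<open>x\<close> as \<open>y\<close> restores the common form, since
    \<open>f\<close> is symmetric in them.\<close>
  have A2: "sdot (sconv a (shankel a q)) (sconv a p) = T2"
    unfolding A[OF q p] T2_def sum5_cartesian
    by (rule sum.reindex_bij_witness[of _ "\<lambda>(k, l, b, x, y). (b, k, y, l, x)" "\<lambda>(b, k, y, l, x). (k, l, b, x, y)"])
       (auto simp: f_def mult_ac split: if_splits)
  \<comment> \<open>The outer index is \<open>x - l\<close> and that of the inner Hankel sum is
    \<open>y - k\<close>, which forces both inequalities; then \<open>b\<close> is their
    sum.\<close>
  have M: "sdot (shankel a q) (shankel a (shankel a p)) = T3"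
  proof -
    let ?p = "shankel a p" and ?q = "shankel a q"
    have fp: "finite_upto N ?p" and fq: "finite_upto N ?q"
      using finite_upto_shankel[OF a] by auto
    have "sdot ?q (shankel a ?p) = (\<Sum>n<N. ?q n * cnj (shankel a ?p n))"
      by (rule sdot_finite) (use finite_uptoD[OF fq] in auto)
    also have "\<dots> = (\<Sum>n<N. cnj (shankel a ?p n) * ?q n)"
      by (simp add: mult.commute)
    also have "\<dots> = (\<Sum>x<N. \<Sum>l<N. if l \<le> x then cnj (shankel a ?p (x - l)) * a x * cnj (q l) else 0)"
      by (rule sum_shankel_box[OF a q])
    also have "\<dots> = (\<Sum>x<N. \<Sum>l<N. \<Sum>y<N. \<Sum>k<N. \<Sum>b<N.
       if l \<le> x \<and> k \<le> y \<and> b = x - l + (y - k) then f k l b x y else 0)"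
    proof (intro sum.cong refl)
      fix x l
      have "cnj (shankel a ?p m) = (\<Sum>y<N. \<Sum>k<N. \<Sum>b<N. if k \<le> y \<and> b = m + (y - k) then
          cnj (a b) * a y * cnj (p k) else 0)" for m
      proof -
        have "cnj (shankel a ?p m) = (\<Sum>j<N. cnj (a (m + j)) * ?p j)"
          by (simp add: shankel_finite[OF finite_uptoD[OF a]])
        also have "\<dots> = (\<Sum>y<N. \<Sum>k<N. if k \<le> y then cnj (a (m + (y - k))) * a y * cnj (p k) else 0)"
          by (rule sum_shankel_box[OF a p])
        also have "\<dots> = (\<Sum>y<N. \<Sum>k<N. \<Sum>b<N. if k \<le> y \<and> b = m + (y - k) then
            cnj (a b) * a y * cnj (p k) else 0)"
          by (intro sum.cong refl) (use finite_uptoD[OF a] in \<open>auto simp: not_less\<close>)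
        finally show ?thesis .
      qed
      then show "(if l \<le> x then cnj (shankel a ?p (x - l)) * a x * cnj (q l) else 0) =
        (\<Sum>y<N. \<Sum>k<N. \<Sum>b<N. if l \<le> x \<and> k \<le> y \<and> b = x - l + (y - k) then f k l b x y else 0)"
        by (auto simp: sum_distrib_right sum_distrib_left mult_if f_def mult_ac cong: if_cong)
    qed
    also have "\<dots> = T3"
      unfolding T3_def sum5_cartesian
      by (rule sum.reindex_bij_witness[of _ "\<lambda>(k, l, b, x, y). (x, l, y, k, b)" "\<lambda>(x, l, y, k, b). (k, l, b, x, y)"])
         (auto split: if_splits)
    finally show ?thesis .
  qed
  have "T + T3 = T1 + T2"
    unfolding T_def T1_def T2_def T3_def sum.distrib[symmetric]
    by (intro sum.cong refl) auto
  then show ?thesis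
    unfolding D A1 A2 M by (simp add: algebra_simps)
qed

section \<open>Evolution of the Hankel moments\<close>

primrec hankel_orbit :: "(nat \<Rightarrow> complex) \<Rightarrow> nat \<Rightarrow> nat \<Rightarrow> complex" where
  "hankel_orbit a 0 = (\<lambda>n. if n = 0 then 1 else 0)"
| "hankel_orbit a (Suc j) = shankel a (hankel_orbit a j)"

text \<open>Records the conjugations picked up when \<open>j\<close> antilinear factors cross the
  pairing.\<close>

definition cnj_pow :: "nat \<Rightarrow> complex \<Rightarrow> complex" where
  "cnj_pow j z = (if even j then z else cnj z)"

text \<open>The bound is a successor so that index 0, the support of the starting sequence, is
  covered.\<close>

lemma finite_upto_hankel_orbit0: "finite_upto (Suc N) (hankel_orbit a 0)"
  by (simp add: finite_upto_def)

lemma finite_upto_hankel_orbit: "finite_upto (Suc N) a \<Longrightarrow> finite_upto (Suc N) (hankel_orbit a j)"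
  by (cases j) (auto intro: finite_upto_shankel finite_upto_hankel_orbit0[simplified])

lemma wsummable_hankel_orbit: "wsummable W1 a \<Longrightarrow> wsummable Wh (hankel_orbit a j)"
  by (induction j) (auto intro: shankel_1h finite_upto_wsummable finite_upto_hankel_orbit0[simplified])

lemma wtendsto_hankel_orbit:
  assumes "wtendsto W1 a a' F"
  shows "wtendsto Wh (\<lambda>x. hankel_orbit (a x) j) (hankel_orbit a' j) F"
  by (induction j)
     (auto intro: wtendsto_shankel_1h assms wtendsto_const finite_upto_wsummable finite_upto_hankel_orbit0[simplified])

lemma sdot_hankel_orbit0: "sdot f (hankel_orbit a 0) = f 0"
  by (subst sdot_finite[of 1]) auto

lemma sconv_hankel_orbit0: "sconv p (hankel_orbit a 0) = p"
proof
  fix n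
  have "sconv p (hankel_orbit a 0) n = (\<Sum>i\<le>n. if i = n then p i else 0)"
    unfolding sconv_def by (intro sum.cong) auto
  then show "sconv p (hankel_orbit a 0) n = p n" by simp
qed

lemma hankel_orbit_1: "hankel_orbit a (Suc 0) = a"
  by (simp add: shankel_finite'[of 1] fun_eq_iff)

lemma sdot_shankel_right:
  assumes "wsummable W1 a" "wsummable Wh p" "wsummable Wh q"
  shows "sdot p (shankel a q) = cnj (sdot a (sconv p q))"
proof -
  have "sdot p (shankel a q) = cnj (sdot (shankel a q) p)"
    by (intro sdot_cnj[symmetric] wsummable_weaken(2) shankel_1h assms)
  then show ?thesis using assms by (simp add: sdot_shankel sconv_commute[of p])
qed

text \<open>Factors move from the right slot to the left one at a time, each at the cost of one
  conjugation, until only the starting sequence is left on the right.\<close>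

lemma sdot_hankel_orbit_hankel_orbit:
  assumes a: "wsummable W1 a"
  shows "sdot (hankel_orbit a i) (hankel_orbit a j) = cnj_pow j (hankel_orbit a (i + j) 0)"
proof (induction j arbitrary: i)
  case 0
  then show ?case by (simp only: sdot_hankel_orbit0 cnj_pow_def) simp
next
  case (Suc j)
  have "sdot (hankel_orbit a i) (hankel_orbit a (Suc j)) = cnj (sdot (shankel a (hankel_orbit a i)) (hankel_orbit a j))"
    using sdot_shankel_right[OF a wsummable_hankel_orbit[OF a] wsummable_hankel_orbit[OF a], of i j]
      sdot_shankel[OF a wsummable_hankel_orbit[OF a] wsummable_hankel_orbit[OF a], of i j] by simp
  also have "\<dots> = cnj (sdot (hankel_orbit a (Suc i)) (hankel_orbit a j))" by simp
  also have "\<dots> = cnj_pow (Suc j) (hankel_orbit a (i + Suc j) 0)"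
    unfolding Suc.IH by (simp add: cnj_pow_def)
  finally show ?case .
qed

text \<open>For \<open>n = 2k\<close> the entry is the squared norm of the \<open>k\<close>-th
  iterate.\<close>

lemma hankel_orbit_even_real:
  assumes a: "wsummable W1 a" and "even n"
  shows "cnj (hankel_orbit a n 0) = hankel_orbit a n 0"
proof -
  obtain k where n: "n = k + k" using \<open>even n\<close> by (metis evenE mult_2)
  have "wsummable W0 (hankel_orbit a k)" using wsummable_hankel_orbit[OF a] wsummable_weaken by blast
  then have "cnj (sdot (hankel_orbit a k) (hankel_orbit a k)) = sdot (hankel_orbit a k) (hankel_orbit a k)" by (intro sdot_cnj)
  then show ?thesis using sdot_hankel_orbit_hankel_orbit[OF a, of k k] n by (simp add: cnj_pow_def split: if_splits)
qed

text \<open>Coefficients of the projected nonlinearity: |u|^2 u is u^2 times the conjugate of u,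
  hence its projection is the Hankel operator with symbol u^2 applied to u.\<close>

definition szego_field :: "(nat \<Rightarrow> complex) \<Rightarrow> nat \<Rightarrow> complex" where
  "szego_field a = shankel (sconv a a) a"

lemma sum_alternating_telescope:
  fixes E :: "nat \<Rightarrow> complex"
  shows "(\<Sum>j<n. (-1) ^ j * (E j + E (Suc j))) = E 0 - (-1) ^ n * E n"
  by (induction n) (auto simp: algebra_simps)

lemma sum_alternating: "(\<Sum>j<n. (-1) ^ j) = (if even n then 0 else 1 :: complex)"
  by (induction n) auto

text \<open>The left-hand side is the derivative of the \<open>n\<close>-th moment along the flow,
  as \<open>hankel_orbit_difference\<close> will show. The cubic identity writes each summand
  through two consecutive \<open>E\<close>, and the sum collapses to its ends.\<close>

lemma hankel_orbit_flow_finite: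
  assumes fa: "finite_upto (Suc N) a"
  shows "(\<Sum>j<n. cnj_pow j (- \<i> * sdot (szego_field a) (sconv (hankel_orbit a (n - 1 - j)) (hankel_orbit a j)))) =
    (if even n then 0 else - \<i> * hankel_orbit a (n + 2) 0)"
proof -
  have a: "wsummable W1 a" by (rule finite_upto_wsummable[OF fa])
  have fV: "finite_upto (Suc N) (hankel_orbit a j)" for j by (rule finite_upto_hankel_orbit[OF fa])
  have sc: "wsummable W0 (sconv a (hankel_orbit a j))" for j
    by (rule finite_upto_wsummable[OF finite_upto_sconv[OF fa fV]])
  define A where "A m = sdot (sconv a (hankel_orbit a (n - m))) (sconv a (hankel_orbit a m))" for m
  define E where "E m = cnj_pow m (A m)" for m
  define Jn where "Jn = hankel_orbit a (n + 2) 0"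
  \<comment> \<open>In the identity, \<open>shankel a\<close> raises an orbit index by one, so its
    first term is \<open>A j\<close> and its second the conjugate of
    \<open>A (Suc j)\<close>.\<close>
  have D: "sdot (szego_field a) (sconv (hankel_orbit a (n - 1 - j)) (hankel_orbit a j)) =
      A j + cnj (A (Suc j)) - cnj_pow (n + 1 - j) Jn" if j: "j < n" for j
  proof -
    have s: "shankel a (hankel_orbit a (n - Suc j)) = hankel_orbit a (n - j)"
      "shankel a (hankel_orbit a (n - j)) = hankel_orbit a (Suc n - j)"
      "shankel a (hankel_orbit a j) = hankel_orbit a (Suc j)" "n - 1 - j = n - Suc j"
      using j by (simp_all add: Suc_diff_Suc Suc_diff_le flip: hankel_orbit.simps(2))
    have "sdot (hankel_orbit a (Suc j)) (hankel_orbit a (Suc n - j)) = cnj_pow (n + 1 - j) Jn"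
      using sdot_hankel_orbit_hankel_orbit[OF a, of "Suc j" "Suc n - j"] j by (simp add: Jn_def)
    moreover have "sdot (sconv a (hankel_orbit a (Suc j))) (sconv a (hankel_orbit a (n - Suc j))) = cnj (A (Suc j))"
      unfolding A_def by (rule sdot_cnj[OF sc sc, symmetric])
    ultimately show ?thesis
      unfolding szego_field_def shankel_sconv_identity_finite[OF fa fV fV] s A_def
      by simp
  qed
  have J_even: "cnj Jn = Jn" if "even n"
    using hankel_orbit_even_real[OF a, of "n + 2"] that by (simp add: Jn_def)
  \<comment> \<open>Conjugating \<open>j\<close> times sends \<open>- \<i>\<close> to
    \<open>(-1) ^ j * (- \<i>)\<close> and aligns the first two terms to \<open>E j\<close> and
    \<open>E (Suc j)\<close>. On the third term the conjugations add up to \<open>n + 1\<close>,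
    whatever \<open>j\<close> is.\<close>
  have summand: "cnj_pow j (- \<i> * sdot (szego_field a) (sconv (hankel_orbit a (n - 1 - j)) (hankel_orbit a j))) =
      - \<i> * ((-1) ^ j * (E j + E (Suc j)) - (-1) ^ j * cnj_pow (n + 1) Jn)" if j: "j < n" for j
    unfolding D[OF j] E_def cnj_pow_def using j
    by (cases "even j"; cases "even n") (auto simp: algebra_simps)
  \<comment> \<open>Convolution with the starting sequence does nothing and \<open>a\<close> is the
    first iterate, so duality reduces \<open>E 0\<close> to a pairing of two iterates with indices
    adding up to \<open>n + 2\<close>.\<close>
  have E0: "E 0 = Jn"
  proof -
    have "E 0 = sdot (sconv a (hankel_orbit a n)) a"
      unfolding E_def A_def cnj_pow_def by (simp only: sconv_hankel_orbit0) simp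
    also have "\<dots> = cnj (sdot a (sconv a (hankel_orbit a n)))"
      by (rule sdot_cnj[symmetric]) (use sc a wsummable_weaken in auto)
    also have "\<dots> = cnj (sdot (shankel a a) (hankel_orbit a n))"
      by (subst sdot_shankel[OF a]) (use a wsummable_weaken wsummable_hankel_orbit[OF a] in auto)
    also have "\<dots> = cnj (sdot (hankel_orbit a 2) (hankel_orbit a n))"
      using hankel_orbit_1[of a] by (simp add: numeral_2_eq_2)
    also have "\<dots> = sdot (hankel_orbit a n) (hankel_orbit a 2)"
      by (rule sdot_cnj) (use wsummable_hankel_orbit[OF a] wsummable_weaken in blast)+
    also have "\<dots> = Jn" by (subst sdot_hankel_orbit_hankel_orbit[OF a]) (simp add: cnj_pow_def Jn_def)
    finally show ?thesis .
  qed
  \<comment> \<open>Replacing \<open>m\<close> by \<open>n - m\<close> conjugates \<open>A\<close>,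
    so the other end is known too.\<close>
  have En: "E n = cnj_pow n (cnj Jn)"
  proof -
    have "A n = cnj (A 0)"
      unfolding A_def diff_self_eq_0 diff_zero by (rule sdot_cnj[OF sc sc, symmetric])
    then show ?thesis using E0 by (simp add: E_def cnj_pow_def)
  qed
  have "(\<Sum>j<n. cnj_pow j (- \<i> * sdot (szego_field a) (sconv (hankel_orbit a (n - 1 - j)) (hankel_orbit a j)))) =
     (\<Sum>j<n. - \<i> * ((-1) ^ j * (E j + E (Suc j)) - (-1) ^ j * cnj_pow (n + 1) Jn))"
    by (intro sum.cong refl summand) auto
  also have "\<dots> = - \<i> * ((E 0 - (-1) ^ n * E n) - (\<Sum>j<n. (-1) ^ j) * cnj_pow (n + 1) Jn)"
    unfolding sum_alternating_telescope[symmetric]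
    by (simp only: sum_distrib_left[symmetric] sum_distrib_right[symmetric] sum_subtractf)
  \<comment> \<open>For odd \<open>n\<close> the ends give \<open>2 * Jn\<close> and the alternating
    sum takes one copy away. For even \<open>n\<close> the alternating sum is 0 and the ends cancel
    because \<open>Jn\<close> is real.\<close>
  also have "\<dots> = (if even n then 0 else - \<i> * Jn)"
    using J_even unfolding E0 En sum_alternating by (auto simp: cnj_pow_def)
  finally show ?thesis by (simp add: Jn_def)
qed

lemma tendsto_cnj_pow: "(f \<longlongrightarrow> l) F \<Longrightarrow> ((\<lambda>x. cnj_pow j (f x)) \<longlongrightarrow> cnj_pow j l) F"
  by (auto simp: cnj_pow_def intro: tendsto_cnj)

lemma wtendsto_szego_field:
  "wtendsto W1 a a' F \<Longrightarrow> wtendsto W0 (\<lambda>x. szego_field (a x)) (szego_field a') F"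
  unfolding szego_field_def by (intro wtendsto_shankel_h1 wtendsto_sconv_11)

lemma wsummable_szego_field: "wsummable W1 a \<Longrightarrow> wsummable W0 (szego_field a)"
  unfolding szego_field_def by (intro shankel_h1 sconv_11)

text \<open>Both sides are continuous in \<open>a\<close> for the \<open>W1\<close> norm, so
  truncation suffices.\<close>

lemma hankel_orbit_flow:
  assumes a: "wsummable W1 a"
  shows "(\<Sum>j<n. cnj_pow j (- \<i> * sdot (szego_field a) (sconv (hankel_orbit a (n - 1 - j)) (hankel_orbit a j)))) =
    (if even n then 0 else - \<i> * hankel_orbit a (n + 2) 0)" (is "?L a = ?R a")
proof -
  let ?a = "\<lambda>N. seq_trunc (Suc N) a"
  have "filterlim Suc sequentially sequentially" by (rule filterlim_Suc)
  then have T: "wtendsto W1 ?a a sequentially"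
    using wtendsto_seq_trunc[OF W_nonneg(3) a]
    by (auto simp: wtendsto_def filterlim_compose[of "\<lambda>N. wsq W1 (\<lambda>n. seq_trunc N a n - a n)"])
  have L: "(\<lambda>N. ?L (?a N)) \<longlonglongrightarrow> ?L a"
    by (intro tendsto_sum tendsto_cnj_pow tendsto_mult tendsto_const tendsto_sdot
        wtendsto_szego_field wtendsto_sconv_hh wtendsto_hankel_orbit T)
  have R: "(\<lambda>N. ?R (?a N)) \<longlonglongrightarrow> ?R a"
    using tendsto_mult[OF tendsto_const wtendsto_pointwise[OF W_pos(2) wtendsto_hankel_orbit[OF T], of "n + 2" 0], of "- \<i>"]
    by (cases "even n") (simp_all only: if_True if_False tendsto_const)
  have eq: "(\<lambda>N. ?L (?a N)) = (\<lambda>N. ?R (?a N))"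
  proof
    fix N show "?L (?a N) = ?R (?a N)"
      by (rule hankel_orbit_flow_finite[of N]) (simp add: finite_upto_def seq_trunc_def)
  qed
  show ?thesis by (rule LIMSEQ_unique[OF L R[folded eq]])
qed

text \<open>\<open>T j\<close> interpolates between the two moments, using \<open>b\<close> for
  \<open>j\<close> of the \<open>n\<close> factors and \<open>a\<close> for the rest. Each step
  exchanges one factor, and duality exposes it as \<open>b - a\<close> paired with a convolution,
  with no derivative of an operator involved.\<close>

lemma hankel_orbit_difference:
  assumes a: "wsummable W1 a" and b: "wsummable W1 b"
  shows "hankel_orbit b n 0 - hankel_orbit a n 0 =
    (\<Sum>j<n. cnj_pow j (sdot (\<lambda>m. b m - a m) (sconv (hankel_orbit a (n - 1 - j)) (hankel_orbit b j))))"
proof -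
  define T where "T j = cnj_pow j (sdot (hankel_orbit a (n - j)) (hankel_orbit b j))" for j
  have h: "wsummable Wh (hankel_orbit a j)" "wsummable Wh (hankel_orbit b j)" for j
    using wsummable_hankel_orbit a b by auto
  have z: "wsummable W0 (hankel_orbit a j)" "wsummable W0 (hankel_orbit b j)" for j
    using h wsummable_weaken by blast+
  have "T (Suc j) - T j = cnj_pow j (sdot (\<lambda>m. b m - a m) (sconv (hankel_orbit a (n - 1 - j)) (hankel_orbit b j)))"
    if j: "j < n" for j
  proof -
    have s: "hankel_orbit a (n - j) = shankel a (hankel_orbit a (n - Suc j))"
      using j by (simp add: Suc_diff_Suc flip: hankel_orbit.simps(2))
    have "T (Suc j) = cnj_pow j (sdot b (sconv (hankel_orbit a (n - Suc j)) (hankel_orbit b j)))"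
      using sdot_shankel_right[OF b h(1) h(2), of "n - Suc j" j] by (simp add: T_def cnj_pow_def)
    moreover have "T j = cnj_pow j (sdot a (sconv (hankel_orbit a (n - Suc j)) (hankel_orbit b j)))"
      using sdot_shankel[OF a h(1) h(2), of "n - Suc j" j] by (simp add: T_def s)
    moreover have "sdot (\<lambda>m. b m - a m) (sconv (hankel_orbit a (n - Suc j)) (hankel_orbit b j)) =
        sdot b (sconv (hankel_orbit a (n - Suc j)) (hankel_orbit b j)) - sdot a (sconv (hankel_orbit a (n - Suc j)) (hankel_orbit b j))"
      by (rule sdot_diff_left) (use a b wsummable_weaken h in \<open>auto intro: sconv_hh\<close>)
    ultimately show ?thesis by (simp add: cnj_pow_def)
  qed
  then have "(\<Sum>j<n. cnj_pow j (sdot (\<lambda>m. b m - a m) (sconv (hankel_orbit a (n - 1 - j)) (hankel_orbit b j)))) = T n - T 0"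
    using sum_lessThan_telescope[of T n] by simp
  moreover have "T 0 = hankel_orbit a n 0"
    unfolding T_def cnj_pow_def diff_zero sdot_hankel_orbit0 by simp
  \<comment> \<open>The \<open>n\<close> conjugations and the one from swapping the slots cancel for
    odd \<open>n\<close>; for even \<open>n\<close> the moment is real.\<close>
  moreover have "T n = hankel_orbit b n 0"
  proof -
    have eq: "hankel_orbit a 0 = hankel_orbit b 0" by simp
    have "T n = cnj_pow n (cnj (sdot (hankel_orbit b n) (hankel_orbit b 0)))"
      unfolding T_def diff_self_eq_0 eq by (simp only: sdot_cnj[OF z(2) z(2)])
    then show ?thesis unfolding sdot_hankel_orbit0 using hankel_orbit_even_real[OF b, of n] by (auto simp: cnj_pow_def)
  qed
  ultimately show ?thesis by simp
qed

section \<open>Derivative of the moments along a coefficientwise solution\<close>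

lemma has_vector_derivative_iff_tendsto:
  fixes f :: "real \<Rightarrow> complex"
  shows "(f has_vector_derivative D) (at t) \<longleftrightarrow> ((\<lambda>s. (f s - f t) / of_real (s - t)) \<longlongrightarrow> D) (at t)"
proof -
  have "(f has_vector_derivative D) (at t) \<longleftrightarrow>
      ((\<lambda>s. norm ((f s - f t) - (s - t) *\<^sub>R D) / norm (s - t)) \<longlongrightarrow> 0) (at t)"
    unfolding has_vector_derivative_def has_derivative_iff_norm
    using bounded_linear_scaleR_left[of D] by simp
  also have "\<dots> \<longleftrightarrow> ((\<lambda>s. norm ((f s - f t) / of_real (s - t) - D)) \<longlongrightarrow> 0) (at t)"
  proof (rule tendsto_cong)
    show "\<forall>\<^sub>F s in at t. norm ((f s - f t) - (s - t) *\<^sub>R D) / norm (s - t) =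
        norm ((f s - f t) / of_real (s - t) - D)"
      unfolding eventually_at_filter
    proof (intro always_eventually allI impI)
      fix s assume "s \<noteq> t"
      then have "(f s - f t) / of_real (s - t) - D = ((f s - f t) - (s - t) *\<^sub>R D) / of_real (s - t)"
        by (simp add: diff_divide_distrib scaleR_conv_of_real)
      then show "norm ((f s - f t) - (s - t) *\<^sub>R D) / norm (s - t) =
          norm ((f s - f t) / of_real (s - t) - D)"
        by (simp only: norm_divide norm_of_real real_norm_def)
    qed
  qed
  also have "\<dots> \<longleftrightarrow> ((\<lambda>s. (f s - f t) / of_real (s - t)) \<longlongrightarrow> D) (at t)"
    by (simp only: tendsto_norm_zero_iff LIM_zero_iff)
  finally show ?thesis .
qed

text \<open>
  Mean value inequality: test a truncation of \<open>a\<close> against its own increment.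
\<close>

lemma wsq_increment_le:
  fixes a g :: "real \<Rightarrow> nat \<Rightarrow> complex"
  assumes S: "convex S" "s \<in> S" "t \<in> S"
    and der: "\<And>r n. r \<in> S \<Longrightarrow> ((\<lambda>s. a s n) has_vector_derivative g r n) (at r)"
    and g: "\<And>r. r \<in> S \<Longrightarrow> wsummable W0 (g r)" "\<And>r. r \<in> S \<Longrightarrow> wsq W0 (g r) \<le> K"
  shows "wsq W0 (\<lambda>n. a s n - a t n) \<le> K * (s - t)\<^sup>2"
proof (rule wsummable_boundI(2))
  fix N
  define c where "c n = a s n - a t n" for n
  define X where "X = (\<Sum>n<N. (cmod (c n))\<^sup>2)"
  define \<phi> where "\<phi> r = (\<Sum>n<N. a r n * cnj (c n))" for r
  have X0: "X \<ge> 0" unfolding X_def by (intro sum_nonneg) auto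
  have K0: "K \<ge> 0" using g(2)[OF S(2)] wsq_nonneg[OF W_nonneg(1) g(1)[OF S(2)]] by simp
  have bd: "cmod (\<Sum>n<N. g r n * cnj (c n)) \<le> sqrt (K * X)" if r: "r \<in> S" for r
  proof (rule real_le_rsqrt)
    have "cmod (\<Sum>n<N. g r n * cnj (c n)) \<le> (\<Sum>n<N. cmod (g r n) * cmod (c n))"
      by (rule order_trans[OF norm_sum]) (simp add: norm_mult)
    then have "(cmod (\<Sum>n<N. g r n * cnj (c n)))\<^sup>2 \<le> (\<Sum>n<N. cmod (g r n) * cmod (c n))\<^sup>2"
      by (rule power_mono) auto
    also have "\<dots> \<le> (\<Sum>n<N. (cmod (g r n))\<^sup>2) * X"
      unfolding X_def by (rule Cauchy_Schwarz_ineq_sum)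
    also have "\<dots> \<le> K * X"
      using wsq_partial[OF W_nonneg(1) g(1)[OF r], of "{..<N}"] g(2)[OF r]
      by (intro mult_right_mono X0) (simp add: W0_def)
    finally show "(cmod (\<Sum>n<N. g r n * cnj (c n)))\<^sup>2 \<le> K * X" .
  qed
  have "norm (\<phi> s - \<phi> t) \<le> sqrt (K * X) * norm (s - t)"
  proof (rule differentiable_bound[OF S(1) _ _ S(2,3)])
    fix r assume r: "r \<in> S"
    have "(\<phi> has_vector_derivative (\<Sum>n<N. g r n * cnj (c n))) (at r within S)"
      unfolding \<phi>_def
      by (intro has_vector_derivative_sum has_vector_derivative_mult_left has_vector_derivative_at_within[OF der[OF r]])
    then show "(\<phi> has_derivative (\<lambda>h. h *\<^sub>R (\<Sum>n<N. g r n * cnj (c n)))) (at r within S)"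
      by (simp add: has_vector_derivative_def)
    show "onorm (\<lambda>h. h *\<^sub>R (\<Sum>n<N. g r n * cnj (c n))) \<le> sqrt (K * X)"
      by (rule onorm_le) (use bd[OF r] in \<open>simp add: mult.commute mult_left_mono\<close>)
  qed
  moreover have "\<phi> s - \<phi> t = of_real X"
    unfolding \<phi>_def X_def sum_subtractf[symmetric] of_real_sum
    by (intro sum.cong refl)
       (simp add: c_def[symmetric] complex_norm_square left_diff_distrib[symmetric] del: complex_cnj_diff of_real_power)
  ultimately have "X \<le> sqrt (K * X) * \<bar>s - t\<bar>" using X0 by simp
  \<comment> \<open>After squaring, one factor \<open>X\<close> cancels, the case
    \<open>X = 0\<close> being trivial.\<close>
  then have "X\<^sup>2 \<le> (sqrt (K * X) * \<bar>s - t\<bar>)\<^sup>2" by (rule power_mono[OF _ X0])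
  also have "\<dots> = K * (s - t)\<^sup>2 * X" using K0 X0 by (simp add: power_mult_distrib)
  finally have "X * X \<le> K * (s - t)\<^sup>2 * X" by (simp add: power2_eq_square)
  then have "X \<le> K * (s - t)\<^sup>2"
    using X0 K0 by (cases "X = 0") (auto simp: mult_le_cancel_right)
  then show "(\<Sum>n<N. W0 n * (cmod (a s n - a t n))\<^sup>2) \<le> K * (s - t)\<^sup>2"
    by (simp add: X_def c_def W0_def)
qed simp

lemma hankel_orbit_has_vector_derivative:
  fixes a :: "real \<Rightarrow> nat \<Rightarrow> complex"
  assumes cont: "\<And>t. wtendsto W1 a (a t) (at t)"
    and ode: "\<And>t n. ((\<lambda>s. a s n) has_vector_derivative (- \<i> * szego_field (a t) n)) (at t)"
  shows "((\<lambda>s. hankel_orbit (a s) n 0) has_vector_derivative (if even n then 0 else - \<i> * hankel_orbit (a t) (n + 2) 0)) (at t)"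
proof -
  have s: "wsummable W1 (a t)" for t using cont by (auto simp: wtendsto_def)
  define g where "g t m = - \<i> * szego_field (a t) m" for t m
  have g: "wsummable W0 (g t)" "wsq W0 (g t) = wsq W0 (szego_field (a t))" for t
    unfolding g_def using wsq_cmult[OF wsummable_szego_field[OF s], of "- \<i>"] by auto
  \<comment> \<open>The constant of \<open>wtendsto_eventually_bounded\<close>: it bounds the
    nonlinearity near \<open>t\<close>.\<close>
  define K where "K = 2 * wsq W0 (szego_field (a t)) + 2"
  have "\<forall>\<^sub>F r in at t. wsq W0 (g r) \<le> K"
    using wtendsto_eventually_bounded[OF W_nonneg(1) wtendsto_szego_field[OF cont]]
    by (simp add: K_def g)
  then obtain d where d: "d > 0" "\<And>r. r \<noteq> t \<Longrightarrow> dist r t < d \<Longrightarrow> wsq W0 (g r) \<le> K"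
    unfolding eventually_at by auto
  \<comment> \<open>The filter at \<open>t\<close> leaves out \<open>t\<close> itself, but the mean
    value inequality needs a convex set; at the centre the bound holds by the choice of
    \<open>K\<close>.\<close>
  have K: "wsq W0 (g r) \<le> K" if "r \<in> ball t d" for r
    using that d(2)[of r] wsq_nonneg[OF W_nonneg(1) wsummable_szego_field[OF s], of t]
    by (cases "r = t") (auto simp: K_def g dist_commute)
  define q where "q r m = (1 / of_real (r - t)) * (a r m - a t m)" for r m
  have da: "wsummable W0 (\<lambda>m. a r m - a t m)" for r
    by (rule wsq_diff) (use s wsummable_weaken in auto)
  have q: "wsummable W0 (q r)" for r
    unfolding q_def by (rule wsq_cmult(1)[OF da])
  \<comment> \<open>The mean value inequality on the ball bounds the increments by
    \<open>K * (r - t)^2\<close>, and the square cancels in the quotients.\<close>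
  have qK: "\<forall>\<^sub>F r in at t. wsq W0 (q r) \<le> K"
    unfolding eventually_at
  proof (intro exI[of _ d] conjI ballI impI d(1))
    fix r assume r: "r \<noteq> t \<and> dist r t < d"
    have "wsq W0 (q r) = (cmod (1 / of_real (r - t)))\<^sup>2 * wsq W0 (\<lambda>m. a r m - a t m)"
      unfolding q_def by (rule wsq_cmult(2)[OF da])
    also have "\<dots> \<le> (cmod (1 / of_real (r - t)))\<^sup>2 * (K * (r - t)\<^sup>2)"
    proof (rule mult_left_mono)
      show "wsq W0 (\<lambda>m. a r m - a t m) \<le> K * (r - t)\<^sup>2"
        by (rule wsq_increment_le[of "ball t d" _ _ _ g])
           (use r d(1) K g(1) ode in \<open>auto simp: dist_commute g_def\<close>)
    qed auto
    also have "\<dots> = K" using r by (simp add: norm_divide power_divide del: of_real_diff)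
    finally show "wsq W0 (q r) \<le> K" .
  qed
  have pt: "((\<lambda>r. q r m) \<longlongrightarrow> g t m) (at t)" for m
    using ode[of m t] unfolding has_vector_derivative_iff_tendsto g_def q_def by simp
  have "((\<lambda>r. \<Sum>j<n. cnj_pow j (sdot (q r) (sconv (hankel_orbit (a t) (n - 1 - j)) (hankel_orbit (a r) j)))) \<longlongrightarrow>
      (\<Sum>j<n. cnj_pow j (sdot (g t) (sconv (hankel_orbit (a t) (n - 1 - j)) (hankel_orbit (a t) j))))) (at t)"
    by (intro tendsto_sum tendsto_cnj_pow tendsto_sdot_weak[OF q g(1) qK pt]
        wtendsto_sconv_hh wtendsto_const wtendsto_hankel_orbit cont wsummable_hankel_orbit s)
  moreover have "(\<Sum>j<n. cnj_pow j (sdot (q r) (sconv (hankel_orbit (a t) (n - 1 - j)) (hankel_orbit (a r) j)))) =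
      (hankel_orbit (a r) n 0 - hankel_orbit (a t) n 0) / of_real (r - t)" for r
  proof -
    have "sdot (q r) f = sdot (\<lambda>m. a r m - a t m) f / of_real (r - t)" if "wsummable W0 f" for f
    proof -
      have "sdot (q r) f = (\<Sum>m. (1 / of_real (r - t)) * ((a r m - a t m) * cnj (f m)))"
        by (simp add: sdot_def q_def mult.assoc)
      also have "\<dots> = (1 / of_real (r - t)) * sdot (\<lambda>m. a r m - a t m) f"
        unfolding sdot_def by (rule suminf_mult[OF sdot_Cauchy(1)[OF da that]])
      finally show ?thesis by simp
    qed
    moreover have "wsummable W0 (sconv (hankel_orbit (a t) i) (hankel_orbit (a r) j))" for i j
      by (intro sconv_hh wsummable_hankel_orbit s)
    moreover have "cnj_pow j (z / of_real c) = cnj_pow j z / of_real c" for j z and c :: real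
      by (simp add: cnj_pow_def)
    ultimately show ?thesis
      unfolding hankel_orbit_difference[OF s s] by (simp add: sum_divide_distrib del: of_real_diff)
  qed
  moreover have "sdot (g t) f = - \<i> * sdot (szego_field (a t)) f" if "wsummable W0 f" for f
  proof -
    have "sdot (g t) f = (\<Sum>m. (- \<i>) * (szego_field (a t) m * cnj (f m)))"
      by (simp add: sdot_def g_def mult.assoc)
    also have "\<dots> = - \<i> * sdot (szego_field (a t)) f"
      unfolding sdot_def by (rule suminf_mult[OF sdot_Cauchy(1)[OF wsummable_szego_field[OF s] that]])
    finally show ?thesis .
  qed
  moreover have "wsummable W0 (sconv (hankel_orbit (a t) i) (hankel_orbit (a t) j))" for i j
    by (intro sconv_hh wsummable_hankel_orbit s)
  ultimately show ?thesis
    unfolding has_vector_derivative_iff_tendsto using hankel_orbit_flow[OF s[of t], of n] by simp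
qed

section \<open>Square integrable functions on the circle\<close>

lemma space_circle [simp]: "space circle = sphere 0 1"
  by (simp add: circle_def space_restrict_space)

lemma sets_circle: "sets circle = sets (restrict_space borel (sphere 0 1))"
  by (simp add: circle_def)

lemma cis_measurable: "cis \<in> measurable (uniform_measure lborel {0..2 * pi}) (restrict_space borel (sphere 0 1))"
proof (rule measurable_restrict_space2)
  have "cis \<in> borel_measurable borel"
    by (intro borel_measurable_continuous_onI continuous_intros)
  then show "cis \<in> borel_measurable (uniform_measure lborel {0..2 * pi})"
    by simp
qed auto

lemma finite_measure_circle: "finite_measure circle"
proof -
  have "finite_measure (uniform_measure lborel {0..2 * pi})"
  proof (rule finite_measureI)
    have "emeasure (uniform_measure lborel {0..2 * pi}) {0..2 * pi} = 1"
      by (rule emeasure_uniform_measure_1) auto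
    then show "emeasure (uniform_measure lborel {0..2 * pi}) (space (uniform_measure lborel {0..2 * pi})) \<noteq> \<infinity>"
      by (subst emeasure_uniform_measure; simp)
  qed
  then show ?thesis
    unfolding circle_def by (rule finite_measure.finite_measure_distr[OF _ cis_measurable])
qed

interpretation circle: finite_measure circle
  by (rule finite_measure_circle)

lemma continuous_measurable_circle:
  assumes "continuous_on (sphere 0 1) f" shows "f \<in> borel_measurable circle"
  using borel_measurable_continuous_on_restrict[OF assms] measurable_cong_sets[OF sets_circle refl] by blast

lemma powi_measurable [measurable]: "(\<lambda>z. z powi k) \<in> borel_measurable circle"
  by (rule continuous_measurable_circle) (auto intro!: continuous_intros)

lemma power_measurable [measurable]: "(\<lambda>z. z ^ n) \<in> borel_measurable circle"
  by (rule continuous_measurable_circle) (auto intro!: continuous_intros)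

lemma norm_powi_circle: "cmod z = 1 \<Longrightarrow> cmod (z powi k) = 1"
  by (simp add: norm_power_int)

lemma cnj_powi_circle:
  assumes "cmod z = 1" shows "cnj (z powi k) = z powi (-k)"
proof -
  have "z * cnj z = 1" using assms by (simp add: complex_norm_square[symmetric])
  then have "cnj z = inverse z" by (metis inverse_unique)
  then show ?thesis by (simp add: power_int_minus power_int_inverse)
qed

lemma powi_add_circle: "cmod z = 1 \<Longrightarrow> z powi (j + k) = z powi j * z powi k"
  by (rule power_int_add) auto

lemma lint_circle:
  assumes f: "f \<in> borel_measurable circle"
  shows "(LINT z|circle. f z :: complex) = (LBINT x. indicator {0..2 * pi} x *\<^sub>R f (cis x)) / (2 * pi)"
proof -
  have f': "f \<in> borel_measurable (restrict_space borel (sphere 0 1))"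
    using f measurable_cong_sets[OF sets_circle refl] by blast
  have m: "(\<lambda>x. f (cis x)) \<in> borel_measurable (uniform_measure lborel {0..2 * pi})"
    by (rule measurable_compose[OF cis_measurable f'])
  then have m': "(\<lambda>x. f (cis x)) \<in> borel_measurable lborel" by simp
  have um: "uniform_measure lborel {0..2 * pi} = density lborel (\<lambda>x. ennreal (indicator {0..2 * pi} x / (2 * pi)))"
    unfolding uniform_measure_def
    by (rule arg_cong[of _ _ "density lborel"])
       (auto simp: fun_eq_iff divide_ennreal split: split_indicator simp flip: ennreal_1)
  have "(LINT z|circle. f z) = (LINT x|uniform_measure lborel {0..2 * pi}. f (cis x))"
    unfolding circle_def by (rule integral_distr[OF cis_measurable f'])
  also have "\<dots> = (LBINT x. (indicator {0..2 * pi} x / (2 * pi)) *\<^sub>R f (cis x))"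
    unfolding um by (rule integral_density[OF m']) auto
  also have "\<dots> = (LBINT x. (1 / (2 * pi)) *\<^sub>R (indicator {0..2 * pi} x *\<^sub>R f (cis x)))"
    by (intro Bochner_Integration.integral_cong refl) simp
  also have "\<dots> = (1 / (2 * pi)) *\<^sub>R (LBINT x. indicator {0..2 * pi} x *\<^sub>R f (cis x))"
    by (rule integral_scaleR_right)
  finally show ?thesis by (simp add: scaleR_conv_of_real)
qed

lemma lint_powi: "(LINT z|circle. z powi k) = (if k = 0 then 1 else 0)"
proof (cases "k = 0")
  case True
  have "(LINT z|circle. z powi k) = (LBINT x. indicator {0..2 * pi} x *\<^sub>R (1::complex)) / (2 * pi)"
    using True by (subst lint_circle) auto
  also have "(LBINT x. indicator {0..2 * pi} x *\<^sub>R (1::complex)) = complex_of_real (2 * pi)"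
    by (subst integral_scaleR_left) (auto simp: scaleR_conv_of_real)
  finally show ?thesis using True by simp
next
  case False
  let ?F = "\<lambda>x. cis (of_int k * x) / (\<i> * of_int k)"
  have "(LBINT x. indicator {0..2 * pi} x *\<^sub>R cis (of_int k * x)) = ?F (2 * pi) - ?F 0"
  proof (rule integral_FTC_atLeastAtMost)
    fix x
    have "(?F has_vector_derivative (of_real (real_of_int k) * (\<i> * cis (of_int k * x)) / (\<i> * of_int k))) (at x within {0..2 * pi})"
      unfolding cis_conv_exp
      by (auto intro!: derivative_eq_intros has_vector_derivative_real_field simp: field_simps)
    moreover have "of_real (real_of_int k) * (\<i> * cis (of_int k * x)) / (\<i> * of_int k) = cis (of_int k * x)"
      using False by simp
    ultimately show "(?F has_vector_derivative cis (of_int k * x)) (at x within {0..2 * pi})" by simp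
  qed (auto intro!: continuous_intros)
  also have "\<dots> = 0"
    using cis_multiple_2pi[of "of_int k"] by (simp add: mult.commute)
  finally show ?thesis
    using False by (subst lint_circle) (auto simp: cis_power_int)
qed

section \<open>Norm and inner product of square integrable functions\<close>

definition nsq :: "(complex \<Rightarrow> complex) \<Rightarrow> real" where
  "nsq f = (LINT z|circle. (cmod (f z))\<^sup>2)"

lemma L2_measurable: "f \<in> L2 \<Longrightarrow> f \<in> borel_measurable circle"
  and L2_integrable_sq: "f \<in> L2 \<Longrightarrow> integrable circle (\<lambda>z. (cmod (f z))\<^sup>2)"
  by (auto simp: L2_def)

lemma nsq_nonneg [simp]: "nsq f \<ge> 0"
  by (simp add: nsq_def)

lemma L2_bounded:
  assumes "f \<in> borel_measurable circle" "\<And>z. cmod z = 1 \<Longrightarrow> cmod (f z) \<le> B"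
  shows "f \<in> L2"
  unfolding L2_def
proof (clarify, intro conjI assms(1))
  show "integrable circle (\<lambda>z. (cmod (f z))\<^sup>2)"
  proof (rule circle.integrable_const_bound[of _ "B\<^sup>2"])
    show "AE z in circle. norm ((cmod (f z))\<^sup>2) \<le> B\<^sup>2"
      by (rule AE_I2) (auto intro!: power_mono assms(2))
  qed (use assms(1) in measurable)
qed

lemma L2_powi [simp]: "(\<lambda>z. z powi k) \<in> L2"
  by (rule L2_bounded[of _ 1]) (auto simp: norm_powi_circle)

lemma L2_power [simp]: "(\<lambda>z. z ^ n) \<in> L2"
  by (rule L2_bounded[of _ 1]) (auto simp: norm_power)

lemma L2_add: assumes "f \<in> L2" "g \<in> L2" shows "(\<lambda>z. f z + g z) \<in> L2"
proof -
  note [measurable] = assms[THEN L2_measurable]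
  have "integrable circle (\<lambda>z. 2 * (cmod (f z))\<^sup>2 + 2 * (cmod (g z))\<^sup>2)"
    using assms[THEN L2_integrable_sq] by auto
  then have "integrable circle (\<lambda>z. (cmod (f z + g z))\<^sup>2)"
    by (rule Bochner_Integration.integrable_bound)
       (use cmod_add_sq_le in \<open>auto intro!: AE_I2\<close>)
  then show ?thesis by (auto simp: L2_def)
qed

lemma L2_cmult: assumes "f \<in> L2" shows "(\<lambda>z. c * f z) \<in> L2"
  using assms by (auto simp: L2_def norm_mult power_mult_distrib)

lemma L2_diff: assumes "f \<in> L2" "g \<in> L2" shows "(\<lambda>z. f z - g z) \<in> L2"
  using L2_add[OF assms(1) L2_cmult[OF assms(2), of "-1"]] by simp

lemma L2_sum: "(\<And>i. i \<in> A \<Longrightarrow> f i \<in> L2) \<Longrightarrow> (\<lambda>z. \<Sum>i\<in>A. f i z) \<in> L2"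
  by (induction A rule: infinite_finite_induct) (auto intro: L2_add L2_bounded[of _ 0])

lemma L2_cnj: assumes "f \<in> L2" shows "(\<lambda>z. cnj (f z)) \<in> L2"
proof -
  have "cnj \<in> borel_measurable borel"
    by (intro borel_measurable_continuous_onI continuous_intros)
  from measurable_compose[OF L2_measurable[OF assms] this] show ?thesis
    using assms by (simp add: L2_def)
qed

lemma L2_mult_powi:
  assumes f: "f \<in> L2" shows "(\<lambda>z. f z * z powi k) \<in> L2"
proof -
  note [measurable] = f[THEN L2_measurable]
  have "integrable circle (\<lambda>z. (cmod (f z * z powi k))\<^sup>2)"
    using L2_integrable_sq[OF f]
    by (rule Bochner_Integration.integrable_cong[THEN iffD1, rotated 2]) (auto simp: norm_mult norm_powi_circle)
  then show ?thesis by (auto simp: L2_def)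
qed

lemma nsq_mult_powi: "nsq (\<lambda>z. f z * z powi k) = nsq f"
  unfolding nsq_def by (rule Bochner_Integration.integral_cong) (auto simp: norm_mult norm_powi_circle)

lemma L2_mult_integrable:
  assumes "f \<in> L2" "g \<in> L2" shows "integrable circle (\<lambda>z. f z * g z)"
proof -
  note [measurable] = assms[THEN L2_measurable]
  have "integrable circle (\<lambda>z. (cmod (f z))\<^sup>2 + (cmod (g z))\<^sup>2)"
    using assms[THEN L2_integrable_sq] by auto
  then show ?thesis
  proof (rule Bochner_Integration.integrable_bound)
    have "cmod x * cmod y \<le> (cmod x)\<^sup>2 + (cmod y)\<^sup>2" for x y
      using sum_squares_bound[of "cmod x" "cmod y"] mult_nonneg_nonneg[OF norm_ge_zero norm_ge_zero, of x y]
      unfolding mult.assoc by linarith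
    then show "AE z in circle. norm (f z * g z) \<le> norm ((cmod (f z))\<^sup>2 + (cmod (g z))\<^sup>2)"
      by (intro AE_I2) (auto simp: norm_mult)
  qed measurable
qed

lemma L2_integrable: assumes "f \<in> L2" shows "integrable circle f"
  using L2_mult_integrable[OF assms L2_powi[of 0]] by simp

lemma ip_integrable: "f \<in> L2 \<Longrightarrow> g \<in> L2 \<Longrightarrow> integrable circle (\<lambda>z. f z * cnj (g z))"
  by (intro L2_mult_integrable L2_cnj)

lemma ip_diff_left: "f \<in> L2 \<Longrightarrow> g \<in> L2 \<Longrightarrow> h \<in> L2 \<Longrightarrow> ip (\<lambda>z. f z - g z) h = ip f h - ip g h"
  unfolding ip_def left_diff_distrib by (intro Bochner_Integration.integral_diff ip_integrable)

lemma ip_diff_right: "f \<in> L2 \<Longrightarrow> g \<in> L2 \<Longrightarrow> h \<in> L2 \<Longrightarrow> ip f (\<lambda>z. g z - h z) = ip f g - ip f h"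
  unfolding ip_def complex_cnj_diff right_diff_distrib by (intro Bochner_Integration.integral_diff ip_integrable)

lemma ip_cnj: "cnj (ip f g) = ip g f"
  unfolding ip_def Bochner_Integration.integral_cnj[symmetric] by (simp add: mult.commute)

lemma ip_sum_left:
  "(\<And>i. i \<in> A \<Longrightarrow> f i \<in> L2) \<Longrightarrow> h \<in> L2 \<Longrightarrow> ip (\<lambda>z. \<Sum>i\<in>A. c i * f i z) h = (\<Sum>i\<in>A. c i * ip (f i) h)"
  unfolding ip_def sum_distrib_right mult.assoc
  by (subst Bochner_Integration.integral_sum)
     (auto intro!: ip_integrable Bochner_Integration.integrable_mult_right)

lemma ip_self: "ip f f = of_real (nsq f)"
  unfolding ip_def nsq_def integral_complex_of_real[symmetric] complex_norm_square ..

text \<open>A coarse form of Cauchy-Schwarz, from 2xy <= t x^2 + y^2/t with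
  \<open>t = sqrt (nsq g)\<close>. Continuity of \<open>ip\<close> needs only that the bound tends
  to 0 with \<open>nsq g\<close>.\<close>

lemma ip_bound:
  assumes f: "f \<in> L2" and g: "g \<in> L2"
  shows "cmod (ip f g) \<le> (nsq f + 1) * sqrt (nsq g)"
proof -
  have t: "2 * cmod (ip f g) \<le> t * nsq f + nsq g / t" if t: "t > 0" for t
  proof -
    have "cmod (ip f g) \<le> (LINT z|circle. norm (f z * cnj (g z)))"
      unfolding ip_def by (rule integral_norm_bound)
    also have "\<dots> \<le> (LINT z|circle. (t * (cmod (f z))\<^sup>2 + (cmod (g z))\<^sup>2 / t) / 2)"
    proof (rule integral_mono)
      fix z
      have "0 \<le> (sqrt t * cmod (f z) - cmod (g z) / sqrt t)\<^sup>2" by simp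
      also have "\<dots> = t * (cmod (f z))\<^sup>2 + (cmod (g z))\<^sup>2 / t - 2 * (cmod (f z) * cmod (g z))"
        using t by (simp add: power2_diff power_mult_distrib power_divide)
      finally show "norm (f z * cnj (g z)) \<le> (t * (cmod (f z))\<^sup>2 + (cmod (g z))\<^sup>2 / t) / 2"
        by (simp add: norm_mult)
    next
      show "integrable circle (\<lambda>z. norm (f z * cnj (g z)))"
        by (intro integrable_norm ip_integrable f g)
      show "integrable circle (\<lambda>z. (t * (cmod (f z))\<^sup>2 + (cmod (g z))\<^sup>2 / t) / 2)"
        using L2_integrable_sq[OF f] L2_integrable_sq[OF g] by simp
    qed
    also have "\<dots> = (t * nsq f + nsq g / t) / 2"
      using f g L2_integrable_sq by (simp add: nsq_def)
    finally show ?thesis by simp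
  qed
  show ?thesis
  proof (cases "nsq g = 0")
    case True
    have "cmod (ip f g) \<le> 0"
    proof (rule field_le_epsilon)
      fix e :: real assume e: "e > 0"
      \<comment> \<open>With \<open>nsq g = 0\<close> every \<open>t > 0\<close> is allowed; adding
        1 keeps the denominator positive.\<close>
      have "2 * cmod (ip f g) \<le> e / (nsq f + 1) * nsq f"
        using t[of "e / (nsq f + 1)"] e True by (simp add: add_nonneg_pos)
      also have "\<dots> = e * (nsq f / (nsq f + 1))" by simp
      also have "\<dots> \<le> e * 1"
        using e by (intro mult_left_mono) (auto simp: divide_le_eq add_nonneg_pos intro: add_nonneg_pos)
      finally show "cmod (ip f g) \<le> 0 + e" using e by simp
    qed
    then show ?thesis using True by simp
  next
    case False
    then have p: "sqrt (nsq g) > 0" using nsq_nonneg[of g] by (simp add: less_le)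
    have "2 * cmod (ip f g) \<le> sqrt (nsq g) * nsq f + sqrt (nsq g)"
      using t[OF p] by (simp add: real_div_sqrt)
    moreover have "(nsq f + 1) * sqrt (nsq g) = sqrt (nsq g) * nsq f + sqrt (nsq g)"
      by (simp add: algebra_simps)
    ultimately show ?thesis using norm_ge_zero[of "ip f g"] by linarith
  qed
qed

lemma tendsto_ip_right:
  assumes "\<And>N. f N \<in> L2" "g \<in> L2" "w \<in> L2" "((\<lambda>N. nsq (\<lambda>z. f N z - g z)) \<longlongrightarrow> 0) F"
  shows "((\<lambda>N. ip w (f N)) \<longlongrightarrow> ip w g) F"
proof -
  have "((\<lambda>N. (nsq w + 1) * sqrt (nsq (\<lambda>z. f N z - g z))) \<longlongrightarrow> (nsq w + 1) * sqrt 0) F"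
    by (intro tendsto_intros assms)
  then have lim: "((\<lambda>N. (nsq w + 1) * sqrt (nsq (\<lambda>z. f N z - g z))) \<longlongrightarrow> 0) F" by simp
  have "((\<lambda>N. ip w (f N) - ip w g) \<longlongrightarrow> 0) F"
  proof (rule Lim_null_comparison[OF _ lim], intro always_eventually allI)
    fix N
    have "cmod (ip w (\<lambda>z. f N z - g z)) \<le> (nsq w + 1) * sqrt (nsq (\<lambda>z. f N z - g z))"
      by (intro ip_bound L2_diff assms)
    then show "norm (ip w (f N) - ip w g) \<le> (nsq w + 1) * sqrt (nsq (\<lambda>z. f N z - g z))"
      by (simp add: ip_diff_right assms)
  qed
  then show ?thesis by (simp add: LIM_zero_iff)
qed

lemma tendsto_ip_left:
  assumes "\<And>N. f N \<in> L2" "g \<in> L2" "w \<in> L2" "((\<lambda>N. nsq (\<lambda>z. f N z - g z)) \<longlongrightarrow> 0) F"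
  shows "((\<lambda>N. ip (f N) w) \<longlongrightarrow> ip g w) F"
  using tendsto_cnj[OF tendsto_ip_right[OF assms]] by (simp add: ip_cnj)

section \<open>Partial sums of power series\<close>

definition psum :: "(nat \<Rightarrow> complex) \<Rightarrow> nat \<Rightarrow> complex \<Rightarrow> complex" where
  "psum c N z = (\<Sum>n<N. c n * z ^ n)"

lemma psum_L2 [simp]: "psum c N \<in> L2"
  unfolding psum_def[abs_def] by (intro L2_sum L2_cmult L2_power)

lemma fhat_power: "fhat (\<lambda>z. z ^ n) k = (if int n = k then 1 else 0)"
proof -
  have "fhat (\<lambda>z. z ^ n) k = (LINT z|circle. z powi (int n - k))"
    unfolding fhat_def ip_def
  proof (rule Bochner_Integration.integral_cong[OF refl])
    fix z assume "z \<in> space circle"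
    then have z: "cmod z = 1" by simp
    show "z ^ n * cnj (z powi k) = z powi (int n - k)"
      unfolding cnj_powi_circle[OF z] using powi_add_circle[OF z, of "int n" "-k"] by simp
  qed
  then show ?thesis by (simp add: lint_powi)
qed

lemma ip_psum_left: "h \<in> L2 \<Longrightarrow> ip (psum c N) h = (\<Sum>n<N. c n * cnj (fhat h (int n)))"
proof -
  assume h: "h \<in> L2"
  have "ip (psum c N) h = (\<Sum>n<N. c n * ip (\<lambda>z. z ^ n) h)"
    unfolding psum_def[abs_def] by (rule ip_sum_left) (use h in auto)
  also have "\<dots> = (\<Sum>n<N. c n * cnj (fhat h (int n)))"
    by (simp add: fhat_def ip_cnj)
  finally show ?thesis .
qed

lemma fhat_psum: "fhat (psum c N) k = (if k \<ge> 0 \<and> nat k < N then c (nat k) else 0)"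
proof -
  have "fhat (psum c N) k = (\<Sum>n<N. c n * fhat (\<lambda>z. z ^ n) k)"
    unfolding fhat_def psum_def[abs_def] by (rule ip_sum_left) auto
  also have "\<dots> = (\<Sum>n<N. if n = nat k then if k \<ge> 0 then c n else 0 else 0)"
    by (intro sum.cong) (auto simp: fhat_power)
  finally show ?thesis by auto
qed

lemma nsq_psum: "nsq (psum c N) = (\<Sum>n<N. (cmod (c n))\<^sup>2)"
proof -
  have "complex_of_real (nsq (psum c N)) = of_real (\<Sum>n<N. (cmod (c n))\<^sup>2)"
    unfolding ip_self[symmetric] ip_psum_left[OF psum_L2] fhat_psum of_real_sum
    unfolding complex_norm_square by (intro sum.cong) auto
  then show ?thesis by (simp only: of_real_eq_iff)
qed

text \<open>Erasing the first \<open>M\<close> coefficients exhibits the difference as a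
  \<open>psum\<close>, so that \<open>nsq_psum\<close> evaluates its norm.\<close>

lemma psum_diff: "M \<le> N \<Longrightarrow> psum c N z - psum c M z = psum (\<lambda>n. if n < M then 0 else c n) N z"
proof -
  assume "M \<le> N"
  then have "{..<N} = {..<M} \<union> {M..<N}" by auto
  moreover have "psum (\<lambda>n. if n < M then 0 else c n) N z = (\<Sum>n\<in>{M..<N}. c n * z ^ n)"
    unfolding psum_def by (rule sum.mono_neutral_cong_right) auto
  ultimately show ?thesis
    by (simp add: psum_def sum.union_disjoint ivl_disj_int)
qed

lemma nsq_psum_diff:
  assumes c: "wsummable W0 c" and "M \<le> N"
  shows "nsq (\<lambda>z. psum c N z - psum c M z) \<le> wsq W0 (\<lambda>n. seq_trunc M c n - c n)"
proof -
  let ?c = "\<lambda>n. seq_trunc M c n - c n"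
  have "nsq (\<lambda>z. psum c N z - psum c M z) = (\<Sum>n<N. W0 n * (cmod (?c n))\<^sup>2)"
    unfolding psum_diff[OF \<open>M \<le> N\<close>] nsq_psum by (intro sum.cong) (auto simp: seq_trunc_def W0_def)
  also have "\<dots> \<le> wsq W0 ?c"
    by (intro wsq_partial wsq_diff(1) seq_trunc_summable c) auto
  finally show ?thesis .
qed

section \<open>Uniqueness of Fourier coefficients and the Riesz--Fischer theorem\<close>

lemma integrable_mult_bounded:
  assumes f: "integrable circle f" and g: "g \<in> borel_measurable circle"
    and B: "\<And>z. cmod z = 1 \<Longrightarrow> cmod (g z) \<le> B"
  shows "integrable circle (\<lambda>z. f z * g z :: complex)"
proof (rule Bochner_Integration.integrable_bound[of _ "\<lambda>z. of_real B * f z"])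
  note [measurable] = borel_measurable_integrable[OF f] g
  show "integrable circle (\<lambda>z. of_real B * f z)" using f by simp
  show "(\<lambda>z. f z * g z) \<in> borel_measurable circle" by measurable
  have "cmod (f z) * cmod (g z) \<le> \<bar>B\<bar> * cmod (f z)" if "cmod z = 1" for z
    using mult_right_mono[OF order_trans[OF B[OF that] abs_ge_self], of "cmod (f z)"]
    by (simp add: mult.commute)
  then show "AE z in circle. norm (f z * g z) \<le> norm (of_real B * f z)"
    by (intro AE_I2) (simp add: norm_mult)
qed

text \<open>Asks for integrability only, because uniqueness will be applied to a product of two
  \<open>L2\<close> functions. The class is stable under multiplication by powers of z, hence by
  polynomials.\<close>

definition fourier_null :: "(complex \<Rightarrow> complex) \<Rightarrow> bool" where
  "fourier_null f \<longleftrightarrow> integrable circle f \<and> (\<forall>k. fhat f k = 0)"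

lemma fourier_null_cong:
  assumes "fourier_null f" "\<And>z. cmod z = 1 \<Longrightarrow> f z = g z"
  shows "fourier_null g"
proof -
  have "fhat g k = fhat f k" for k
    unfolding fhat_def ip_def by (rule Bochner_Integration.integral_cong) (auto simp: assms(2))
  moreover have "integrable circle g = integrable circle f"
    by (rule Bochner_Integration.integrable_cong) (auto simp: assms(2))
  ultimately show ?thesis using assms(1) by (simp add: fourier_null_def)
qed

lemma integrable_mult_cnj_powi:
  "integrable circle f \<Longrightarrow> integrable circle (\<lambda>z. f z * cnj (z powi k))"
proof (rule integrable_mult_bounded[of _ _ 1])
  show "(\<lambda>z. cnj (z powi k)) \<in> borel_measurable circle"
    by (rule L2_measurable[OF L2_cnj[OF L2_powi]])
qed (auto simp: norm_powi_circle simp del: complex_cnj_power_int)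

lemma fourier_null_add:
  assumes "fourier_null f" "fourier_null g" shows "fourier_null (\<lambda>z. f z + g z)"
  using assms integrable_mult_cnj_powi[of f] integrable_mult_cnj_powi[of g]
  by (auto simp: fourier_null_def fhat_def ip_def distrib_right simp del: complex_cnj_power_int)

lemma fourier_null_cmult:
  assumes "fourier_null f" shows "fourier_null (\<lambda>z. c * f z)"
  using assms by (auto simp: fourier_null_def fhat_def ip_def mult.assoc simp del: complex_cnj_power_int)

lemma fourier_null_powi:
  assumes "fourier_null f" shows "fourier_null (\<lambda>z. f z * z powi j)"
  unfolding fourier_null_def
proof (intro conjI allI)
  show "integrable circle (\<lambda>z. f z * z powi j)"
    by (rule integrable_mult_bounded[of _ _ 1]) (use assms in \<open>auto simp: fourier_null_def norm_powi_circle\<close>)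
  fix k
  have "fhat (\<lambda>z. f z * z powi j) k = fhat f (k - j)"
    unfolding fhat_def ip_def
  proof (rule Bochner_Integration.integral_cong[OF refl])
    fix z assume "z \<in> space circle"
    then have z: "cmod z = 1" by simp
    show "f z * z powi j * cnj (z powi k) = f z * cnj (z powi (k - j))"
      unfolding cnj_powi_circle[OF z] using powi_add_circle[OF z, of j "-k"] by simp
  qed
  then show "fhat (\<lambda>z. f z * z powi j) k = 0" using assms by (simp add: fourier_null_def)
qed

text \<open>
  Quantifying over \<open>f\<close> makes the product case of the induction two applications of the hypotheses.
\<close>

lemma fourier_null_polynomial:
  assumes "real_polynomial_function p" "fourier_null f"
  shows "fourier_null (\<lambda>z. f z * of_real (p z))"
  using assms
proof (induction arbitrary: f rule: real_polynomial_function.induct)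
  case (linear p)
  interpret p: bounded_linear p by fact
  \<comment> \<open>A real-linear \<open>p\<close> is \<open>Re z * p 1 + Im z * p \<i>\<close>, and
    on the circle \<open>Re z\<close> and \<open>Im z\<close> are combinations of z and its inverse;
    multiplying by \<open>p\<close> thus combines two index shifts.\<close>
  have "fourier_null (\<lambda>z. (of_real (p 1) - \<i> * of_real (p \<i>)) / 2 * (f z * z powi 1)
      + (of_real (p 1) + \<i> * of_real (p \<i>)) / 2 * (f z * z powi (-1)))"
    by (intro fourier_null_add fourier_null_cmult fourier_null_powi linear.prems)
  then show ?case
  proof (rule fourier_null_cong)
    fix z :: complex assume z: "cmod z = 1"
    have "z powi (-1) = cnj z" using cnj_powi_circle[OF z, of 1] by simp
    moreover have "p z = Re z * p 1 + Im z * p \<i>"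
    proof -
      have "z = Re z *\<^sub>R 1 + Im z *\<^sub>R \<i>" by (simp add: complex_eq_iff)
      then have "p z = p (Re z *\<^sub>R 1 + Im z *\<^sub>R \<i>)" by simp
      then show ?thesis by (simp only: p.add p.scaleR real_scaleR_def)
    qed
    moreover have "complex_of_real (Re z) = (z + cnj z) / 2" "complex_of_real (Im z) = - \<i> * (z - cnj z) / 2"
      by (auto simp: complex_eq_iff)
    ultimately have "z powi (-1) = cnj z"
      "complex_of_real (p z) = (z + cnj z) / 2 * of_real (p 1) + - \<i> * (z - cnj z) / 2 * of_real (p \<i>)"
      by (simp_all only: of_real_add of_real_mult)
    moreover have "(P - \<i> * Q) / 2 * (F * a) + (P + \<i> * Q) / 2 * (F * b) =
      F * ((a + b) / 2 * P + - \<i> * (a - b) / 2 * Q)" for P Q F a b :: complex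
      by (simp add: field_simps)
    ultimately show "(of_real (p 1) - \<i> * of_real (p \<i>)) / 2 * (f z * z powi 1)
      + (of_real (p 1) + \<i> * of_real (p \<i>)) / 2 * (f z * z powi (-1)) = f z * of_real (p z)"
      by (simp only: power_int_1_right)
  qed
next
  case (const c)
  then show ?case using fourier_null_cmult[of f "of_real c"] by (simp add: mult.commute)
next
  case (add p q)
  then show ?case using fourier_null_add by (simp add: distrib_left)
next
  case (mult p q)
  then show ?case using mult.IH(2)[OF mult.IH(1)] by (simp add: mult.assoc)
qed

text \<open>Replacing \<open>\<phi>\<close> by a uniformly close real polynomial costs at most
  \<open>e\<close> times the L^1 norm of \<open>f\<close>, and the polynomial part integrates to a
  zeroth Fourier coefficient that vanishes.\<close>

lemma fourier_null_continuous:
  fixes \<phi> :: "complex \<Rightarrow> real"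
  assumes f: "fourier_null f" and \<phi>: "continuous_on (sphere 0 1) \<phi>"
  shows "(LINT z|circle. f z * of_real (\<phi> z)) = 0"
proof -
  have fi: "integrable circle f" using f by (simp add: fourier_null_def)
  obtain B where B: "\<And>z. cmod z = 1 \<Longrightarrow> \<bar>\<phi> z\<bar> \<le> B"
    using compact_imp_bounded[OF compact_continuous_image[OF \<phi> compact_sphere]]
    by (force simp: bounded_iff)
  have "(\<lambda>z. complex_of_real (\<phi> z)) \<in> borel_measurable circle"
    by (intro continuous_measurable_circle continuous_intros \<phi>)
  then have i1: "integrable circle (\<lambda>z. f z * of_real (\<phi> z))"
    by (rule integrable_mult_bounded[OF fi, of _ B]) (use B in auto)
  have bd: "cmod (LINT z|circle. f z * of_real (\<phi> z)) \<le> e * (LINT z|circle. cmod (f z))" if e: "e > 0" for e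
  proof -
    obtain p where p: "real_polynomial_function p" "\<And>z. z \<in> sphere 0 1 \<Longrightarrow> \<bar>\<phi> z - p z\<bar> < e"
      using Stone_Weierstrass_real_polynomial_function[OF compact_sphere \<phi> e] by blast
    have fp: "fourier_null (\<lambda>z. f z * of_real (p z))"
      by (rule fourier_null_polynomial[OF p(1) f])
    then have "fhat (\<lambda>z. f z * of_real (p z)) 0 = 0" "integrable circle (\<lambda>z. f z * of_real (p z))"
      by (simp_all add: fourier_null_def)
    then have "(LINT z|circle. f z * of_real (p z)) = 0" by (simp add: fhat_def ip_def)
    then have "(LINT z|circle. f z * of_real (\<phi> z)) = (LINT z|circle. f z * of_real (\<phi> z) - f z * of_real (p z))"
      using i1 fp by (simp add: fourier_null_def)
    also have "cmod \<dots> \<le> (LINT z|circle. e * cmod (f z))"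
    proof (rule Bochner_Integration.integral_norm_bound_integral)
      fix z assume "z \<in> space circle"
      then have z: "cmod z = 1" by simp
      have "f z * of_real (\<phi> z) - f z * of_real (p z) = f z * of_real (\<phi> z - p z)"
        by (simp add: right_diff_distrib)
      then have "cmod (f z * of_real (\<phi> z) - f z * of_real (p z)) = cmod (f z) * \<bar>\<phi> z - p z\<bar>"
        by (simp only: norm_mult norm_of_real)
      also have "\<dots> \<le> cmod (f z) * e" by (intro mult_left_mono) (use p(2)[of z] z in auto)
      finally show "cmod (f z * of_real (\<phi> z) - f z * of_real (p z)) \<le> e * cmod (f z)"
        by (simp add: mult.commute)
    qed (use i1 fp fi in \<open>auto simp: fourier_null_def\<close>)
    finally show ?thesis by simp
  qed
  have I: "(LINT z|circle. cmod (f z)) \<ge> 0" by (intro integral_nonneg_AE) auto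
  have "cmod (LINT z|circle. f z * of_real (\<phi> z)) \<le> 0"
  proof (rule field_le_epsilon)
    fix e :: real assume e: "e > 0"
    let ?I = "LINT z|circle. cmod (f z)"
    have p: "?I + 1 > 0" using I by linarith
    have "cmod (LINT z|circle. f z * of_real (\<phi> z)) \<le> e / (?I + 1) * ?I"
      by (rule bd) (use e p in simp)
    also have "\<dots> = e * (?I / (?I + 1))" by simp
    also have "\<dots> \<le> e * 1"
    proof (rule mult_left_mono)
      show "?I / (?I + 1) \<le> 1" unfolding pos_divide_le_eq[OF p] by simp
    qed (use e in simp)
    finally show "cmod (LINT z|circle. f z * of_real (\<phi> z)) \<le> 0 + e" by simp
  qed
  then show ?thesis by simp
qed

lemma sets_circle_Int: "A \<in> sets borel \<Longrightarrow> A \<inter> sphere 0 1 \<in> sets circle"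
  unfolding sets_circle by (auto simp: sets_restrict_space)

text \<open>The indicator of an open set is a pointwise limit of continuous functions with values in
  [0, 1], built from the distance to the complement; dominated convergence does the rest.\<close>

lemma fourier_null_set_integral_open:
  assumes f: "fourier_null f" and U: "open U"
  shows "(LINT z:U \<inter> sphere 0 1|circle. f z) = 0"
proof -
  have fi: "integrable circle f" using f by (simp add: fourier_null_def)
  have eq: "(LINT z:U \<inter> sphere 0 1|circle. f z) = (LINT z|circle. f z * of_real (indicator U z))"
    unfolding set_lebesgue_integral_def
    by (rule Bochner_Integration.integral_cong) (auto split: split_indicator)
  show ?thesis
  \<comment> \<open>The distance to the empty set is 0 by convention, so the whole plane needs its
    own argument: there the integral is the zeroth coefficient.\<close>
  proof (cases "U = UNIV")
    case True
    then have "(LINT z|circle. f z * of_real (indicator U z)) = fhat f 0" by (simp add: fhat_def ip_def)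
    then show ?thesis using f by (simp add: eq fourier_null_def)
  next
    case False
    define \<phi> where "\<phi> n z = min 1 (real n * infdist z (- U))" for n z
    have bd: "0 \<le> \<phi> n z" "\<phi> n z \<le> 1" for n z
      unfolding \<phi>_def by (auto simp: infdist_nonneg)
    have c: "continuous_on (sphere 0 1) (\<phi> n)" for n
      unfolding \<phi>_def by (intro continuous_intros)
    have m: "(\<lambda>z. complex_of_real (\<phi> n z)) \<in> borel_measurable circle" for n
      by (intro continuous_measurable_circle continuous_intros c)
    have lim: "(\<lambda>n. \<phi> n z) \<longlonglongrightarrow> indicator U z" for z
    proof (cases "z \<in> U")
      case True
      then have "infdist z (- U) \<noteq> 0"
        using in_closed_iff_infdist_zero[of "- U" z] U False by auto
      then have pos: "infdist z (- U) > 0" using infdist_nonneg[of z "- U"] by linarith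
      obtain N :: nat where "1 < real N * infdist z (- U)"
        using reals_Archimedean3[OF pos] by blast
      then have N: "real N * infdist z (- U) \<ge> 1" by simp
      have "\<phi> n z = 1" if "n \<ge> N" for n
      proof -
        have "real N * infdist z (- U) \<le> real n * infdist z (- U)"
          using that pos by (intro mult_right_mono) auto
        then show ?thesis using N by (simp add: \<phi>_def)
      qed
      then have "\<forall>\<^sub>F n in sequentially. \<phi> n z = indicator U z"
        unfolding eventually_sequentially using True by (intro exI[of _ N]) auto
      then show ?thesis by (rule tendsto_eventually)
    next
      case False
      then show ?thesis by (simp add: \<phi>_def)
    qed
    have mU: "(\<lambda>z. complex_of_real (indicator U z)) \<in> borel_measurable circle"
    proof -
      have "(indicator (U \<inter> sphere 0 1) :: complex \<Rightarrow> real) \<in> borel_measurable circle"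
        by (rule borel_measurable_indicator[OF sets_circle_Int]) (use U in auto)
      then have "(\<lambda>z. complex_of_real (indicator (U \<inter> sphere 0 1) z)) \<in> borel_measurable circle"
        by measurable
      then show ?thesis
        by (rule measurable_cong[THEN iffD1, rotated]) (auto split: split_indicator)
    qed
    have "(\<lambda>n. LINT z|circle. f z * of_real (\<phi> n z)) \<longlonglongrightarrow> (LINT z|circle. f z * of_real (indicator U z))"
    proof (rule integral_dominated_convergence[where w = "\<lambda>z. cmod (f z)"])
      show "AE z in circle. (\<lambda>n. f z * of_real (\<phi> n z)) \<longlonglongrightarrow> f z * of_real (indicator U z)"
        by (intro AE_I2 tendsto_intros lim)
      show "AE z in circle. norm (f z * of_real (\<phi> n z)) \<le> cmod (f z)" for n
        using bd[of n] by (intro AE_I2) (simp add: norm_mult mult_left_le)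
    qed (use fi borel_measurable_integrable[OF fi] m mU in \<open>auto intro!: borel_measurable_times\<close>)
    then have "(LINT z|circle. f z * of_real (indicator U z)) = 0"
      using fourier_null_continuous[OF f c] by (simp add: LIMSEQ_const_iff)
    then show ?thesis by (simp only: eq)
  qed
qed

text \<open>Open sets form an intersection-stable generator. The sets over which \<open>f\<close>
  integrates to 0 are closed under disjoint unions, and under complements because the integral over
  the whole circle is \<open>fhat f 0\<close>.\<close>

lemma fourier_null_set_integral:
  assumes f: "fourier_null f" and A: "A \<in> sets borel"
  shows "(LINT z:A \<inter> sphere 0 1|circle. f z) = 0"
proof -
  have fi: "integrable circle f" using f by (simp add: fourier_null_def)
  have si: "set_integrable circle (B \<inter> sphere 0 1) f" if "B \<in> sets borel" for B
    unfolding set_integrable_def by (intro integrable_mult_indicator sets_circle_Int that fi)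
  note sb = sets_borel[where 'a = complex]
  have "Int_stable {S::complex set. open S}" "{S::complex set. open S} \<subseteq> Pow UNIV"
    by (auto simp: Int_stable_def)
  from this A[unfolded sb] show ?thesis
  proof (induction rule: sigma_sets_induct_disjoint)
    case (basic A)
    then show ?case using fourier_null_set_integral_open[OF f] by simp
  next
    case empty
    then show ?case by (simp add: set_lebesgue_integral_def)
  next
    case (compl A)
    then have "A \<in> sets borel" unfolding sb by simp
    then have i: "integrable circle (\<lambda>z. indicator (A \<inter> sphere 0 1) z *\<^sub>R f z)"
      using si by (simp add: set_integrable_def)
    have "(LINT z:(UNIV - A) \<inter> sphere 0 1|circle. f z) =
        (LINT z|circle. f z - indicator (A \<inter> sphere 0 1) z *\<^sub>R f z)"
      unfolding set_lebesgue_integral_def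
      by (rule Bochner_Integration.integral_cong) (auto split: split_indicator)
    also have "\<dots> = fhat f 0 - (LINT z:A \<inter> sphere 0 1|circle. f z)"
      using fi i by (simp add: fhat_def ip_def set_lebesgue_integral_def)
    finally show ?case using f compl.IH unfolding fourier_null_def by simp
  next
    case (union A)
    have b: "A i \<in> sets borel" for i using union(2) unfolding sb by auto
    have U: "(\<Union>i. A i) \<inter> sphere 0 1 = (\<Union>i. A i \<inter> sphere 0 1)" by auto
    have "(LINT z:(\<Union>i. A i \<inter> sphere 0 1)|circle. f z) = (\<Sum>i. LINT z:A i \<inter> sphere 0 1|circle. f z)"
    proof (rule lebesgue_integral_countable_add)
      show "set_integrable circle (\<Union>i. A i \<inter> sphere 0 1) f"
        unfolding U[symmetric] by (rule si, rule sets.countable_UN) (use b in blast)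
      show "(A i \<inter> sphere 0 1) \<inter> (A j \<inter> sphere 0 1) = {}" if "i \<noteq> j" for i j
        using disjoint_family_onD[OF union(1) UNIV_I UNIV_I that] by blast
    qed (intro sets_circle_Int b)
    then show ?case unfolding U union.IH by simp
  qed
qed

lemma fourier_null_AE:
  assumes f: "fourier_null f" shows "AE z in circle. f z = 0"
proof (rule circle.density_zero)
  show "integrable circle f" using f by (simp add: fourier_null_def)
  fix A assume "A \<in> sets circle"
  then obtain B where "B \<in> sets borel" "A = B \<inter> sphere 0 1"
    unfolding sets_circle by (auto simp: sets_restrict_space)
  then show "(LINT z:A|circle. f z) = 0" using fourier_null_set_integral[OF f] by simp
qed

lemma Fourier_unique_AE:
  assumes f: "integrable circle f" and g: "integrable circle g" and eq: "\<And>k. fhat f k = fhat g k"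
  shows "AE z in circle. f z = g z"
proof -
  have "fhat (\<lambda>z. f z - g z) k = fhat f k - fhat g k" for k
    unfolding fhat_def ip_def left_diff_distrib
    by (intro Bochner_Integration.integral_diff integrable_mult_cnj_powi f g)
  then have "fourier_null (\<lambda>z. f z - g z)"
    using f g eq by (simp add: fourier_null_def)
  from fourier_null_AE[OF this] show ?thesis by simp
qed

text \<open>Integrated over a finite measure, this bounds an L^1 norm by \<open>h\<close> and a
  squared L^2 norm; \<open>h\<close> is free to match the size of the latter.\<close>

lemma le_add_sq_div:
  fixes x h :: real assumes "h > 0" shows "x \<le> h + x\<^sup>2 / h"
proof -
  have "x * h \<le> h * h + x\<^sup>2" if "x \<ge> 0"
  proof -
    have "2 * (x * h) \<le> x\<^sup>2 + h * h"
      using sum_squares_bound[of x h] by (simp add: power2_eq_square mult.assoc)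
    moreover have "0 \<le> x * h" using that assms by simp
    ultimately show ?thesis by linarith
  qed
  moreover have "x \<le> h + x\<^sup>2 / h" if "x < 0"
    using that assms by (smt (verit) divide_nonneg_pos zero_le_power2)
  ultimately show ?thesis using assms by (cases "x \<ge> 0") (auto simp: field_simps)
qed

text \<open>A rapidly converging subsequence has increments summable in L^1, hence converges almost
  everywhere; Fatou then upgrades this to L^2 convergence of all partial sums.\<close>

lemma Riesz_Fischer:
  assumes c: "wsummable W0 c"
  obtains g where "g \<in> L2" "(\<lambda>N. nsq (\<lambda>z. psum c N z - g z)) \<longlonglongrightarrow> 0"
proof -
  define T where "T M = wsq W0 (\<lambda>n. seq_trunc M c n - c n)" for M
  have T0: "T \<longlonglongrightarrow> 0"
    using wtendsto_seq_trunc[OF W_nonneg(1) c] by (simp add: wtendsto_def T_def[abs_def])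
  have ex: "\<exists>M\<ge>K. T M \<le> (1/4) ^ j" for K j
  proof -
    have "\<forall>\<^sub>F M in sequentially. T M < (1/4) ^ j"
      by (rule order_tendstoD(2)[OF T0]) simp
    then have "\<forall>\<^sub>F M in sequentially. M \<ge> K \<and> T M \<le> (1/4) ^ j"
      using eventually_ge_at_top[of K] by eventually_elim auto
    then show ?thesis by (auto simp: eventually_sequentially)
  qed
  \<comment> \<open>With \<open>h = (1/2) ^ j\<close> in \<open>le_add_sq_div\<close>, a tail of
    size \<open>(1/4) ^ j\<close> leaves the summable bound \<open>(1/2) ^ j\<close>.\<close>
  have "\<exists>r. \<forall>j. T (r j) \<le> (1/4) ^ j \<and> Suc (r j) \<le> r (Suc j)"
  proof (rule dependent_nat_choice)
    show "\<exists>x. T x \<le> (1/4) ^ 0" using ex[of 0 0] by blast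
    show "\<exists>y. T y \<le> (1/4) ^ Suc j \<and> Suc x \<le> y" for x j using ex[of "Suc x" "Suc j"] by blast
  qed
  then obtain r where r: "\<And>j. T (r j) \<le> (1/4) ^ j" "\<And>j. r j < r (Suc j)" by (auto simp: Suc_le_eq)
  have mono: "strict_mono r" using r(2) by (simp add: strict_mono_Suc_iff)
  define d where "d j z = psum c (r (Suc j)) z - psum c (r j) z" for j z
  define m where "m = measure circle (space circle)"
  have dL: "d j \<in> L2" for j unfolding d_def[abs_def] by (intro L2_diff psum_L2)
  note [measurable] = L2_measurable[OF dL] L2_measurable[OF psum_L2]
  have d: "(LINT z|circle. cmod (d j z)) \<le> (m + 1) * (1/2) ^ j" for j
  proof -
    have "(LINT z|circle. cmod (d j z)) \<le> (LINT z|circle. (1/2) ^ j + (cmod (d j z))\<^sup>2 / (1/2) ^ j)"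
    proof (rule integral_mono)
      show "integrable circle (\<lambda>z. (1/2) ^ j + (cmod (d j z))\<^sup>2 / (1/2) ^ j)"
        using L2_integrable_sq[OF dL] by auto
    qed (use L2_integrable[OF dL] le_add_sq_div[of "(1/2) ^ j"] in auto)
    also have "\<dots> = (1/2) ^ j * m + nsq (d j) / (1/2) ^ j"
      using L2_integrable_sq[OF dL] by (simp add: nsq_def m_def del: space_circle)
    also have "\<dots> \<le> (1/2) ^ j * m + (1/4) ^ j / (1/2) ^ j"
    proof (intro add_left_mono divide_right_mono)
      have "nsq (d j) \<le> T (r j)"
        unfolding d_def T_def by (rule nsq_psum_diff[OF c]) (use r(2)[of j] in simp)
      then show "nsq (d j) \<le> (1/4) ^ j" using r(1) order_trans by blast
    qed simp
    also have "(1/4) ^ j / (1/2) ^ j = (1/2 :: real) ^ j"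
      by (simp add: power_divide[symmetric])
    finally show ?thesis by (simp add: algebra_simps)
  qed
  have "(\<integral>\<^sup>+z. (\<Sum>j. ennreal (cmod (d j z))) \<partial>circle) = (\<Sum>j. \<integral>\<^sup>+z. ennreal (cmod (d j z)) \<partial>circle)"
    by (intro nn_integral_suminf) measurable
  also have "\<dots> = (\<Sum>j. ennreal (LINT z|circle. cmod (d j z)))"
    by (intro suminf_cong nn_integral_eq_integral integrable_norm L2_integrable dL) auto
  also have "\<dots> \<noteq> top"
  proof (rule ennreal_suminf_neq_top)
    show "summable (\<lambda>j. LINT z|circle. cmod (d j z))"
    proof (rule summable_comparison_test'[where N = 0])
      show "summable (\<lambda>j. (m + 1) * (1/2) ^ j)" by (intro summable_mult summable_geometric) simp
    qed (use d in \<open>simp add: integral_nonneg_AE\<close>)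
  qed (simp add: integral_nonneg_AE)
  finally have "AE z in circle. (\<Sum>j. ennreal (cmod (d j z))) \<noteq> \<infinity>"
    by (intro nn_integral_PInf_AE) auto
  then have conv: "AE z in circle. convergent (\<lambda>J. psum c (r J) z)"
  proof eventually_elim
    case (elim z)
    then have "summable (\<lambda>j. cmod (d j z))" by (intro summable_suminf_not_top) auto
    then have "summable (\<lambda>j. d j z)" by (rule summable_norm_cancel)
    then have "convergent (\<lambda>J. \<Sum>j<J. d j z)" by (simp add: summable_iff_convergent)
    moreover have "(\<Sum>j<J. d j z) = psum c (r J) z - psum c (r 0) z" for J
      unfolding d_def by (rule sum_lessThan_telescope)
    ultimately show ?case by (simp add: convergent_diff_const_right_iff)
  qed
  define g where "g z = lim (\<lambda>J. psum c (r J) z)" for z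
  have gm [measurable]: "g \<in> borel_measurable circle"
    unfolding g_def[abs_def] by (rule borel_measurable_lim_metric) measurable
  \<comment> \<open>The limit runs along the subsequence while \<open>N\<close> is arbitrary: from
    \<open>J \<ge> N\<close> on, \<open>r J \<ge> N\<close>, so the tail \<open>T N\<close> bounds
    every approximant.\<close>
  have fatou: "(\<integral>\<^sup>+z. ennreal ((cmod (psum c N z - g z))\<^sup>2) \<partial>circle) \<le> ennreal (T N)" for N
  proof -
    have "(\<integral>\<^sup>+z. ennreal ((cmod (psum c N z - g z))\<^sup>2) \<partial>circle) \<le>
        (\<integral>\<^sup>+z. liminf (\<lambda>J. ennreal ((cmod (psum c N z - psum c (r J) z))\<^sup>2)) \<partial>circle)"
    proof (rule nn_integral_mono_AE)
      show "AE z in circle. ennreal ((cmod (psum c N z - g z))\<^sup>2) \<le>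
          liminf (\<lambda>J. ennreal ((cmod (psum c N z - psum c (r J) z))\<^sup>2))"
        using conv
      proof eventually_elim
        case (elim z)
        then have "(\<lambda>J. psum c (r J) z) \<longlonglongrightarrow> g z" by (simp add: g_def convergent_LIMSEQ_iff)
        then have "(\<lambda>J. ennreal ((cmod (psum c N z - psum c (r J) z))\<^sup>2)) \<longlonglongrightarrow>
            ennreal ((cmod (psum c N z - g z))\<^sup>2)"
          by (intro tendsto_intros tendsto_ennrealI)
        from lim_imp_Liminf[OF trivial_limit_sequentially this] show ?case by (simp only: order_refl)
      qed
    qed
    also have "\<dots> \<le> liminf (\<lambda>J. \<integral>\<^sup>+z. ennreal ((cmod (psum c N z - psum c (r J) z))\<^sup>2) \<partial>circle)"
      by (intro nn_integral_liminf) measurable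
    also have "\<dots> \<le> ennreal (T N)"
    proof (rule Liminf_le)
      show "\<forall>\<^sub>F J in sequentially. (\<integral>\<^sup>+z. ennreal ((cmod (psum c N z - psum c (r J) z))\<^sup>2) \<partial>circle) \<le> ennreal (T N)"
        using eventually_ge_at_top[of N]
      proof eventually_elim
        case (elim J)
        then have NJ: "N \<le> r J" using strict_mono_imp_increasing[OF mono, of J] by simp
        have "(\<integral>\<^sup>+z. ennreal ((cmod (psum c N z - psum c (r J) z))\<^sup>2) \<partial>circle) =
            ennreal (nsq (\<lambda>z. psum c N z - psum c (r J) z))"
          unfolding nsq_def
          by (intro nn_integral_eq_integral L2_integrable_sq L2_diff psum_L2) auto
        also have "nsq (\<lambda>z. psum c N z - psum c (r J) z) = nsq (\<lambda>z. psum c (r J) z - psum c N z)"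
          by (simp add: nsq_def norm_minus_commute)
        also have "ennreal \<dots> \<le> ennreal (T N)"
          unfolding T_def by (intro ennreal_leI nsq_psum_diff c NJ)
        finally show ?case .
      qed
    qed simp
    finally show ?thesis .
  qed
  have pg: "(\<lambda>z. psum c N z - g z) \<in> L2" for N
  proof -
    have "integrable circle (\<lambda>z. (cmod (psum c N z - g z))\<^sup>2)"
      unfolding integrable_iff_bounded using fatou[of N] by (auto simp: ennreal_less_top intro: le_less_trans)
    then show ?thesis by (simp add: L2_def)
  qed
  \<comment> \<open>The case \<open>N = 0\<close>, where the partial sum is zero.\<close>
  have "g \<in> L2" using L2_cmult[OF pg[of 0], of "-1"] by (simp add: psum_def)
  moreover have "(\<lambda>N. nsq (\<lambda>z. psum c N z - g z)) \<longlonglongrightarrow> 0"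
  proof (rule tendsto_sandwich[OF _ _ tendsto_const T0])
    have "nsq (\<lambda>z. psum c N z - g z) \<le> T N" for N
    proof -
      have "ennreal (nsq (\<lambda>z. psum c N z - g z)) = (\<integral>\<^sup>+z. ennreal ((cmod (psum c N z - g z))\<^sup>2) \<partial>circle)"
        unfolding nsq_def by (intro nn_integral_eq_integral[symmetric] L2_integrable_sq pg) auto
      then have "ennreal (nsq (\<lambda>z. psum c N z - g z)) \<le> ennreal (T N)" using fatou by simp
      moreover have "T N \<ge> 0"
        unfolding T_def by (intro wsq_nonneg wsq_diff(1) seq_trunc_summable c) auto
      ultimately show ?thesis by simp
    qed
    then show "\<forall>\<^sub>F N in sequentially. nsq (\<lambda>z. psum c N z - g z) \<le> T N" by simp
  qed simp
  ultimately show ?thesis by (rule that)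
qed

section \<open>Fourier coefficients of the Szego projection\<close>

definition fcoeff :: "(complex \<Rightarrow> complex) \<Rightarrow> nat \<Rightarrow> complex" where
  "fcoeff f n = fhat f (int n)"

lemma fcoeff_eq_ip: "fcoeff f n = ip f (\<lambda>z. z ^ n)"
  by (simp add: fcoeff_def fhat_def)

lemma fhat_AE_cong:
  assumes "f \<in> borel_measurable circle" "g \<in> borel_measurable circle" "AE z in circle. f z = g z"
  shows "fhat f k = fhat g k"
proof -
  have [measurable]: "(\<lambda>z. cnj (z powi k)) \<in> borel_measurable circle"
    by (rule L2_measurable[OF L2_cnj[OF L2_powi]])
  note [measurable] = assms(1,2)
  show ?thesis
    unfolding fhat_def ip_def
    by (rule integral_cong_AE) (measurable, use assms(3) in \<open>auto simp del: complex_cnj_power_int\<close>)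
qed

lemma fhat_psum_limit:
  assumes "g \<in> L2" "(\<lambda>N. nsq (\<lambda>z. psum c N z - g z)) \<longlonglongrightarrow> 0"
  shows "fhat g k = (if k \<ge> 0 then c (nat k) else 0)"
proof -
  have "(\<lambda>N. fhat (psum c N) k) \<longlonglongrightarrow> fhat g k"
    unfolding fhat_def by (rule tendsto_ip_left) (use assms in auto)
  moreover have "\<forall>\<^sub>F N in sequentially. fhat (psum c N) k = (if k \<ge> 0 then c (nat k) else 0)"
    using eventually_gt_at_top[of "nat k"] by eventually_elim (simp add: fhat_psum)
  then have "(\<lambda>N. fhat (psum c N) k) \<longlonglongrightarrow> (if k \<ge> 0 then c (nat k) else 0)"
    by (rule tendsto_eventually)
  ultimately show ?thesis by (rule LIMSEQ_unique)
qed

lemma Riesz_Fischer_plus: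
  assumes "wsummable W0 c"
  shows "\<exists>g. g \<in> plus_part L2 \<and> fcoeff g = c \<and>
    (\<forall>k. fhat g k = (if k \<ge> 0 then c (nat k) else 0)) \<and>
    (\<lambda>N. nsq (\<lambda>z. psum c N z - g z)) \<longlonglongrightarrow> 0"
proof (rule Riesz_Fischer[OF assms])
  fix g assume g: "g \<in> L2" "(\<lambda>N. nsq (\<lambda>z. psum c N z - g z)) \<longlonglongrightarrow> 0"
  note f = fhat_psum_limit[OF g]
  show ?thesis
    by (rule exI[of _ g]) (use g f in \<open>auto simp: plus_part_def fcoeff_def fun_eq_iff\<close>)
qed

lemma Bessel:
  assumes h: "h \<in> L2" shows "wsummable W0 (fcoeff h)"
proof (rule wsummable_boundI(1))
  fix N
  let ?P = "psum (fcoeff h) N"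
  let ?S = "\<Sum>n<N. (cmod (fcoeff h n))\<^sup>2"
  have Ph: "ip ?P h = of_real ?S"
    unfolding ip_psum_left[OF h] fcoeff_def[symmetric] of_real_sum complex_norm_square ..
  have hP: "ip h ?P = of_real ?S" using ip_cnj[of ?P h] Ph by simp
  have "complex_of_real (nsq (\<lambda>z. ?P z - h z)) = ip ?P ?P - ip ?P h - (ip h ?P - ip h h)"
    unfolding ip_self[symmetric] by (simp add: ip_diff_left ip_diff_right L2_diff h)
  also have "\<dots> = of_real (nsq h - ?S)"
    unfolding Ph hP ip_self nsq_psum by simp
  finally have "nsq (\<lambda>z. ?P z - h z) = nsq h - ?S" by (simp only: of_real_eq_iff)
  then have "?S \<le> nsq h" using nsq_nonneg[of "\<lambda>z. ?P z - h z"] by linarith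
  then show "(\<Sum>n<N. W0 n * (cmod (fcoeff h n))\<^sup>2) \<le> nsq h" by (simp add: W0_def)
qed simp

lemma plus_part_L2: "h \<in> plus_part L2 \<Longrightarrow> h \<in> L2"
  by (simp add: plus_part_def)

text \<open>The Riesz-Fischer limit of the partial sums has all Fourier coefficients in common with
  \<open>h\<close>, so uniqueness identifies the two almost everywhere.\<close>

lemma psum_tendsto:
  assumes h: "h \<in> plus_part L2"
  shows "(\<lambda>N. nsq (\<lambda>z. psum (fcoeff h) N z - h z)) \<longlonglongrightarrow> 0"
proof -
  have hL: "h \<in> L2" using h by (rule plus_part_L2)
  obtain g where g: "g \<in> plus_part L2" "fcoeff g = fcoeff h"
    "\<And>k. fhat g k = (if k \<ge> 0 then fcoeff h (nat k) else 0)"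
    "(\<lambda>N. nsq (\<lambda>z. psum (fcoeff h) N z - g z)) \<longlonglongrightarrow> 0"
    using Riesz_Fischer_plus[OF Bessel[OF hL]] by auto
  have gL: "g \<in> L2" using g(1) by (rule plus_part_L2)
  have "fhat g k = fhat h k" for k
    using h by (auto simp: g(3) fcoeff_def plus_part_def)
  then have ae: "AE z in circle. g z = h z"
    by (intro Fourier_unique_AE L2_integrable gL hL)
  note [measurable] = L2_measurable[OF gL] L2_measurable[OF hL] L2_measurable[OF psum_L2]
  have "nsq (\<lambda>z. psum (fcoeff h) N z - g z) = nsq (\<lambda>z. psum (fcoeff h) N z - h z)" for N
    unfolding nsq_def by (rule integral_cong_AE) (measurable, use ae in auto)
  then show ?thesis using g(4) by simp
qed

text \<open>The coefficient is the inner product of \<open>u\<close> with \<open>h\<close> times a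
  power of z. That power has modulus 1, so \<open>h\<close> may be replaced by its partial sums
  although the product need not lie in \<open>L2\<close>.\<close>

lemma fcoeff_mult_cnj:
  assumes u: "u \<in> plus_part L2" and h: "h \<in> plus_part L2"
  shows "fcoeff (\<lambda>z. u z * cnj (h z)) n = shankel (fcoeff u) (fcoeff h) n"
proof -
  note L = u[THEN plus_part_L2] h[THEN plus_part_L2]
  have "fcoeff (\<lambda>z. u z * cnj (h z)) n = ip u (\<lambda>z. h z * z powi int n)"
    by (simp add: fcoeff_eq_ip ip_def mult.assoc)
  moreover have "(\<lambda>N. ip u (\<lambda>z. psum (fcoeff h) N z * z powi int n)) \<longlonglongrightarrow> ip u (\<lambda>z. h z * z powi int n)"
  proof (rule tendsto_ip_right)
    have "nsq (\<lambda>z. psum (fcoeff h) N z * z powi int n - h z * z powi int n) =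
        nsq (\<lambda>z. psum (fcoeff h) N z - h z)" for N
      using nsq_mult_powi[of "\<lambda>z. psum (fcoeff h) N z - h z" "int n"] by (simp add: left_diff_distrib)
    then show "(\<lambda>N. nsq (\<lambda>z. psum (fcoeff h) N z * z powi int n - h z * z powi int n)) \<longlonglongrightarrow> 0"
      using psum_tendsto[OF h] by simp
  qed (intro L2_mult_powi L psum_L2)+
  moreover have "ip u (\<lambda>z. psum (fcoeff h) N z * z powi int n) = (\<Sum>l<N. fcoeff u (n + l) * cnj (fcoeff h l))" for N
  proof -
    have "ip (\<lambda>z. psum (fcoeff h) N z * z powi int n) u = ip (\<lambda>z. \<Sum>l<N. fcoeff h l * z ^ (n + l)) u"
      unfolding psum_def power_int_of_nat sum_distrib_right
      by (simp add: power_add mult_ac)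
    also have "\<dots> = (\<Sum>l<N. fcoeff h l * ip (\<lambda>z. z ^ (n + l)) u)"
      by (rule ip_sum_left) (use L in auto)
    also have "\<dots> = (\<Sum>l<N. fcoeff h l * cnj (fcoeff u (n + l)))"
      by (simp add: fcoeff_eq_ip ip_cnj)
    finally have "cnj (ip (\<lambda>z. psum (fcoeff h) N z * z powi int n) u) = (\<Sum>l<N. fcoeff u (n + l) * cnj (fcoeff h l))"
      by (simp add: mult.commute)
    then show ?thesis by (simp only: ip_cnj)
  qed
  ultimately have "(\<lambda>l. fcoeff u (n + l) * cnj (fcoeff h l)) sums fcoeff (\<lambda>z. u z * cnj (h z)) n"
    by (simp add: sums_def)
  then show ?thesis by (simp add: shankel_def sums_iff)
qed

lemma fhat_mult:
  assumes u: "u \<in> plus_part L2" and v: "v \<in> plus_part L2"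
  shows "fhat (\<lambda>z. u z * v z) k = (if k \<ge> 0 then sconv (fcoeff u) (fcoeff v) (nat k) else 0)"
proof -
  note L = u[THEN plus_part_L2] v[THEN plus_part_L2]
  let ?w = "\<lambda>z. cnj (v z) * z powi k"
  have w: "?w \<in> L2" by (intro L2_mult_powi L2_cnj L)
  have e1: "fhat (\<lambda>z. u z * v z) k = ip u ?w"
    by (simp add: fhat_def ip_def mult.assoc)
  have e2: "(\<lambda>N. ip (psum (fcoeff u) N) ?w) \<longlonglongrightarrow> ip u ?w"
    by (intro tendsto_ip_left w L psum_L2 psum_tendsto u)
  have "\<forall>\<^sub>F N in sequentially. ip (psum (fcoeff u) N) ?w = (if k \<ge> 0 then sconv (fcoeff u) (fcoeff v) (nat k) else 0)"
    using eventually_gt_at_top[of "nat k"]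
  proof eventually_elim
    case (elim N)
    \<comment> \<open>Conjugation reflects the index. As \<open>v\<close> has no negative
      coefficients, only \<open>l \<le> k\<close> contributes, and nothing does for negative
      \<open>k\<close>.\<close>
    have c: "fhat ?w l = cnj (fhat v (k - l))" for l
    proof -
      have "cnj (fhat ?w l) = fhat v (k - l)"
        unfolding fhat_def ip_def Bochner_Integration.integral_cnj[symmetric]
      proof (rule Bochner_Integration.integral_cong[OF refl])
        fix z assume "z \<in> space circle"
        then have z: "cmod z = 1" by simp
        show "cnj (?w z * cnj (z powi l)) = v z * cnj (z powi (k - l))"
          unfolding complex_cnj_mult complex_cnj_cnj cnj_powi_circle[OF z]
          using powi_add_circle[OF z, of "-k" l] by simp
      qed
      then show ?thesis by (metis complex_cnj_cnj)
    qed
    have "ip (psum (fcoeff u) N) ?w = (\<Sum>l<N. fcoeff u l * fhat v (k - int l))"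
      by (simp add: ip_psum_left[OF w] c)
    also have "\<dots> = (if k \<ge> 0 then sconv (fcoeff u) (fcoeff v) (nat k) else 0)"
    proof (cases "k \<ge> 0")
      case True
      have "(\<Sum>l<N. fcoeff u l * fhat v (k - int l)) = (\<Sum>l\<le>nat k. fcoeff u l * fcoeff v (nat k - l))"
        by (rule sum.mono_neutral_cong_right)
           (use elim True v in \<open>auto simp: fcoeff_def plus_part_def of_nat_diff\<close>)
      then show ?thesis using True by (simp add: sconv_def)
    next
      case False
      then show ?thesis using v by (simp add: plus_part_def)
    qed
    finally show ?case .
  qed
  then have e3: "(\<lambda>N. ip (psum (fcoeff u) N) ?w) \<longlonglongrightarrow> (if k \<ge> 0 then sconv (fcoeff u) (fcoeff v) (nat k) else 0)"
    by (rule tendsto_eventually)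
  show ?thesis unfolding e1 by (rule LIMSEQ_unique[OF e2 e3])
qed

text \<open>Riesz-Fischer provides a witness for the \<open>SOME\<close>. Either branch of
  \<open>is_szego_proj\<close> fixes the coefficients of nonnegative index, in the \<open>L2\<close>
  case by testing with powers of z, so the choice does not matter.\<close>

lemma szego_proj_fcoeff:
  assumes c: "wsummable W0 c" and f: "fcoeff f = c"
  shows "szego_proj f \<in> plus_part L2" "fcoeff (szego_proj f) = c"
proof -
  obtain g where g: "g \<in> plus_part L2" "fcoeff g = c"
    using Riesz_Fischer_plus[OF c] by auto
  have "is_szego_proj f g"
  proof (cases "f \<in> L2")
    case True
    have fg: "(\<lambda>z. f z - g z) \<in> L2" by (intro L2_diff True plus_part_L2 g)
    have "ip (\<lambda>z. f z - g z) h = 0" if h: "h \<in> plus_part L2" for h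
    proof -
      have "fcoeff (\<lambda>z. f z - g z) n = 0" for n
        using fun_cong[OF f, of n] fun_cong[OF g(2), of n] True plus_part_L2[OF g(1)]
        by (simp add: fcoeff_eq_ip ip_diff_left)
      then have "ip (psum (fcoeff h) N) (\<lambda>z. f z - g z) = 0" for N
        by (simp add: ip_psum_left[OF fg] fcoeff_def)
      moreover have "(\<lambda>N. ip (psum (fcoeff h) N) (\<lambda>z. f z - g z)) \<longlonglongrightarrow> ip h (\<lambda>z. f z - g z)"
        by (intro tendsto_ip_left psum_tendsto h plus_part_L2[OF h] fg psum_L2)
      ultimately have "ip h (\<lambda>z. f z - g z) = 0" by (simp add: LIMSEQ_const_iff)
      then show ?thesis using ip_cnj[of h "\<lambda>z. f z - g z"] by simp
    qed
    then show ?thesis using True g by (simp add: is_szego_proj_def)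
  next
    case False
    have "fhat g k = fhat f k" if "k \<ge> 0" for k
      using fun_cong[OF f, of "nat k"] fun_cong[OF g(2), of "nat k"] that by (simp add: fcoeff_def)
    then show ?thesis using False g by (simp add: is_szego_proj_def)
  qed
  then have P: "is_szego_proj f (szego_proj f)"
    unfolding szego_proj_def by (rule someI[of "is_szego_proj f"])
  then show p: "szego_proj f \<in> plus_part L2" by (simp add: is_szego_proj_def)
  show "fcoeff (szego_proj f) = c"
  proof
    fix n
    show "fcoeff (szego_proj f) n = c n"
    proof (cases "f \<in> L2")
      case True
      have "(\<lambda>z. z ^ n) \<in> plus_part L2" by (auto simp: plus_part_def fhat_power)
      then have "ip (\<lambda>z. f z - szego_proj f z) (\<lambda>z. z ^ n) = 0"
        using P True unfolding is_szego_proj_def by auto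
      then have "fcoeff f n = fcoeff (szego_proj f) n"
        using True plus_part_L2[OF p] by (simp add: fcoeff_eq_ip ip_diff_left)
      then show ?thesis using f by simp
    next
      case False
      then have "fhat (szego_proj f) (int n) = fhat f (int n)"
        using P by (simp add: is_szego_proj_def)
      then show ?thesis using f by (auto simp: fcoeff_def)
    qed
  qed
qed

text \<open>\<open>shankel_10\<close> keeps each iterate square summable, as
  \<open>szego_proj_fcoeff\<close> requires.\<close>

lemma hankel_iterate:
  assumes u: "u \<in> plus_part L2" and a: "wsummable W1 (fcoeff u)"
  shows "(hankel u ^^ j) (\<lambda>_. 1) \<in> plus_part L2 \<and> fcoeff ((hankel u ^^ j) (\<lambda>_. 1)) = hankel_orbit (fcoeff u) j"
proof (induction j)
  case 0
  have "fhat (\<lambda>_. 1) k = (if k = 0 then 1 else 0)" for k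
    using fhat_power[of 0 k] by auto
  moreover have "(\<lambda>_. 1) \<in> L2" using L2_power[of 0] by simp
  ultimately show ?case by (auto simp: plus_part_def fcoeff_def)
next
  case (Suc j)
  let ?h = "(hankel u ^^ j) (\<lambda>_. 1)"
  have h: "?h \<in> plus_part L2" "fcoeff ?h = hankel_orbit (fcoeff u) j" using Suc by auto
  have c: "fcoeff (\<lambda>z. u z * cnj (?h z)) = shankel (fcoeff u) (hankel_orbit (fcoeff u) j)"
    using fcoeff_mult_cnj[OF u h(1)] h(2) by (simp add: fun_eq_iff)
  have "wsummable W0 (shankel (fcoeff u) (hankel_orbit (fcoeff u) j))"
    by (rule shankel_10) (use a Bessel[OF plus_part_L2[OF h(1)]] h(2) in auto)
  from szego_proj_fcoeff[OF this c] show ?case by (simp add: hankel_def[of u ?h])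
qed

lemma J_eq_hankel_orbit:
  assumes "u \<in> plus_part L2" "wsummable W1 (fcoeff u)"
  shows "J n u = hankel_orbit (fcoeff u) n 0"
proof -
  have "J n u = fcoeff ((hankel u ^^ n) (\<lambda>_. 1)) 0" by (simp add: J_def fcoeff_eq_ip)
  then show ?thesis using hankel_iterate[OF assms, of n] by simp
qed

text \<open>To apply \<open>fcoeff_mult_cnj\<close> to u^2 times the conjugate of u, u^2 must be
  replaced by an element of \<open>plus_part L2\<close>. It is built from the coefficients of u^2
  and agrees with u^2 almost everywhere by uniqueness for integrable functions.\<close>

lemma fcoeff_szego_nonlinearity:
  assumes u: "u \<in> plus_part L2" and a: "wsummable W1 (fcoeff u)"
  shows "fcoeff (szego_proj (\<lambda>z. complex_of_real ((cmod (u z))\<^sup>2) * u z)) = szego_field (fcoeff u)"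
proof (rule szego_proj_fcoeff(2)[OF wsummable_szego_field[OF a]])
  have uL: "u \<in> L2" using u by (rule plus_part_L2)
  have "wsummable W0 (sconv (fcoeff u) (fcoeff u))"
    by (intro wsummable_weaken(2) sconv_11 a)
  from Riesz_Fischer_plus[OF this] obtain w where w: "w \<in> plus_part L2" "fcoeff w = sconv (fcoeff u) (fcoeff u)"
    "\<And>k. fhat w k = (if k \<ge> 0 then sconv (fcoeff u) (fcoeff u) (nat k) else 0)"
    by auto
  have wL: "w \<in> L2" using w(1) by (rule plus_part_L2)
  have ae: "AE z in circle. u z * u z = w z"
    by (rule Fourier_unique_AE[OF L2_mult_integrable[OF uL uL] L2_integrable[OF wL]])
       (simp add: fhat_mult[OF u u] w(3))
  note [measurable] = L2_measurable[OF uL] L2_measurable[OF wL] L2_measurable[OF L2_cnj[OF uL]]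
  have "fcoeff (\<lambda>z. complex_of_real ((cmod (u z))\<^sup>2) * u z) n = fcoeff (\<lambda>z. w z * cnj (u z)) n" for n
    unfolding fcoeff_def
  proof (rule fhat_AE_cong)
    show "AE z in circle. complex_of_real ((cmod (u z))\<^sup>2) * u z = w z * cnj (u z)"
      using ae
    proof eventually_elim
      case (elim z)
      then show ?case unfolding complex_norm_square elim[symmetric] by (simp add: mult_ac)
    qed
  qed measurable
  then show "fcoeff (\<lambda>z. complex_of_real ((cmod (u z))\<^sup>2) * u z) = szego_field (fcoeff u)"
    using fcoeff_mult_cnj[OF w(1) u] by (simp add: fun_eq_iff szego_field_def w(2))
qed

section \<open>From the function spaces to weighted sequences, and conclusion\<close>

lemma H_half_fcoeff:
  assumes f: "f \<in> H_half"
  shows "wsummable W1 (fcoeff f)" "wsq W1 (fcoeff f) \<le> sqrt 2 * (H_half_norm f)\<^sup>2"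
proof -
  let ?F = "\<lambda>k::int. sqrt (1 + (real_of_int k)\<^sup>2) * (cmod (fhat f k))\<^sup>2"
  have s: "?F summable_on UNIV" using f by (simp add: H_half_def)
  have "(H_half_norm f)\<^sup>2 = infsum ?F UNIV"
    unfolding H_half_norm_def by (intro real_sqrt_pow2 infsum_nonneg) auto
  moreover have "(\<Sum>n<N. W1 n * (cmod (fcoeff f n))\<^sup>2) \<le> sqrt 2 * infsum ?F UNIV" for N
  proof -
    \<comment> \<open>The constant comes from (n + 1)^2 <= 2 (1 + n^2).\<close>
    have "W1 n \<le> sqrt 2 * sqrt (1 + (real n)\<^sup>2)" for n
      unfolding W1_def real_sqrt_mult[symmetric]
      by (rule real_le_rsqrt) (use sum_squares_bound[of "real n" 1] in \<open>simp add: power2_eq_square algebra_simps\<close>)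
    then have "(\<Sum>n<N. W1 n * (cmod (fcoeff f n))\<^sup>2) \<le> (\<Sum>n<N. (sqrt 2 * sqrt (1 + (real n)\<^sup>2)) * (cmod (fcoeff f n))\<^sup>2)"
      by (intro sum_mono mult_right_mono) auto
    also have "\<dots> = sqrt 2 * (\<Sum>k\<in>int ` {..<N}. ?F k)"
      by (subst sum.reindex) (simp_all add: sum_distrib_left fcoeff_def mult.assoc)
    also have "\<dots> \<le> sqrt 2 * infsum ?F UNIV"
      by (intro mult_left_mono finite_sum_le_infsum s) auto
    finally show ?thesis .
  qed
  ultimately show "wsummable W1 (fcoeff f)" "wsq W1 (fcoeff f) \<le> sqrt 2 * (H_half_norm f)\<^sup>2"
    using wsummable_boundI[of W1 "fcoeff f"] by auto
qed

text \<open>An \<open>infsum\<close> that does not exist is 0, so a small \<open>H_half_norm\<close>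
  of a difference is informative only once membership is known.\<close>

lemma H_half_diff:
  assumes f: "f \<in> H_half" and g: "g \<in> H_half"
  shows "(\<lambda>z. f z - g z) \<in> H_half"
proof -
  have L: "f \<in> L2" "g \<in> L2" using f g by (auto simp: H_half_def)
  let ?w = "\<lambda>k::int. sqrt (1 + (real_of_int k)\<^sup>2)"
  have "(\<lambda>k. 2 * (?w k * (cmod (fhat f k))\<^sup>2) + 2 * (?w k * (cmod (fhat g k))\<^sup>2)) summable_on UNIV"
    using f g by (intro summable_on_add summable_on_cmult_right) (auto simp: H_half_def)
  note S = iffD1[OF summable_on_iff_abs_summable_on_real this]
  have "(\<lambda>k. norm (?w k * (cmod (fhat (\<lambda>z. f z - g z) k))\<^sup>2)) summable_on UNIV"
  proof (rule Infinite_Sum.abs_summable_on_comparison_test[OF S])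
    fix k
    have "fhat (\<lambda>z. f z - g z) k = fhat f k + - fhat g k"
      unfolding fhat_def by (simp add: ip_diff_left L)
    then have "(cmod (fhat (\<lambda>z. f z - g z) k))\<^sup>2 \<le> 2 * (cmod (fhat f k))\<^sup>2 + 2 * (cmod (fhat g k))\<^sup>2"
      using cmod_add_sq_le[of "fhat f k" "- fhat g k"] by simp
    then have "?w k * (cmod (fhat (\<lambda>z. f z - g z) k))\<^sup>2 \<le>
        ?w k * (2 * (cmod (fhat f k))\<^sup>2 + 2 * (cmod (fhat g k))\<^sup>2)"
      by (rule mult_left_mono) simp
    also have "\<dots> = 2 * (?w k * (cmod (fhat f k))\<^sup>2) + 2 * (?w k * (cmod (fhat g k))\<^sup>2)"
      by (simp add: algebra_simps)
    finally show "norm (?w k * (cmod (fhat (\<lambda>z. f z - g z) k))\<^sup>2) \<le>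
        norm (2 * (?w k * (cmod (fhat f k))\<^sup>2) + 2 * (?w k * (cmod (fhat g k))\<^sup>2))"
      by simp
  qed
  then have "(\<lambda>k. ?w k * (cmod (fhat (\<lambda>z. f z - g z) k))\<^sup>2) summable_on UNIV"
    by (rule iffD2[OF summable_on_iff_abs_summable_on_real])
  then show ?thesis using L2_diff[OF L] by (simp add: H_half_def)
qed

lemma continuous_into_H_half_plus_fcoeff:
  assumes "continuous_into_H_half_plus u"
  shows "wtendsto W1 (\<lambda>s. fcoeff (u s)) (fcoeff (u t)) (at t)"
proof -
  have H: "u s \<in> H_half" for s
    using assms by (simp add: continuous_into_H_half_plus_def plus_part_def)
  have lim: "((\<lambda>s. H_half_norm (\<lambda>z. u s z - u t z)) \<longlongrightarrow> 0) (at t)"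
    using assms by (simp add: continuous_into_H_half_plus_def)
  have L: "u s \<in> L2" for s using H by (simp add: H_half_def)
  have eq: "(\<lambda>n. fcoeff (u s) n - fcoeff (u t) n) = fcoeff (\<lambda>z. u s z - u t z)" for s
    by (simp add: fun_eq_iff fcoeff_eq_ip ip_diff_left L)
  have "((\<lambda>s. sqrt 2 * (H_half_norm (\<lambda>z. u s z - u t z))\<^sup>2) \<longlongrightarrow> sqrt 2 * 0\<^sup>2) (at t)"
    by (intro tendsto_intros lim)
  then have l: "((\<lambda>s. sqrt 2 * (H_half_norm (\<lambda>z. u s z - u t z))\<^sup>2) \<longlongrightarrow> 0) (at t)" by simp
  have "((\<lambda>s. wsq W1 (\<lambda>n. fcoeff (u s) n - fcoeff (u t) n)) \<longlongrightarrow> 0) (at t)"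
    unfolding eq
    by (rule tendsto_sandwich[OF _ _ tendsto_const l])
       (intro always_eventually allI wsq_nonneg W_nonneg H_half_fcoeff H_half_diff H)+
  then show ?thesis using H_half_fcoeff(1)[OF H] by (simp add: wtendsto_def)
qed

theorem corollary3:
  fixes u :: "real \<Rightarrow> complex \<Rightarrow> complex" and k :: nat
  assumes "continuous_into_H_half_plus u"
    and "solves_szego u"
    and "k > 0"
  shows "\<forall>t. (\<lambda>s. J (2 * k) (u s)) differentiable (at t) \<and>
             vector_derivative (\<lambda>s. J (2 * k) (u s)) (at t) = 0 \<and>
             (\<lambda>s. J (2 * k - 1) (u s)) differentiable (at t) \<and>
             \<i> * vector_derivative (\<lambda>s. J (2 * k - 1) (u s)) (at t) = J (2 * k + 1) (u t)"
proof
  fix t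
  have H: "u s \<in> plus_part H_half" for s
    using assms(1) by (simp add: continuous_into_H_half_plus_def)
  have u: "u s \<in> plus_part L2" and a: "wsummable W1 (fcoeff (u s))" for s
    using H[of s] H_half_fcoeff(1)[of "u s"] by (auto simp: plus_part_def H_half_def)
  have ode: "((\<lambda>s. fcoeff (u s) n) has_vector_derivative (- \<i> * szego_field (fcoeff (u t)) n)) (at t)" for t n
  proof -
    have d: "(\<lambda>s. fcoeff (u s) n) differentiable (at t)"
      and e: "\<i> * vector_derivative (\<lambda>s. fcoeff (u s) n) (at t) = szego_field (fcoeff (u t)) n"
      using assms(2) fun_cong[OF fcoeff_szego_nonlinearity[OF u a], of t n]
      by (simp_all add: solves_szego_def fcoeff_def)
    have "- \<i> * szego_field (fcoeff (u t)) n = vector_derivative (\<lambda>s. fcoeff (u s) n) (at t)"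
      unfolding e[symmetric] by simp
    then show ?thesis using d by (simp only: vector_derivative_works)
  qed
  have D: "((\<lambda>s. J n (u s)) has_vector_derivative (if even n then 0 else - \<i> * J (n + 2) (u t))) (at t)" for n
    unfolding J_eq_hankel_orbit[OF u a]
    by (rule hankel_orbit_has_vector_derivative[OF continuous_into_H_half_plus_fcoeff[OF assms(1)] ode])
  have even: "((\<lambda>s. J (2 * k) (u s)) has_vector_derivative 0) (at t)"
    using D[of "2 * k"] by simp
  \<comment> \<open>Subtraction on \<open>nat\<close> truncates; \<open>k > 0\<close> keeps
    \<open>2 * k - 1\<close> odd.\<close>
  have "odd (2 * k - 1)" "2 * k - 1 + 2 = 2 * k + 1" using \<open>k > 0\<close> by auto
  then have odd: "((\<lambda>s. J (2 * k - 1) (u s)) has_vector_derivative (- \<i> * J (2 * k + 1) (u t))) (at t)"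
    using D[of "2 * k - 1"] by (simp only: if_False)
  show "(\<lambda>s. J (2 * k) (u s)) differentiable (at t) \<and>
             vector_derivative (\<lambda>s. J (2 * k) (u s)) (at t) = 0 \<and>
             (\<lambda>s. J (2 * k - 1) (u s)) differentiable (at t) \<and>
             \<i> * vector_derivative (\<lambda>s. J (2 * k - 1) (u s)) (at t) = J (2 * k + 1) (u t)"
    unfolding vector_derivative_at[OF even] vector_derivative_at[OF odd]
    using differentiableI_vector[OF even] differentiableI_vector[OF odd] by simp
qed

end
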